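(* Fix $p$, $\beta\in\mathbb{R}^p$ and $\Lambda\in\mathbb{R}^{p+}$, let $M=\mathrm{patt}(\beta)$. For each $n\ge p$ let $Y_n=X_n\beta+\varepsilon_n$, where $X_n\in\mathbb{R}^{n\times p}$ is a random design matrix. Assume: (A) $\varepsilon_n=(\epsilon_1,\dots,\epsilon_n)'$, where $(\epsilon_i)_i$ are i.i.d. centered with finite variance; (B') the rows of $X_n$ are independent and each row of $X_n$ has the same law as $\xi$, where $\xi=(\xi_1,\dots,\xi_p)$ is a random vector whose components are linearly independent a.s. and satisfy $\mathbb{E}[\xi_i^2]<\infty$ for $i=1,\dots,p$; (C) $(X_n)_n$ and $(\epsilon_n)_n$ are independent. Let $C=(C_{ij})$ with $C_{ij}=\mathbb{E}[\xi_i\xi_j]$. Let $(\alpha_n)_n$ be a sequence of positive numbers with $$\lim_{n\to\infty}\frac{\alpha_n}{n}=0\quad\text{and}\quad\lim_{n\to\infty}\frac{\alpha_n}{\sqrt{n\log\log n}}=\infty,$$ and let $\hat\beta^{\rm SLOPE}_n\in S_{X_n,\alpha_n\Lambda}(Y_n)$ (almost surely unique for large $n$). If $$CU_M(U_M'CU_M)^{-1}\tilde\Lambda_M\in\mathrm{ri}(\partial J_\Lambda(M)),$$ then the sequence $(\hat\beta^{\rm SLOPE}_n)_n$ almost surely recovers the pattern of $\beta$ asymptotically, i.e. $\mathrm{patt}(\hat\beta^{\rm SLOPE}_n)\to\mathrm{patt}(\beta)$ almost surely.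
   Context: Notation: $A'$ is the transpose, $\mathrm{ri}$ denotes the relative interior of a set (its interior relative to its affine hull), $\|\cdot\|_\infty$ the maximum absolute entry. $\mathbb{R}^{k+}=\{\kappa\in\mathbb{R}^k:\kappa_1>\dots>\kappa_k>0\}$. "Components of $\xi$ linearly independent a.s." means that for every $t\in\mathbb{R}^p\setminus\{0\}$ the random variable $\sum_it_i\xi_i$ is not almost surely equal to $0$; equivalently, $C$ is positive definite. SLOPE pattern: for $b\in\mathbb{R}^p$, $\mathrm{patt}(b)_i=\mathrm{sign}(b_i)\,\mathrm{rank}(|b|)_i$, where $k$ is the number of distinct nonzero values in $\{|b_1|,\dots,|b_p|\}$, $\mathrm{rank}(|b|)_i\in\{0,1,\dots,k\}$, $\mathrm{rank}(|b|)_i=0$ if $b_i=0$, $\mathrm{rank}(|b|)_i>0$ if $b_i\ne0$, and $\mathrm{rank}(|b|)_i<\mathrm{rank}(|b|)_j$ if $|b_i|<|b_j|$ (so $\mathrm{rank}(|b|)_i$ is the number of distinct nonzero values of $|b_1|,\dots,|b_p|$ that are $\le|b_i|$). For a pattern $M\ne0$ with $k=\|M\|_\infty$, the pattern matrix $U_M\in\mathbb{R}^{p\times k}$ is $(U_M)_{ij}=\mathrm{sign}(M_i)\mathbf 1_{(|M_i|=k+1-j)}$; $|M|_\downarrow$ is the vector of absolute values of the components of $M$ in nonincreasing order, and $\tilde\Lambda_M=(U_{|M|_\downarrow})'\Lambda\in\mathbb{R}^k$. When $M=0$, expressions containing $U_M$ are read as zero (no columns). For $\Lambda=(\lambda_1,\dots,\lambda_p)'\in\mathbb{R}^{p+}$: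 $J_\Lambda(b)=\sum_{i=1}^p\lambda_i|b|_{(i)}$, where $|b|_{(1)}\ge\dots\ge|b|_{(p)}$ are the sorted absolute values of the components of $b$; $\partial J_\Lambda(b)=\{v\in\mathbb{R}^p: J_\Lambda(z)\ge J_\Lambda(b)+v'(z-b)\ \forall z\in\mathbb{R}^p\}$. $S_{X,\alpha\Lambda}(Y)=\arg\min_{b\in\mathbb{R}^p}\{\frac12\|Y-Xb\|_2^2+\alpha J_\Lambda(b)\}$ is the set of SLOPE minimizers. Almost sure convergence of patterns means that almost surely $\mathrm{patt}(\hat\beta^{\rm SLOPE}_n)=\mathrm{patt}(\beta)$ for all sufficiently large $n$.
   Formalization: The rows of X_n are taken to be the first n members of one i.i.d. sequence with the law of ξ; if the matrices X_n for different n may be unrelated, the claim fails (e.g. p=1, β=0, independent Gaussian X_n, α_n=√n log log n). The parenthetical uniqueness is neither assumed nor claimed. *)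

theory Defs
  imports
    "HOL-Probability.Probability"
    "Jordan_Normal_Form.Gauss_Jordan_Elimination"
begin

no_notation Matrix.vec_index (infixl \<open>$\<close> 100)

text \<open>
  Vectors of $R^p$ have type \<open>real ^ 'p\<close>, where \<open>'p\<close> is a finite linearly ordered type whose
  elements, in increasing order, play the role of the indices $1, \dots, p$.
  The order is used only where the position of a component matters: for the weights
  $\Lambda$ and for vectors sorted in nonincreasing order.
\<close>

definition pos_of :: "'p::{finite,linorder} \<Rightarrow> nat" where
  "pos_of i = card {..<i}"

definition index_at :: "nat \<Rightarrow> 'p::{finite,linorder}" where
  "index_at m = sorted_list_of_set UNIV ! m"

definition decreasing_positive :: "real ^ 'p::{finite,linorder} \<Rightarrow> bool" where
  "decreasing_positive \<Lambda> \<longleftrightarrow> (\<forall>i j. i < j \<longrightarrow> \<Lambda> $ j < \<Lambda> $ i) \<and> (\<forall>i. 0 < \<Lambda> $ i)"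

definition abs_sorted :: "real ^ 'p::{finite,linorder} \<Rightarrow> real ^ 'p::{finite,linorder}" where
  "abs_sorted b =
     (\<chi> i. rev (sorted_list_of_multiset (image_mset (\<lambda>j. \<bar>b $ j\<bar>) (mset_set UNIV))) ! pos_of i)"

definition abs_rank :: "real ^ 'p::finite \<Rightarrow> 'p \<Rightarrow> nat" where
  "abs_rank b i = card {\<bar>b $ j\<bar> | j. b $ j \<noteq> 0 \<and> \<bar>b $ j\<bar> \<le> \<bar>b $ i\<bar>}"

definition patt :: "real ^ 'p::finite \<Rightarrow> real ^ 'p" where
  "patt b = (\<chi> i. sgn (b $ i) * real (abs_rank b i))"

definition J :: "real ^ 'p::{finite,linorder} \<Rightarrow> real ^ 'p::{finite,linorder} \<Rightarrow> real" where
  "J \<Lambda> b = (\<Sum>i\<in>UNIV. \<Lambda> $ i * abs_sorted b $ i)"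

definition subdiff_J ::
  "real ^ 'p::{finite,linorder} \<Rightarrow> real ^ 'p::{finite,linorder} \<Rightarrow> (real ^ 'p::{finite,linorder}) set"
where
  "subdiff_J \<Lambda> b = {v. \<forall>z. J \<Lambda> z \<ge> J \<Lambda> b + v \<bullet> (z - b)}"

text \<open>
  The design matrix with \<open>n\<close> rows is given by its rows \<open>X 0, \<dots>, X (n - 1)\<close>, the response by
  \<open>Y 0, \<dots>, Y (n - 1)\<close>; other values of \<open>X\<close> and \<open>Y\<close> are ignored.
\<close>

definition slope_objective ::
  "nat \<Rightarrow> (nat \<Rightarrow> real ^ 'p::{finite,linorder}) \<Rightarrow> (nat \<Rightarrow> real) \<Rightarrow> real \<Rightarrow>
     real ^ 'p::{finite,linorder} \<Rightarrow> real ^ 'p::{finite,linorder} \<Rightarrow> real"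
where
  "slope_objective n X Y \<alpha> \<Lambda> b = 1 / 2 * (\<Sum>i<n. (Y i - X i \<bullet> b)\<^sup>2) + \<alpha> * J \<Lambda> b"

definition slope_minimizers ::
  "nat \<Rightarrow> (nat \<Rightarrow> real ^ 'p::{finite,linorder}) \<Rightarrow> (nat \<Rightarrow> real) \<Rightarrow> real \<Rightarrow>
     real ^ 'p::{finite,linorder} \<Rightarrow> (real ^ 'p::{finite,linorder}) set"
where
  "slope_minimizers n X Y \<alpha> \<Lambda> =
     {b. \<forall>z. slope_objective n X Y \<alpha> \<Lambda> b \<le> slope_objective n X Y \<alpha> \<Lambda> z}"

text \<open>
  The pattern matrix has $k = \|M\|_\infty$ columns, a number that depends on \<open>M\<close>, so it is a
  matrix with dimensions in \<open>nat\<close> and entries counted from 0: column \<open>j < k\<close> is the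
  column $j + 1$ of the usual notation. For \<open>M = 0\<close> it has no columns.
\<close>

definition pattern_size :: "real ^ 'p::finite \<Rightarrow> nat" where
  "pattern_size M = nat \<lfloor>infnorm M\<rfloor>"

definition pattern_matrix :: "real ^ 'p::{finite,linorder} \<Rightarrow> real mat" where
  "pattern_matrix M =
     Matrix.mat CARD('p) (pattern_size M)
       (\<lambda>(i, j). if \<bar>M $ index_at i\<bar> = real (pattern_size M - j) then sgn (M $ index_at i) else 0)"

definition vec_to_jnf :: "real ^ 'p::{finite,linorder} \<Rightarrow> real Matrix.vec" where
  "vec_to_jnf v = Matrix.vec CARD('p) (\<lambda>i. v $ index_at i)"

definition vec_of_jnf :: "real Matrix.vec \<Rightarrow> real ^ 'p::{finite,linorder}" where
  "vec_of_jnf v = (\<chi> i. Matrix.vec_index v (pos_of i))"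

definition mat_to_jnf :: "real ^ 'p::{finite,linorder} ^ 'p::{finite,linorder} \<Rightarrow> real mat" where
  "mat_to_jnf A = Matrix.mat CARD('p) CARD('p) (\<lambda>(i, j). A $ index_at i $ index_at j)"

definition reduced_weights ::
  "real ^ 'p::{finite,linorder} \<Rightarrow> real ^ 'p::{finite,linorder} \<Rightarrow> real Matrix.vec"
where
  "reduced_weights \<Lambda> M = (pattern_matrix (abs_sorted M))\<^sup>T *\<^sub>v vec_to_jnf \<Lambda>"

text \<open>
  The vector $C U_M (U_M' C U_M)^{-1} \tilde\Lambda_M$. The inverse exists when \<open>C\<close> is positive
  definite and \<open>M\<close> is a pattern; for \<open>M = 0\<close> the product passes through dimension 0 and
  equals 0.
\<close>

definition irrepresentable_vector ::
  "real ^ 'p::{finite,linorder} ^ 'p::{finite,linorder} \<Rightarrow>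
     real ^ 'p::{finite,linorder} \<Rightarrow> real ^ 'p::{finite,linorder} \<Rightarrow> real ^ 'p::{finite,linorder}"
where
  "irrepresentable_vector C \<Lambda> M =
     (let U = pattern_matrix M; A = mat_to_jnf C
      in vec_of_jnf (A * U * the (mat_inverse (U\<^sup>T * A * U)) *\<^sub>v reduced_weights \<Lambda> M))"

definition second_moment_matrix :: "'b measure \<Rightarrow> ('b \<Rightarrow> real ^ 'p::finite) \<Rightarrow> real ^ 'p ^ 'p" where
  "second_moment_matrix Q \<xi> = (\<chi> i j. integral\<^sup>L Q (\<lambda>w. \<xi> w $ i * \<xi> w $ j))"

end

theory Submission
  imports Defs "HOL-Real_Asymp.Real_Asymp" "Jordan_Normal_Form.Determinant"
begin

text \<open>
  For a fixed realization the statement is deterministic. Write $C_n = X_n'X_n/n$ and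
  $w_n = X_n'\varepsilon_n/\alpha_n$. A vector $b$ minimizes the SLOPE objective as soon as
  $v = w_n - (n/\alpha_n) C_n (b - \beta)$ is a subgradient of $J_\Lambda$ at $b$, and it is the
  only minimizer if $C_n$ is positive definite. Such a $b$ is sought in the form
  $\beta - (\alpha_n/n) u$, where $u$ lies in the column space $V$ of $U_M$; then
  $v = w_n + C_n u$. The irrepresentable vector is $C d$ for some $d \in V$
  (\<open>irrepresentable_vector_eq_mult\<close>), and $u \in V$ can be chosen such that $v - C d$ is
  orthogonal to $V$ (\<open>exists_projected_solution\<close>). When $C_n \to C$ and $w_n \to 0$, this
  choice satisfies $u \to d$, and therefore $v \to C d$.

  The subdifferential at $M$ is a face of a polytope, and every vector orthogonal to $V$ is
  parallel to its affine hull: the vertices of the face are signed rearrangements of $\Lambda$ with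
  arbitrary signs at the zeros of $M$ and arbitrary order within its clusters, and the differences
  of such vertices span $V^\perp$ because the weights are distinct and positive
  (\<open>affine_hull_subdiff\<close>). As $C d$ is in the relative interior, $v$ is in the subdifferential at
  $M$ for all large $n$ (\<open>rel_interior_subdiff_nhds\<close>). Because $\alpha_n/n \to 0$, the perturbation
  $(\alpha_n/n) u \in V$ finally becomes so small that $b$ has the pattern of $\beta$, and the
  subdifferential only depends on the pattern (\<open>subdiff_same_pattern\<close>). Thus $b$ is the minimizer
  and has the right pattern (\<open>slope_pattern_recovery\<close>).

  It remains that $C_n \to C$ and $w_n \to 0$ almost surely. The first is the strong law of large
  numbers for the products $\xi_j \xi_k$, which are merely integrable; it is derived from Garsia's
  maximal inequality and the 0-1 law (\<open>strong_law_of_large_numbers\<close>). The second is the place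
  of the condition on $\sqrt{n \log\log n}$: the products $\xi_j \epsilon$ are i.i.d., centered and of
  finite variance, so their partial sums are $O(\sqrt{n \log\log n})$ by the upper half of the
  Hartman-Wintner law of the iterated logarithm (\<open>iterated_logarithm_upper_bound\<close>). For this, the
  summands are truncated at a level of order $\sqrt{n / \log\log n}$. The truncated sums obey an
  exponential maximal inequality along the powers of 2, and the parts cut off are absolutely
  summable after division by $\sqrt{n \log\log n}$, by finiteness of the second moment.
\<close>

no_notation Matrix.vec_index (infixl \<open>$\<close> 100)
no_notation scalar_prod (infix \<open>\<bullet>\<close> 70)

section \<open>The strong law of large numbers\<close>

text \<open>
  The largest of the partial sums with $0, \dots, n$ terms. Peeling off the first term, and not
  the last, brings in the shifted sequence, on which stationarity acts.
\<close>

fun max_partial_sum :: "nat \<Rightarrow> (nat \<Rightarrow> real) \<Rightarrow> real" where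
  "max_partial_sum 0 x = 0"
| "max_partial_sum (Suc n) x = max 0 (x 0 + max_partial_sum n (\<lambda>i. x (Suc i)))"

lemma max_partial_sum_mono: "max_partial_sum n x \<le> max_partial_sum (Suc n) x"
proof (induction n arbitrary: x)
  case (Suc n)
  show ?case using Suc[of "\<lambda>i. x (Suc i)"] by simp
qed simp

lemma max_partial_sum_nonneg: "0 \<le> max_partial_sum n x"
  by (cases n) auto

lemma max_partial_sum_ge: "k \<le> n \<Longrightarrow> (\<Sum>i<k. x i) \<le> max_partial_sum n x"
proof (induction n arbitrary: x k)
  case (Suc n)
  show ?case
  proof (cases k)
    case (Suc l)
    have "(\<Sum>i<k. x i) = x 0 + (\<Sum>i<l. x (Suc i))" unfolding Suc by (rule sum.lessThan_Suc_shift)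
    then show ?thesis using Suc.IH[of l "\<lambda>i. x (Suc i)"] Suc Suc.prems by simp
  qed simp
qed simp

lemma max_partial_sum_abs_le: "\<bar>max_partial_sum n x\<bar> \<le> (\<Sum>i<n. \<bar>x i\<bar>)"
proof (induction n arbitrary: x)
  case (Suc n)
  have "\<bar>max_partial_sum (Suc n) x\<bar> \<le> \<bar>x 0\<bar> + \<bar>max_partial_sum n (\<lambda>i. x (Suc i))\<bar>" by simp
  also have "\<dots> \<le> \<bar>x 0\<bar> + (\<Sum>i<n. \<bar>x (Suc i)\<bar>)" using Suc[of "\<lambda>i. x (Suc i)"] by simp
  also have "\<dots> = (\<Sum>i<Suc n. \<bar>x i\<bar>)" by (rule sum.lessThan_Suc_shift[symmetric])
  finally show ?case .
qed simp

lemma max_partial_sum_measurable: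
  assumes "\<And>i. X i \<in> borel_measurable M"
  shows "(\<lambda>w. max_partial_sum n (\<lambda>i. X i w)) \<in> borel_measurable M"
  using assms
proof (induction n arbitrary: X)
  case (Suc n)
  have [measurable]: "X 0 \<in> borel_measurable M" "(\<lambda>w. max_partial_sum n (\<lambda>i. X (Suc i) w)) \<in> borel_measurable M"
    using Suc.prems Suc.IH[of "\<lambda>i. X (Suc i)"] by auto
  show ?case by simp
qed simp

definition (in prob_space) iid :: "(nat \<Rightarrow> 'a \<Rightarrow> real) \<Rightarrow> bool" where
  "iid X \<longleftrightarrow> indep_vars (\<lambda>_. borel) X UNIV \<and> (\<forall>i. distr M borel (X i) = distr M borel (X 0))"

context prob_space begin

lemma iid_indep_vars: "iid X \<Longrightarrow> indep_vars (\<lambda>_. borel) X UNIV"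
  by (simp add: iid_def)

lemma iid_measurable: "iid X \<Longrightarrow> X i \<in> borel_measurable M"
  unfolding iid_def indep_vars_def2 by auto

lemma iid_compose:
  assumes "iid X" and [measurable]: "f \<in> borel_measurable borel"
  shows "iid (\<lambda>i w. f (X i w))"
proof -
  have [measurable]: "X i \<in> borel_measurable M" for i using assms(1) by (rule iid_measurable)
  have "distr M borel (\<lambda>w. f (X i w)) = distr (distr M borel (X i)) borel f" for i
    by (subst distr_distr) (auto simp: comp_def)
  moreover have "indep_vars (\<lambda>_. borel) (\<lambda>i w. f (X i w)) UNIV"
    using iid_indep_vars[OF assms(1)] by (rule indep_vars_compose2) simp
  ultimately show ?thesis using assms(1) unfolding iid_def by metis
qed

lemma iid_integrable_iff:
  assumes "iid X" shows "integrable M (X i) \<longleftrightarrow> integrable M (X 0)"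
proof -
  have *: "integrable M (X j) \<longleftrightarrow> integrable (distr M borel (X j)) (\<lambda>x. x)" for j
    using iid_measurable[OF assms, of j] by (subst integrable_distr_eq) auto
  show ?thesis unfolding *[of i] *[of 0] using assms unfolding iid_def by metis
qed

lemma iid_expectation:
  assumes "iid X" shows "expectation (X i) = expectation (X 0)"
proof -
  have *: "expectation (X j) = integral\<^sup>L (distr M borel (X j)) (\<lambda>x. x)" for j
    using iid_measurable[OF assms, of j] by (subst integral_distr) auto
  show ?thesis unfolding *[of i] *[of 0] using assms unfolding iid_def by metis
qed

text \<open>
  Stationarity: the law of the whole sequence is a product of copies of one law, and dropping
  the first factor of infinitely many equal ones changes nothing.
\<close>

lemma iid_shift_distr:
  assumes "iid X"
  shows "distr M (Pi\<^sub>M UNIV (\<lambda>_. borel)) (\<lambda>w i. X (Suc i) w)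
       = distr M (Pi\<^sub>M UNIV (\<lambda>_. borel)) (\<lambda>w i. X i w)"
proof -
  have m: "X i \<in> borel_measurable M" for i using assms by (rule iid_measurable)
  have ind: "indep_vars (\<lambda>_. borel) X UNIV" using assms by (simp add: iid_def)
  have ind': "indep_vars (\<lambda>_. borel) (\<lambda>i. X (Suc i)) UNIV"
    unfolding indep_vars_def
  proof (intro conjI ballI indep_setsI)
    let ?F = "\<lambda>i. sigma_sets (space M) {X i -` B \<inter> space M | B. B \<in> sets borel}"
    have F: "indep_sets ?F UNIV" using ind unfolding indep_vars_def by simp
    fix A J assume J: "J \<noteq> {}" "finite (J::nat set)" and A: "\<forall>j\<in>J. A j \<in> ?F (Suc j)"
    show "prob (\<Inter>j\<in>J. A j) = (\<Prod>j\<in>J. prob (A j))"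
      using indep_setsD[OF F, of "Suc ` J" "\<lambda>i. A (i - 1)"] J A by (simp add: prod.reindex)
  next
    fix i
    show "sigma_sets (space M) {X (Suc i) -` B \<inter> space M | B. B \<in> sets borel} \<subseteq> events"
      using ind unfolding indep_vars_def indep_sets_def by blast
  qed (use m in auto)
  have d: "distr M borel (X (Suc i)) = distr M borel (X i)" for i
    using assms unfolding iid_def by metis
  show ?thesis
    using ind ind' by (simp add: indep_vars_iff_distr_eq_PiM m d restrict_UNIV)
qed

lemma iid_expectation_max_partial_sum_shift:
  assumes "iid X"
  shows "expectation (\<lambda>w. max_partial_sum n (\<lambda>i. X (Suc i) w)) = expectation (\<lambda>w. max_partial_sum n (\<lambda>i. X i w))"
proof -
  have [measurable]: "X i \<in> borel_measurable M" for i using assms by (rule iid_measurable)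
  have [measurable]: "max_partial_sum n \<in> borel_measurable (Pi\<^sub>M UNIV (\<lambda>_. borel))"
    using max_partial_sum_measurable[of "\<lambda>i x. x i" "Pi\<^sub>M UNIV (\<lambda>_. borel)" n] by simp
  have a: "(\<lambda>w i. X (Suc i) w) \<in> M \<rightarrow>\<^sub>M Pi\<^sub>M UNIV (\<lambda>_. borel)" "(\<lambda>w i. X i w) \<in> M \<rightarrow>\<^sub>M Pi\<^sub>M UNIV (\<lambda>_. borel)"
    by (auto intro!: measurable_PiM_single')
  show ?thesis
    using iid_shift_distr[OF assms] integral_distr[OF a(1), of "max_partial_sum n"] integral_distr[OF a(2), of "max_partial_sum n"]
    by simp
qed

lemma max_partial_sum_integrable:
  assumes "\<And>i. integrable M (X i)"
  shows "integrable M (\<lambda>w. max_partial_sum n (\<lambda>i. X i w))"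
proof (rule Bochner_Integration.integrable_bound[where f="\<lambda>w. \<Sum>i<n. \<bar>X i w\<bar>"])
  show "integrable M (\<lambda>w. \<Sum>i<n. \<bar>X i w\<bar>)" using assms by auto
  show "(\<lambda>w. max_partial_sum n (\<lambda>i. X i w)) \<in> borel_measurable M"
    using assms by (intro max_partial_sum_measurable) auto
  show "AE w in M. norm (max_partial_sum n (\<lambda>i. X i w)) \<le> norm (\<Sum>i<n. \<bar>X i w\<bar>)"
    using max_partial_sum_abs_le by (auto intro: order_trans)
qed

text \<open>
  Garsia's argument. Let $m_n$ be the maximal partial sum and $\theta$ the shift. Where
  $m_{n+1} > 0$, the recursion says $X_0 = m_{n+1} - m_n \circ \theta$; elsewhere
  $m_{n+1} = 0$ and $m_n \circ \theta \ge 0$. Hence the integral is at least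
  $E m_{n+1} - E(m_n \circ \theta)$, which by stationarity is $E m_{n+1} - E m_n \ge 0$.
\<close>

lemma maximal_ergodic_inequality:
  assumes "iid X" "integrable M (X 0)"
  shows "0 \<le> expectation (\<lambda>w. X 0 w * indicator {w. 0 < max_partial_sum n (\<lambda>i. X i w)} w)"
proof (cases n)
  case (Suc l)
  have int: "integrable M (X i)" for i using assms iid_integrable_iff by blast
  have [measurable]: "X i \<in> borel_measurable M" for i using int by auto
  let ?m = "\<lambda>w. max_partial_sum n (\<lambda>i. X i w)" and ?s = "\<lambda>w. max_partial_sum l (\<lambda>i. X (Suc i) w)"
  have [measurable]: "?m \<in> borel_measurable M" "?s \<in> borel_measurable M" by (auto intro!: max_partial_sum_measurable)
  have i: "integrable M ?m" "integrable M ?s" "integrable M (\<lambda>w. max_partial_sum l (\<lambda>i. X i w))"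
    using int by (intro max_partial_sum_integrable; simp)+
  have i2: "integrable M (\<lambda>w. X 0 w * indicator {w. 0 < ?m w} w)"
  proof (rule Bochner_Integration.integrable_bound[OF int[of 0]])
    show "(\<lambda>w. X 0 w * indicator {w. 0 < ?m w} w) \<in> borel_measurable M" by measurable
  qed (simp add: indicator_def)
  have "0 \<le> expectation ?m - expectation (\<lambda>w. max_partial_sum l (\<lambda>i. X i w))"
    unfolding Suc using max_partial_sum_mono i by (simp add: Suc integral_mono del: max_partial_sum.simps)
  also have "\<dots> = expectation ?m - expectation ?s"
    by (simp add: iid_expectation_max_partial_sum_shift[OF assms(1)])
  also have "\<dots> = expectation (\<lambda>w. ?m w - ?s w)"
    using i by simp
  also have "\<dots> \<le> expectation (\<lambda>w. X 0 w * indicator {w. 0 < ?m w} w)"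
  proof (rule integral_mono)
    fix w
    show "?m w - ?s w \<le> X 0 w * indicator {w. 0 < ?m w} w"
      using max_partial_sum_nonneg[of l "\<lambda>i. X (Suc i) w"] by (auto simp: indicator_def Suc max_def split: if_splits)
  qed (use i i2 in auto)
  finally show ?thesis .
qed simp

text \<open>
  The events of the maximal inequality increase to an almost sure one, so dominated convergence
  removes the indicator.
\<close>

lemma iid_expectation_nonneg_if_partial_sum_pos:
  assumes "iid X" "integrable M (X 0)" and pos: "AE w in M. \<exists>k. 0 < (\<Sum>i<k. X i w)"
  shows "0 \<le> expectation (X 0)"
proof -
  have [measurable]: "X i \<in> borel_measurable M" for i using assms by (auto intro: iid_measurable)
  have [measurable]: "(\<lambda>w. max_partial_sum n (\<lambda>i. X i w)) \<in> borel_measurable M" for n by (auto intro!: max_partial_sum_measurable)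
  have "(\<lambda>n. expectation (\<lambda>w. X 0 w * indicator {w. 0 < max_partial_sum n (\<lambda>i. X i w)} w)) \<longlonglongrightarrow> expectation (X 0)"
  proof (rule integral_dominated_convergence[where w="\<lambda>w. \<bar>X 0 w\<bar>"])
    show "AE w in M. (\<lambda>n. X 0 w * indicator {w. 0 < max_partial_sum n (\<lambda>i. X i w)} w) \<longlonglongrightarrow> X 0 w"
      using pos
    proof eventually_elim
      case (elim w)
      then obtain k where k: "0 < (\<Sum>i<k. X i w)" by blast
      have "eventually (\<lambda>n. X 0 w * indicator {w. 0 < max_partial_sum n (\<lambda>i. X i w)} w = X 0 w) sequentially"
        using eventually_ge_at_top[of k]
      proof eventually_elim
        case (elim n)
        show ?case using max_partial_sum_ge[OF elim, of "\<lambda>i. X i w"] k by (simp add: indicator_def)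
      qed
      then show ?case by (rule tendsto_eventually)
    qed
    show "integrable M (\<lambda>w. \<bar>X 0 w\<bar>)" using assms(2) by simp
    show "(\<lambda>w. X 0 w * indicator {w. 0 < max_partial_sum n (\<lambda>i. X i w)} w) \<in> borel_measurable M" for n by measurable
  qed (simp_all add: indicator_def)
  then show ?thesis
    by (rule LIMSEQ_le_const) (use maximal_ergodic_inequality[OF assms(1,2)] in auto)
qed

lemma indep_vars_tail_event_0_1:
  fixes X :: "nat \<Rightarrow> 'a \<Rightarrow> real"
  assumes ind: "indep_vars (\<lambda>_. borel) X UNIV"
    and tail: "\<And>m. A \<in> sigma_sets (space M) (\<Union>i\<in>{m..}. {X i -` B \<inter> space M | B. B \<in> sets borel})"
  shows "prob A = 0 \<or> prob A = 1"
proof (rule kolmogorov_0_1_law)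
  let ?F = "\<lambda>i. sigma_sets (space M) {X i -` B \<inter> space M | B. B \<in> sets borel}"
  show "sigma_algebra (space M) (?F i)" for i by (rule sigma_algebra_sigma_sets) auto
  show "indep_sets ?F UNIV" using ind unfolding indep_vars_def by simp
  have "sigma_sets (space M) (\<Union>i\<in>{m..}. {X i -` B \<inter> space M | B. B \<in> sets borel}) \<subseteq> sigma_sets (space M) (\<Union>(?F ` {m..}))" for m
    by (rule sigma_sets_mono') (auto intro!: sigma_sets.Basic)
  then show "A \<in> tail_events ?F" unfolding tail_events_def using tail by blast
qed

text \<open>
  That the upper limit exceeds $c$ is a tail event, because the first $m$ terms disappear after
  division by $n$. If it had probability 1, the partial sums of $X_i - c$ would almost surely
  become positive at some time, and the previous lemma would force $E X_0 \ge c$. The 0-1 law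
  leaves probability 0.
\<close>

lemma iid_limsup_average_le:
  assumes X: "iid X" "integrable M (X 0)" and c: "expectation (X 0) < c"
  shows "AE w in M. limsup (\<lambda>n. ereal ((\<Sum>i<n. X i w) / real n)) \<le> ereal c"
proof -
  have rv[measurable]: "X i \<in> borel_measurable M" for i using X by (auto intro: iid_measurable)
  let ?L = "\<lambda>w. limsup (\<lambda>n. ereal ((\<Sum>i<n. X i w) / real n))"
  define A where "A = {w\<in>space M. ereal c < ?L w}"
  have [measurable]: "A \<in> events" unfolding A_def by measurable
  have "A \<in> sigma_sets (space M) (\<Union>i\<in>{m..}. {X i -` B \<inter> space M | B. B \<in> sets borel})" for m
  proof -
    let ?E = "\<Union>i\<in>{m..}. {X i -` B \<inter> space M | B. B \<in> sets borel}"
    define N where "N = sigma (space M) ?E"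
    have E: "?E \<subseteq> Pow (space M)" by auto
    have sp: "space N = space M" "sets N = sigma_sets (space M) ?E"
      using E by (auto simp: N_def)
    have Xm: "X i \<in> borel_measurable N" if "i \<ge> m" for i
      by (rule measurableI) (use that in \<open>auto simp: sp intro!: sigma_sets.Basic\<close>)
    let ?L' = "\<lambda>w. limsup (\<lambda>n. ereal ((\<Sum>i\<in>{m..<n}. X i w) / real n))"
    have "?L w = ?L' w" for w
    proof -
      have "(\<lambda>n. (\<Sum>i<m. X i w) / real n) \<longlonglongrightarrow> 0"
        by (rule lim_const_over_n)
      then have lim: "(\<lambda>n. ereal ((\<Sum>i<m. X i w) / real n)) \<longlonglongrightarrow> ereal 0" by (simp only: lim_ereal)
      have "?L w = limsup (\<lambda>n. ereal ((\<Sum>i<m. X i w) / real n) + ereal ((\<Sum>i\<in>{m..<n}. X i w) / real n))"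
      proof (rule Limsup_eq)
        show "\<forall>\<^sub>F n in sequentially. ereal ((\<Sum>i<n. X i w) / real n) = ereal ((\<Sum>i<m. X i w) / real n) + ereal ((\<Sum>i\<in>{m..<n}. X i w) / real n)"
          using eventually_ge_at_top[of m]
        proof eventually_elim
          case (elim n)
          have "(\<Sum>i<n. X i w) = (\<Sum>i<m. X i w) + (\<Sum>i\<in>{m..<n}. X i w)"
            using sum.atLeastLessThan_concat[of 0 m n "\<lambda>i. X i w"] elim by (simp add: lessThan_atLeast0)
          then show ?case by (simp add: add_divide_distrib)
        qed
      qed
      also have "\<dots> = ereal 0 + ?L' w" by (rule ereal_limsup_lim_add[OF lim]) auto
      finally show ?thesis by simp
    qed
    then have "A = {w\<in>space N. ereal c < ?L' w}" by (simp add: A_def sp)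
    moreover have "?L' \<in> borel_measurable N"
      by (intro borel_measurable_limsup borel_measurable_ereal borel_measurable_divide borel_measurable_sum Xm) auto
    then have "{w\<in>space N. ereal c < ?L' w} \<in> sets N" by measurable
    ultimately show ?thesis by (simp add: sp)
  qed
  then have "prob A = 0 \<or> prob A = 1"
    using iid_indep_vars[OF X(1)] by (intro indep_vars_tail_event_0_1)
  moreover have "prob A \<noteq> 1"
  proof
    assume "prob A = 1"
    then have "AE w in M. w \<in> A" by (simp add: prob_eq_1)
    then have "AE w in M. \<exists>k. 0 < (\<Sum>i<k. X i w - c)"
    proof eventually_elim
      case (elim w)
      show ?case
      proof (rule ccontr)
        assume "\<not> ?thesis"
        then have *: "(\<Sum>i<k. X i w) \<le> real k * c" for k by (simp add: sum_subtractf not_less)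
        have "?L w \<le> ereal c"
          by (rule Limsup_bounded) (use * in \<open>auto intro!: eventually_sequentiallyI[of 1] simp: field_simps\<close>)
        then show False using elim leD unfolding A_def by blast
      qed
    qed
    moreover have "iid (\<lambda>i w. X i w - c)" using iid_compose[OF X(1), of "\<lambda>x. x - c"] by simp
    ultimately have "0 \<le> expectation (\<lambda>w. X 0 w - c)"
      by (intro iid_expectation_nonneg_if_partial_sum_pos) (use X in auto)
    then show False using c X(2) by (simp add: prob_space)
  qed
  ultimately have "AE w in M. w \<notin> A" by (simp add: prob_eq_0)
  then show ?thesis by (rule AE_mp) (auto intro!: AE_I2 simp: A_def not_less)
qed

lemma iid_eventually_average_less:
  assumes X: "iid X" "integrable M (X 0)"
  shows "AE w in M. \<forall>e>0. \<forall>\<^sub>F n in sequentially. (\<Sum>i<n. X i w) / real n < expectation (X 0) + e"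
proof -
  have "AE w in M. \<forall>k. limsup (\<lambda>n. ereal ((\<Sum>i<n. X i w) / real n)) \<le> ereal (expectation (X 0) + inverse (real (Suc k)))"
    unfolding AE_all_countable using iid_limsup_average_le[OF X] by simp
  then show ?thesis
  proof eventually_elim
    case (elim w)
    show ?case
    proof safe
      fix e :: real assume "0 < e"
      then obtain k where "inverse (real (Suc k)) < e" using reals_Archimedean by blast
      then have "ereal (expectation (X 0) + inverse (real (Suc k))) < ereal (expectation (X 0) + e)" by simp
      then have "limsup (\<lambda>n. ereal ((\<Sum>i<n. X i w) / real n)) < ereal (expectation (X 0) + e)" using elim by (metis le_less_trans)
      from Limsup_lessD[OF this] show "\<forall>\<^sub>F n in sequentially. (\<Sum>i<n. X i w) / real n < expectation (X 0) + e" by simp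
    qed
  qed
qed

theorem strong_law_of_large_numbers:
  assumes X: "iid X" "integrable M (X 0)"
  shows "AE w in M. (\<lambda>n. (\<Sum>i<n. X i w) / real n) \<longlonglongrightarrow> expectation (X 0)"
proof -
  have "iid (\<lambda>i w. - X i w)" using iid_compose[OF X(1), of "\<lambda>x. - x"] by simp
  from iid_eventually_average_less[OF this] X(2)
  have "AE w in M. \<forall>e>0. \<forall>\<^sub>F n in sequentially. - (\<Sum>i<n. X i w) / real n < - expectation (X 0) + e"
    by (simp add: sum_negf)
  then show ?thesis using iid_eventually_average_less[OF X]
  proof eventually_elim
    case (elim w)
    show ?case unfolding tendsto_iff dist_real_def
    proof safe
      fix e :: real assume "0 < e"
      then have "\<forall>\<^sub>F n in sequentially. - (\<Sum>i<n. X i w) / real n < - expectation (X 0) + e"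
        "\<forall>\<^sub>F n in sequentially. (\<Sum>i<n. X i w) / real n < expectation (X 0) + e" using elim by auto
      then show "\<forall>\<^sub>F n in sequentially. \<bar>(\<Sum>i<n. X i w) / real n - expectation (X 0)\<bar> < e"
        by eventually_elim (auto simp: abs_less_iff)
    qed
  qed
qed

end

section \<open>The upper half of the law of the iterated logarithm\<close>

text \<open>
  The shift by 32 makes the iterated logarithm at least 1 everywhere, since $\ln 32 > e$.
  The summand with index $n$ is cut at \<open>lil_cutoff n\<close>, and \<open>lil_rate n\<close>, which is of
  order $\sqrt{n \ln \ln n}$, is the growth rate to be proved; the product of the two is $n + 1$.
\<close>

definition lil_log :: "nat \<Rightarrow> real" where "lil_log n = ln (ln (real n + 32))"
definition lil_cutoff :: "nat \<Rightarrow> real" where "lil_cutoff n = sqrt ((real n + 1) / lil_log n)"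
definition lil_rate :: "nat \<Rightarrow> real" where "lil_rate n = sqrt ((real n + 1) * lil_log n)"

lemma ln_add_32_ge: "3 \<le> ln (real n + 32)"
proof -
  have "3 \<le> 5 * ln (2::real)" using ln2_ge_two_thirds by simp
  also have "\<dots> = ln (2 ^ 5)" by (subst ln_realpow) auto
  also have "\<dots> \<le> ln (real n + 32)" by simp
  finally show ?thesis .
qed

lemma lil_log_ge_1: "1 \<le> lil_log n"
proof -
  have "exp 1 \<le> ln (real n + 32)" using exp_le ln_add_32_ge[of n] by linarith
  then have "ln (exp 1) \<le> ln (ln (real n + 32))" by (intro ln_mono) auto
  then show ?thesis by (simp add: lil_log_def)
qed

lemma lil_log_pos [simp]: "0 < lil_log n" using lil_log_ge_1[of n] by simp
lemma lil_log_nonneg [simp]: "0 \<le> lil_log n" using lil_log_ge_1[of n] by simp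
lemma lil_log_neq_0 [simp]: "lil_log n \<noteq> 0" using lil_log_ge_1[of n] by simp

lemma lil_cutoff_pos [simp]: "0 < lil_cutoff n" by (simp add: lil_cutoff_def)
lemma lil_rate_pos [simp]: "0 < lil_rate n" by (simp add: lil_rate_def)
lemma lil_cutoff_neq_0 [simp]: "lil_cutoff n \<noteq> 0" using lil_cutoff_pos[of n] by linarith
lemma lil_rate_neq_0 [simp]: "lil_rate n \<noteq> 0" using lil_rate_pos[of n] by linarith

lemma lil_cutoff_square: "(lil_cutoff n)\<^sup>2 = (real n + 1) / lil_log n" by (simp add: lil_cutoff_def)

lemma lil_log_times_a: "lil_log n * lil_cutoff n = lil_rate n"
proof -
  have "lil_log n * lil_cutoff n = sqrt ((lil_log n)\<^sup>2) * sqrt ((real n + 1) / lil_log n)" by (simp add: lil_cutoff_def)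
  also have "\<dots> = sqrt ((lil_log n)\<^sup>2 * ((real n + 1) / lil_log n))" by (rule real_sqrt_mult[symmetric])
  also have "(lil_log n)\<^sup>2 * ((real n + 1) / lil_log n) = (real n + 1) * lil_log n" by (simp add: power2_eq_square)
  finally show ?thesis by (simp add: lil_rate_def)
qed

lemma lil_log_mono: "m \<le> n \<Longrightarrow> lil_log m \<le> lil_log n"
proof -
  assume "m \<le> n"
  then have "ln (real m + 32) \<le> ln (real n + 32)" by simp
  then show ?thesis unfolding lil_log_def using ln_add_32_ge[of m] by (subst ln_le_cancel_iff) linarith+
qed

lemma lil_rate_mono: "m \<le> n \<Longrightarrow> lil_rate m \<le> lil_rate n"
  unfolding lil_rate_def using lil_log_mono[of m n] by (intro real_sqrt_le_mono mult_mono) auto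

text \<open>
  A discrete form of the fact that the derivative of the cutoff is of the order of the inverse
  rate. The square of the cutoff is $(n+1)/h(n)$ with $h$ the iterated logarithm; the numerator grows by 1,
  whereas $h$ grows by at most $1/(y \ln y)$ at $y = n + 32$, so that the quotient grows by at
  least $1/(2 h(n+1))$.
\<close>

lemma lil_cutoff_step: "1 / lil_rate (Suc n) \<le> 4 * (lil_cutoff (Suc n) - lil_cutoff n)" and lil_cutoff_Suc: "lil_cutoff n \<le> lil_cutoff (Suc n)"
proof -
  define y where "y = real n + 32"
  define h where "h = lil_log n"
  define h' where "h' = lil_log (Suc n)"
  have y: "0 < y" "32 \<le> y" "3 \<le> ln y" using ln_add_32_ge[of n] by (auto simp: y_def)
  have hp: "1 \<le> h" "h \<le> h'" "0 < h'" using lil_log_ge_1 lil_log_mono[of n "Suc n"] by (auto simp: h_def h'_def)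
  have hh: "h = ln (ln y)" "h' = ln (ln (y + 1))" by (auto simp: h_def h'_def lil_log_def y_def add_ac)
  have "ln (y + 1) - ln y = ln ((y + 1) / y)" using y by (simp add: ln_div)
  also have "(y + 1) / y = 1 + 1 / y" using y by (simp add: field_simps)
  also have "ln (1 + 1 / y) \<le> 1 / y" using y by (intro ln_add_one_self_le_self) auto
  finally have d: "ln (y + 1) - ln y \<le> 1 / y" .
  have pos': "0 < ln (y + 1)" using y by (simp add: ln_gt_zero)
  have "h' - h = ln (ln (y + 1) / ln y)" unfolding hh using y pos' by (simp add: ln_div)
  also have "ln (y + 1) / ln y = 1 + (ln (y + 1) - ln y) / ln y" using y by (simp add: field_simps)
  also have "ln (1 + (ln (y + 1) - ln y) / ln y) \<le> (ln (y + 1) - ln y) / ln y" using y by (intro ln_add_one_self_le_self) auto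
  also have "\<dots> \<le> (1 / y) / ln y" using d y by (intro divide_right_mono) auto
  finally have "(real n + 1) * (h' - h) \<le> (real n + 1) * ((1 / y) / ln y)" by (intro mult_left_mono) auto
  also have "\<dots> = ((real n + 1) / y) / ln y" by simp
  also have "\<dots> \<le> 1 / 3" using y by (intro frac_le) (auto simp: y_def)
  finally have e: "(real n + 1) * (h' - h) \<le> h / 2" using hp by linarith
  have "(real n + 2) / h' - (real n + 1) / h = (h - (real n + 1) * (h' - h)) / (h * h')"
    using hp by (simp add: field_simps)
  also have "\<dots> \<ge> (h / 2) / (h * h')" using e hp by (intro divide_right_mono) auto
  finally have f: "1 / (2 * h') \<le> (lil_cutoff (Suc n))\<^sup>2 - (lil_cutoff n)\<^sup>2"
    using hp by (simp add: lil_cutoff_square h_def h'_def add_ac)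
  have "0 \<le> 1 / (2 * h')" using hp by simp
  with f have "(lil_cutoff n)\<^sup>2 \<le> (lil_cutoff (Suc n))\<^sup>2" by linarith
  then show le: "lil_cutoff n \<le> lil_cutoff (Suc n)" by (rule power2_le_imp_le) (simp add: less_imp_le)
  have "1 / (2 * h') \<le> (lil_cutoff (Suc n) - lil_cutoff n) * (lil_cutoff (Suc n) + lil_cutoff n)"
    using f by (simp add: power2_eq_square algebra_simps)
  also have "\<dots> \<le> (lil_cutoff (Suc n) - lil_cutoff n) * (2 * lil_cutoff (Suc n))"
    using le by (intro mult_left_mono) auto
  finally have st: "1 / (2 * h') / (lil_cutoff (Suc n)) \<le> (lil_cutoff (Suc n) - lil_cutoff n) * 2"
    by (simp only: pos_divide_le_eq[OF lil_cutoff_pos] mult.assoc)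
  have eq: "1 / (2 * h') / lil_cutoff (Suc n) = (1 / lil_rate (Suc n)) / 2"
    unfolding lil_log_times_a[of "Suc n", symmetric] h'_def[symmetric] by simp
  have "(1 / lil_rate (Suc n)) / 2 \<le> (lil_cutoff (Suc n) - lil_cutoff n) * 2" using st unfolding eq .
  moreover have "p / 2 \<le> q * 2 \<Longrightarrow> p \<le> 4 * q" for p q :: real by linarith
  ultimately show "1 / lil_rate (Suc n) \<le> 4 * (lil_cutoff (Suc n) - lil_cutoff n)" by blast
qed

lemma lil_cutoff_mono: "m \<le> n \<Longrightarrow> lil_cutoff m \<le> lil_cutoff n"
  using lil_cutoff_Suc by (rule lift_Suc_mono_le)

lemma sum_inverse_lil_rate_le: "(\<Sum>i\<le>N. 1 / lil_rate i) \<le> 4 * lil_cutoff N"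
proof (induction N)
  case 0
  have "1 / lil_rate 0 = lil_cutoff 0" by (simp add: lil_cutoff_def lil_rate_def real_sqrt_divide)
  then show ?case using lil_cutoff_pos[of 0] by simp
next
  case (Suc N)
  then show ?case using lil_cutoff_step[of N] by simp
qed

text \<open>
  This bound is the reason why a second moment suffices: the inverse rates of all indices whose
  cutoff is below $z$ add up to at most $4 z$, so that weighting them with $z$ gives at most
  $4 z^2$.
\<close>

lemma sum_inverse_lil_rate_below_le:
  assumes "0 \<le> z"
  shows "(\<Sum>i<N. indicator {i. lil_cutoff i < z} i / lil_rate i) \<le> 4 * z"
proof (induction N)
  case (Suc N)
  show ?case
  proof (cases "lil_cutoff N < z")
    case True
    have "(\<Sum>i<Suc N. indicator {i. lil_cutoff i < z} i / lil_rate i) \<le> (\<Sum>i<Suc N. 1 / lil_rate i)"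
      by (intro sum_mono) (auto simp: indicator_def less_imp_le)
    also have "\<dots> \<le> 4 * lil_cutoff N" using sum_inverse_lil_rate_le[of N] by (simp only: lessThan_Suc_atMost)
    finally show ?thesis using True by simp
  qed (use Suc in simp)
qed (use assms in simp)

lemma lil_rate_double: "lil_rate (2 * n) \<le> 2 * lil_rate n"
proof -
  have "ln (real (2 * n) + 32) \<le> ln ((real n + 32)\<^sup>2)"
  proof (rule ln_mono)
    show "real (2 * n) + 32 \<le> (real n + 32)\<^sup>2" by (simp add: power2_eq_square algebra_simps)
  qed simp
  also have "\<dots> = 2 * ln (real n + 32)" by (simp add: ln_realpow)
  finally have "lil_log (2 * n) \<le> ln (2 * ln (real n + 32))"
    unfolding lil_log_def using ln_add_32_ge[of "2*n"] ln_add_32_ge[of n] by (subst ln_le_cancel_iff) linarith+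
  also have "\<dots> = ln 2 + lil_log n" using ln_add_32_ge[of n] by (simp add: lil_log_def ln_mult)
  also have "\<dots> \<le> 2 * lil_log n" using lil_log_ge_1[of n] ln_2_less_1 by linarith
  finally have "lil_rate (2 * n) \<le> sqrt ((2 * (real n + 1)) * (2 * lil_log n))"
    unfolding lil_rate_def by (intro real_sqrt_le_mono mult_mono) auto
  also have "\<dots> = sqrt (2\<^sup>2 * ((real n + 1) * lil_log n))" by simp
  also have "\<dots> = 2 * lil_rate n" unfolding lil_rate_def real_sqrt_mult by simp
  finally show ?thesis .
qed

lemma exp_le_quadratic: "\<bar>x\<bar> \<le> 1 \<Longrightarrow> exp x \<le> 1 + x + x\<^sup>2" for x :: real
proof (cases "0 \<le> x")
  case False
  assume "\<bar>x\<bar> \<le> 1"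
  define y where "y = - x"
  have y: "0 < y" using False by (simp add: y_def)
  have "1 \<le> (1 - y + y\<^sup>2) * (1 + y)" using y by (simp add: algebra_simps power2_eq_square)
  also have "\<dots> \<le> (1 - y + y\<^sup>2) * exp y"
  proof (rule mult_left_mono)
    have "0 \<le> (1 - y)\<^sup>2 + y" using y by (intro add_nonneg_nonneg) auto
    then show "0 \<le> 1 - y + y\<^sup>2" by (simp add: power2_eq_square algebra_simps)
  qed (simp add: exp_ge_add_one_self)
  finally have "exp (- y) \<le> 1 - y + y\<^sup>2" by (simp add: exp_minus field_simps)
  then show ?thesis by (simp add: y_def)
qed (simp add: exp_bound)

text \<open>
  The running product of the $g_i$, frozen as soon as it reaches the level $l$. For independent
  nonnegative factors of mean at most 1 it is a supermartingale.
\<close>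

primrec stopped_prod :: "real \<Rightarrow> nat \<Rightarrow> (nat \<Rightarrow> real) \<Rightarrow> real" where
  "stopped_prod l 0 g = 1"
| "stopped_prod l (Suc k) g = stopped_prod l k g * (if l \<le> stopped_prod l k g then 1 else g k)"

lemma stopped_prod_cong: "(\<And>i. i < k \<Longrightarrow> g i = g' i) \<Longrightarrow> stopped_prod l k g = stopped_prod l k g'"
  by (induction k) auto

lemma stopped_prod_nonneg: "(\<And>i. 0 \<le> g i) \<Longrightarrow> 0 \<le> stopped_prod l k g"
  by (induction k) auto

text \<open>
  Before the freezing time the stopped product is the running product, and afterwards it stays
  at or above the level.
\<close>

lemma stopped_prod_ge: 
  assumes "l \<le> (\<Prod>i<n. g i)" "n \<le> N" shows "l \<le> stopped_prod l N g"
proof -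
  have "l \<le> stopped_prod l k g \<or> stopped_prod l k g = (\<Prod>i<k. g i)" for k
    by (induction k) auto
  then have "l \<le> stopped_prod l n g" using assms(1) by metis
  moreover have "l \<le> stopped_prod l (n + d) g" if "l \<le> stopped_prod l n g" for d
    using that by (induction d) auto
  ultimately show ?thesis using assms(2) le_Suc_ex by blast
qed

lemma stopped_prod_measurable:
  assumes "\<And>i. i < k \<Longrightarrow> (\<lambda>x. G i x) \<in> borel_measurable M"
  shows "(\<lambda>x. stopped_prod l k (\<lambda>i. G i x)) \<in> borel_measurable M"
  using assms
proof (induction k)
  case (Suc k)
  have [measurable]: "(\<lambda>x. stopped_prod l k (\<lambda>i. G i x)) \<in> borel_measurable M" "G k \<in> borel_measurable M" 
    using Suc by auto
  show ?case by simp
qed simp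

context prob_space begin

text \<open>
  The next factor multiplies only the part that is not yet frozen. This part is determined by
  the past, hence independent of the factor, and a mean of at most 1 cannot increase it.
\<close>

lemma stopped_prod_expectation:
  fixes G :: "nat \<Rightarrow> 'a \<Rightarrow> real"
  assumes ind: "indep_vars (\<lambda>_. borel) G UNIV" 
    and int: "\<And>i. i < k \<Longrightarrow> integrable M (G i)" and le1: "\<And>i. i < k \<Longrightarrow> expectation (G i) \<le> 1"
    and nn: "\<And>i w. 0 \<le> G i w"
  shows "integrable M (\<lambda>w. stopped_prod l k (\<lambda>i. G i w)) \<and> expectation (\<lambda>w. stopped_prod l k (\<lambda>i. G i w)) \<le> 1"
  using int le1
proof (induction k)
  case 0 show ?case by (simp add: prob_space)
next
  case (Suc k)
  let ?S = "\<lambda>w. stopped_prod l k (\<lambda>i. G i w)"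
  have IH: "integrable M ?S" "expectation ?S \<le> 1" using Suc by auto
  have rv[measurable]: "G i \<in> borel_measurable M" for i using ind unfolding indep_vars_def2 by auto
  have [measurable]: "?S \<in> borel_measurable M" by (intro stopped_prod_measurable) simp
  have nnS: "0 \<le> ?S w" for w using nn by (intro stopped_prod_nonneg)
  let ?Y = "\<lambda>g. stopped_prod l k g * (if l \<le> stopped_prod l k g then 0 else 1)"
  have Sm[measurable]: "(\<lambda>g. stopped_prod l k g) \<in> borel_measurable (Pi\<^sub>M {..<k} (\<lambda>_. borel))"
    using stopped_prod_measurable[of k "\<lambda>i g. g i" "Pi\<^sub>M {..<k} (\<lambda>_. borel)" l] by simp
  have "indep_var borel (?Y \<circ> (\<lambda>w. restrict (\<lambda>i. G i w) {..<k})) borel ((\<lambda>g. g k) \<circ> (\<lambda>w. restrict (\<lambda>i. G i w) {k}))"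
    by (rule indep_var_compose[OF indep_var_restrict[OF ind]]) auto
  moreover have "stopped_prod l k (restrict (\<lambda>i. G i w) {..<k}) = ?S w" for w
    by (rule stopped_prod_cong) simp
  ultimately have iv: "indep_var borel (\<lambda>w. ?S w * (if l \<le> ?S w then 0 else 1)) borel (G k)"
    by (simp add: comp_def)
  have i1: "integrable M (\<lambda>w. ?S w * (if l \<le> ?S w then 0 else 1))"
    by (rule Bochner_Integration.integrable_bound[OF IH(1)]) auto
  have i2: "integrable M (\<lambda>w. ?S w * (if l \<le> ?S w then 1 else 0))"
    by (rule Bochner_Integration.integrable_bound[OF IH(1)]) auto
  have i3: "integrable M (G k)" using Suc.prems by simp
  have eq: "stopped_prod l (Suc k) (\<lambda>i. G i w) = ?S w * (if l \<le> ?S w then 1 else 0) + ?S w * (if l \<le> ?S w then 0 else 1) * G k w" for w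
    by simp
  have i4: "integrable M (\<lambda>w. ?S w * (if l \<le> ?S w then 0 else 1) * G k w)"
    using indep_var_integrable[OF iv i1 i3] .
  have "expectation (\<lambda>w. stopped_prod l (Suc k) (\<lambda>i. G i w)) 
     = expectation (\<lambda>w. ?S w * (if l \<le> ?S w then 1 else 0)) + expectation (\<lambda>w. ?S w * (if l \<le> ?S w then 0 else 1)) * expectation (G k)"
    unfolding eq using i2 i4 indep_var_lebesgue_integral[OF iv i1 i3] by simp
  also have "\<dots> \<le> expectation (\<lambda>w. ?S w * (if l \<le> ?S w then 1 else 0)) + expectation (\<lambda>w. ?S w * (if l \<le> ?S w then 0 else 1)) * 1"
    using Suc.prems nnS by (intro add_left_mono mult_left_mono integral_nonneg_AE) auto
  also have "\<dots> = expectation (\<lambda>w. ?S w * (if l \<le> ?S w then 1 else 0) + ?S w * (if l \<le> ?S w then 0 else 1))"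
    using i1 i2 by simp
  also have "\<dots> = expectation ?S" by (rule Bochner_Integration.integral_cong) auto
  finally show ?case using IH(2) i2 i4 unfolding eq by (auto intro!: Bochner_Integration.integrable_add)
qed

text \<open>
  A maximal inequality: a running product that reaches $l$ at any time up to $N$ leaves the
  stopped product at or above $l$ at time $N$, where Markov's inequality applies.
\<close>

lemma prob_running_prod_ge:
  fixes G :: "nat \<Rightarrow> 'a \<Rightarrow> real"
  assumes ind: "indep_vars (\<lambda>_. borel) G UNIV" 
    and int: "\<And>i. i < N \<Longrightarrow> integrable M (G i)" and le1: "\<And>i. i < N \<Longrightarrow> expectation (G i) \<le> 1"
    and nn: "\<And>i w. 0 \<le> G i w" and l: "0 < l"
  shows "prob {w\<in>space M. \<exists>n\<le>N. l \<le> (\<Prod>i<n. G i w)} \<le> 1 / l"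
proof -
  have rv[measurable]: "G i \<in> borel_measurable M" for i using ind unfolding indep_vars_def2 by auto
  have [measurable]: "(\<lambda>w. stopped_prod l N (\<lambda>i. G i w)) \<in> borel_measurable M" by (intro stopped_prod_measurable) simp
  note E = stopped_prod_expectation[OF ind int le1 nn, of N l]
  have "prob {w\<in>space M. \<exists>n\<le>N. l \<le> (\<Prod>i<n. G i w)} \<le> prob {w\<in>space M. l \<le> stopped_prod l N (\<lambda>i. G i w)}"
    by (intro finite_measure_mono) (auto intro: stopped_prod_ge)
  also have "\<dots> \<le> expectation (\<lambda>w. stopped_prod l N (\<lambda>i. G i w)) / l"
    using E l nn by (intro integral_Markov_inequality_measure[where A="{}"]) (auto intro!: stopped_prod_nonneg)
  also have "\<dots> \<le> 1 / l" using E l by (intro divide_right_mono) auto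
  finally show ?thesis .
qed

definition lil_trunc :: "nat \<Rightarrow> real \<Rightarrow> real" where
  "lil_trunc i z = z * indicator {- lil_cutoff i .. lil_cutoff i} z"
definition lil_tail :: "nat \<Rightarrow> real \<Rightarrow> real" where
  "lil_tail i z = \<bar>z\<bar> * indicator {i. lil_cutoff i < \<bar>z\<bar>} i"

lemma lil_trunc_measurable [measurable]: "lil_trunc i \<in> borel_measurable borel"
  unfolding lil_trunc_def by measurable

lemma lil_tail_measurable [measurable]: "lil_tail i \<in> borel_measurable borel"
proof -
  have "lil_tail i = (\<lambda>z. if lil_cutoff i < \<bar>z\<bar> then \<bar>z\<bar> else 0)" by (auto simp: lil_tail_def indicator_def)
  then show ?thesis by simp
qed

lemma lil_trunc_tail: "\<bar>z - lil_trunc i z\<bar> = lil_tail i z"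
  using lil_cutoff_pos[of i] by (auto simp: lil_trunc_def lil_tail_def indicator_def abs_if)

lemma lil_tail_nonneg [simp]: "0 \<le> lil_tail i z" by (simp add: lil_tail_def)

lemma lil_tail_le: "lil_tail i z \<le> \<bar>z\<bar>" by (simp add: lil_tail_def indicator_def)

lemma lil_trunc_abs_le: "\<bar>lil_trunc i z\<bar> \<le> lil_cutoff i" "\<bar>lil_trunc i z\<bar> \<le> \<bar>z\<bar>"
  using lil_cutoff_pos[of i] by (auto simp: lil_trunc_def indicator_def less_imp_le)

lemma sum_lil_tail_le: "(\<Sum>i<N. lil_tail i z / lil_rate i) \<le> 4 * z\<^sup>2"
proof -
  have "(\<Sum>i<N. lil_tail i z / lil_rate i) = \<bar>z\<bar> * (\<Sum>i<N. indicator {i. lil_cutoff i < \<bar>z\<bar>} i / lil_rate i)"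
    by (simp add: lil_tail_def sum_distrib_left)
  also have "\<dots> \<le> \<bar>z\<bar> * (4 * \<bar>z\<bar>)" by (intro mult_left_mono sum_inverse_lil_rate_below_le) auto
  finally show ?thesis by (simp add: power2_eq_square)
qed

lemma sum_le_lil_rate_times:
  assumes "\<And>i. 0 \<le> q i" "N \<le> Suc n"
  shows "(\<Sum>i<N. q i) \<le> lil_rate n * (\<Sum>i<N. q i / lil_rate i)"
  unfolding sum_distrib_left
proof (rule sum_mono)
  fix i assume "i \<in> {..<N}"
  then have "lil_rate i * q i \<le> lil_rate n * q i" using assms by (intro mult_right_mono lil_rate_mono) auto
  then show "q i \<le> lil_rate n * (q i / lil_rate i)" by (simp add: field_simps)
qed

end

locale lil_sequence = prob_space +
  fixes Z :: "nat \<Rightarrow> 'a \<Rightarrow> real"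
  assumes iid: "iid Z" and mean: "expectation (Z 0) = 0"
    and int: "integrable M (Z 0)" and int2: "integrable M (\<lambda>w. (Z 0 w)\<^sup>2)"
begin

definition var where "var = expectation (\<lambda>w. (Z 0 w)\<^sup>2)"

lemma rv [measurable]: "Z i \<in> borel_measurable M" using iid by (rule iid_measurable)

lemma integrable_Z: "integrable M (Z i)" using iid_integrable_iff[OF iid] int by blast

lemma integrable_Z2: "integrable M (\<lambda>w. (Z i w)\<^sup>2)" "expectation (\<lambda>w. (Z i w)\<^sup>2) = var"
proof -
  have *: "iid (\<lambda>i w. (Z i w)\<^sup>2)" using iid_compose[OF iid, of "\<lambda>z. z\<^sup>2"] by simp
  show "integrable M (\<lambda>w. (Z i w)\<^sup>2)" using iid_integrable_iff[OF *] int2 by blast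
  show "expectation (\<lambda>w. (Z i w)\<^sup>2) = var" using iid_expectation[OF *] unfolding var_def by blast
qed

lemma expectation_compose_Z:
  fixes f :: "real \<Rightarrow> real"
  assumes [measurable]: "f \<in> borel_measurable borel"
  shows "expectation (\<lambda>w. f (Z i w)) = expectation (\<lambda>w. f (Z 0 w))"
proof -
  have "iid (\<lambda>i w. f (Z i w))" using iid_compose[OF iid] by simp
  from iid_expectation[OF this] show ?thesis .
qed

lemma var_nonneg: "0 \<le> var" unfolding var_def by simp

lemma integrable_tail: "integrable M (\<lambda>w. lil_tail i (Z j w))"
  by (rule Bochner_Integration.integrable_bound[OF integrable_Z[of j]]) (auto simp: lil_tail_le)

lemma integrable_trunc: "integrable M (\<lambda>w. lil_trunc i (Z j w))"
  by (rule Bochner_Integration.integrable_bound[OF integrable_Z[of j]]) (auto simp: lil_trunc_abs_le)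

definition tail_mean where "tail_mean i = expectation (\<lambda>w. lil_tail i (Z i w))"

lemma tail_mean_nonneg: "0 \<le> tail_mean i" unfolding tail_mean_def by simp

lemma sum_tail_mean_weighted_le: "(\<Sum>i<N. tail_mean i / lil_rate i) \<le> 4 * var"
proof -
  have "(\<Sum>i<N. tail_mean i / lil_rate i) = (\<Sum>i<N. expectation (\<lambda>w. lil_tail i (Z 0 w)) / lil_rate i)"
    unfolding tail_mean_def by (intro sum.cong refl arg_cong2[where f="(/)"] expectation_compose_Z) simp
  also have "\<dots> = expectation (\<lambda>w. \<Sum>i<N. lil_tail i (Z 0 w) / lil_rate i)"
    using integrable_tail by simp
  also have "\<dots> \<le> expectation (\<lambda>w. 4 * (Z 0 w)\<^sup>2)"
    by (rule integral_mono) (use integrable_tail int2 sum_lil_tail_le in auto)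
  also have "\<dots> = 4 * var" by (simp add: var_def)
  finally show ?thesis .
qed

lemma sum_tail_mean_le: "N \<le> Suc n \<Longrightarrow> (\<Sum>i<N. tail_mean i) \<le> 4 * var * lil_rate n"
proof -
  assume N: "N \<le> Suc n"
  have "(\<Sum>i<N. tail_mean i) \<le> lil_rate n * (\<Sum>i<N. tail_mean i / lil_rate i)"
    using N by (rule sum_le_lil_rate_times[OF tail_mean_nonneg])
  also have "\<dots> \<le> lil_rate n * (4 * var)"
    by (intro mult_left_mono sum_tail_mean_weighted_le) (simp add: less_imp_le)
  finally show ?thesis by (simp add: mult_ac)
qed

text \<open>
  The tails, divided by the rate, have expectations that sum to at most four variances, so
  their series converges almost surely. As the rate is monotone, the tails themselves sum to
  the order of the rate.
\<close>

lemma sum_tail_bounded: "AE w in M. \<exists>B. \<forall>n. (\<Sum>i<n. lil_tail i (Z i w)) \<le> B * lil_rate n"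
proof -
  have "(\<integral>\<^sup>+w. (\<Sum>i. ennreal (lil_tail i (Z i w) / lil_rate i)) \<partial>M) = (\<Sum>i. \<integral>\<^sup>+w. ennreal (lil_tail i (Z i w) / lil_rate i) \<partial>M)"
    by (rule nn_integral_suminf) simp
  also have "\<dots> = (\<Sum>i. ennreal (tail_mean i / lil_rate i))"
  proof (intro suminf_cong)
    fix i
    show "(\<integral>\<^sup>+w. ennreal (lil_tail i (Z i w) / lil_rate i) \<partial>M) = ennreal (tail_mean i / lil_rate i)"
      unfolding tail_mean_def using integrable_tail[of i i]
      by (subst nn_integral_eq_integral) (auto simp: less_imp_le)
  qed
  also have "\<dots> \<le> ennreal (4 * var)"
  proof (rule suminf_le_const)
    fix n
    have "(\<Sum>i<n. ennreal (tail_mean i / lil_rate i)) = ennreal (\<Sum>i<n. tail_mean i / lil_rate i)"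
      by (rule sum_ennreal) (simp add: tail_mean_nonneg less_imp_le)
    then show "(\<Sum>i<n. ennreal (tail_mean i / lil_rate i)) \<le> ennreal (4 * var)"
      using sum_tail_mean_weighted_le by (simp add: ennreal_leI)
  qed simp
  also have "\<dots> < \<infinity>" by simp
  finally have "AE w in M. (\<Sum>i. ennreal (lil_tail i (Z i w) / lil_rate i)) \<noteq> \<infinity>"
    by (intro nn_integral_PInf_AE) auto
  then show ?thesis
  proof eventually_elim
    case (elim w)
    then obtain B where B: "(\<Sum>i. ennreal (lil_tail i (Z i w) / lil_rate i)) = ennreal B" "0 \<le> B"
      by (cases "\<Sum>i. ennreal (lil_tail i (Z i w) / lil_rate i)") auto
    have "(\<Sum>i<n. lil_tail i (Z i w)) \<le> B * lil_rate n" for n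
    proof -
      have "ennreal (\<Sum>i<n. lil_tail i (Z i w) / lil_rate i) = (\<Sum>i<n. ennreal (lil_tail i (Z i w) / lil_rate i))"
        by (rule sum_ennreal[symmetric]) (simp add: less_imp_le)
      also have "\<dots> \<le> (\<Sum>i. ennreal (lil_tail i (Z i w) / lil_rate i))" by (intro sum_le_suminf) auto
      finally have "(\<Sum>i<n. lil_tail i (Z i w) / lil_rate i) \<le> B" using B by simp
      then have "lil_rate n * (\<Sum>i<n. lil_tail i (Z i w) / lil_rate i) \<le> lil_rate n * B"
        by (intro mult_left_mono) (auto simp: less_imp_le)
      with sum_le_lil_rate_times[of "\<lambda>i. lil_tail i (Z i w)" n n]
      have "(\<Sum>i<n. lil_tail i (Z i w)) \<le> lil_rate n * B" by (metis lil_tail_nonneg le_SucI order_refl order_trans)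
      then show ?thesis by (simp add: mult.commute)
    qed
    then show ?case by blast
  qed
qed

text \<open>
  The exponent is at most 1 in absolute value, which makes the quadratic bound on the
  exponential function available. Truncation destroys the centering, but since the original
  variable is centered, the mean of the truncated one is at most the mean of the tail.
\<close>

lemma exp_trunc_expectation:
  assumes t: "0 < t" "t * lil_cutoff i \<le> 1"
  shows "expectation (\<lambda>w. exp (t * lil_trunc i (Z i w))) \<le> exp (t * tail_mean i + t\<^sup>2 * var)"
    and "integrable M (\<lambda>w. exp (t * lil_trunc i (Z i w)))"
proof -
  have b: "\<bar>t * lil_trunc i z\<bar> \<le> 1" for z
  proof -
    have "\<bar>t * lil_trunc i z\<bar> = t * \<bar>lil_trunc i z\<bar>" using t by (simp add: abs_mult)
    also have "\<dots> \<le> t * lil_cutoff i" using t lil_trunc_abs_le by (intro mult_left_mono) auto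
    finally show ?thesis using t by simp
  qed
  show i: "integrable M (\<lambda>w. exp (t * lil_trunc i (Z i w)))"
    by (rule integrable_const_bound[of _ "exp 1"]) (use b in \<open>auto simp: abs_le_iff\<close>)
  have "expectation (\<lambda>w. lil_trunc i (Z i w)) = expectation (\<lambda>w. lil_trunc i (Z i w)) - expectation (Z i)"
    using iid_expectation[OF iid, of i] mean by simp
  also have "\<dots> = expectation (\<lambda>w. lil_trunc i (Z i w) - Z i w)"
    using integrable_trunc integrable_Z by simp
  also have "\<dots> \<le> expectation (\<lambda>w. lil_tail i (Z i w))"
  proof (rule integral_mono)
    fix w show "lil_trunc i (Z i w) - Z i w \<le> lil_tail i (Z i w)"
      using lil_trunc_tail[of "Z i w" i] by linarith
  qed (use integrable_trunc integrable_tail integrable_Z in auto)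
  finally have m: "expectation (\<lambda>w. lil_trunc i (Z i w)) \<le> tail_mean i" by (simp add: tail_mean_def)
  have "expectation (\<lambda>w. exp (t * lil_trunc i (Z i w))) \<le> expectation (\<lambda>w. 1 + t * lil_trunc i (Z i w) + t\<^sup>2 * (Z i w)\<^sup>2)"
  proof (rule integral_mono[OF i])
    fix w
    have "(lil_trunc i (Z i w))\<^sup>2 \<le> (Z i w)\<^sup>2" using lil_trunc_abs_le(2) by (simp add: abs_le_square_iff)
    then have "(t * lil_trunc i (Z i w))\<^sup>2 \<le> t\<^sup>2 * (Z i w)\<^sup>2" by (simp add: power_mult_distrib mult_left_mono)
    then show "exp (t * lil_trunc i (Z i w)) \<le> 1 + t * lil_trunc i (Z i w) + t\<^sup>2 * (Z i w)\<^sup>2"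
      using exp_le_quadratic[OF b, of "Z i w"] by linarith
  qed (use integrable_trunc integrable_Z2 in auto)
  also have "\<dots> = 1 + t * expectation (\<lambda>w. lil_trunc i (Z i w)) + t\<^sup>2 * var"
    using integrable_trunc integrable_Z2 by (simp add: prob_space)
  also have "\<dots> \<le> 1 + (t * tail_mean i + t\<^sup>2 * var)" using m t by simp
  also have "\<dots> \<le> exp (t * tail_mean i + t\<^sup>2 * var)" by (rule exp_ge_add_one_self)
  finally show "expectation (\<lambda>w. exp (t * lil_trunc i (Z i w))) \<le> exp (t * tail_mean i + t\<^sup>2 * var)" .
qed

text \<open>
  Write $h$ for the iterated logarithm at $N$. With $t = 1/\mathrm{cutoff}(N)$ both
  $t \cdot \mathrm{rate}(N)$ and $t^2 (N+1)$ equal $h$. The means of the tails contribute at most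
  $4 \sigma^2 h$ to the logarithm of the moment generating function and the variances
  $\sigma^2 h$. The factor $5 \sigma^2 + 2$ is chosen to leave a surplus of $2 h$.
\<close>

lemma prob_running_sum_trunc_ge:
  "prob {w\<in>space M. \<exists>n\<le>Suc N. (5 * var + 2) * lil_rate N \<le> (\<Sum>i<n. lil_trunc i (Z i w))} \<le> exp (- 2 * lil_log N)"
proof -
  \<comment> \<open>The largest parameter for which all exponents up to index $N$ are at most 1.\<close>
  define t where "t = 1 / lil_cutoff N"
  have t: "0 < t" by (simp add: t_def)
  have tr: "t * lil_rate N = lil_log N" unfolding t_def by (simp add: lil_log_times_a[symmetric])
  have tN: "t\<^sup>2 * (real N + 1) = lil_log N" by (simp add: t_def power_divide lil_cutoff_square)
  define c where "c i = t * tail_mean i + t\<^sup>2 * var" for i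
  define G where "G i w = exp (t * lil_trunc i (Z i w) - c i)" for i w
  have G: "G i w = exp (t * lil_trunc i (Z i w)) * exp (- c i)" for i w by (simp add: G_def exp_diff exp_minus field_simps)
  have ta: "t * lil_cutoff i \<le> 1" if "i < Suc N" for i
    using that lil_cutoff_mono[of i N] by (simp add: t_def field_simps)
  have "indep_vars (\<lambda>_. borel) (\<lambda>i w. exp (t * lil_trunc i (Z i w) - c i)) UNIV"
    by (rule indep_vars_compose2[OF iid_indep_vars[OF iid]]) simp
  then have ind: "indep_vars (\<lambda>_. borel) G UNIV" unfolding G_def .
  have le: "prob {w\<in>space M. \<exists>n\<le>Suc N. exp (2 * lil_log N) \<le> (\<Prod>i<n. G i w)} \<le> 1 / exp (2 * lil_log N)"
  proof (rule prob_running_prod_ge[OF ind])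
    fix i assume i: "i < Suc N"
    show "integrable M (G i)" using exp_trunc_expectation(2)[OF t ta[OF i]] unfolding G by simp
    have "expectation (G i) = expectation (\<lambda>w. exp (t * lil_trunc i (Z i w))) * exp (- c i)"
      unfolding G by simp
    also have "\<dots> \<le> exp (c i) * exp (- c i)" unfolding c_def
      by (intro mult_right_mono exp_trunc_expectation(1)[OF t ta[OF i]]) simp
    finally show "expectation (G i) \<le> 1" by (simp add: exp_minus)
  qed (auto simp: G_def)
  have "exp (2 * lil_log N) \<le> (\<Prod>i<n. G i w)" 
    if n: "n \<le> Suc N" and ge: "(5 * var + 2) * lil_rate N \<le> (\<Sum>i<n. lil_trunc i (Z i w))" for n w
  proof -
    have "(\<Sum>i<n. c i) = t * (\<Sum>i<n. tail_mean i) + real n * (t\<^sup>2 * var)"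
      by (simp add: c_def sum.distrib sum_distrib_left)
    also have "\<dots> \<le> t * (4 * var * lil_rate N) + (real N + 1) * (t\<^sup>2 * var)"
      using sum_tail_mean_le[OF n] t n var_nonneg by (intro add_mono mult_left_mono mult_right_mono) auto
    also have "\<dots> = 4 * var * (t * lil_rate N) + var * (t\<^sup>2 * (real N + 1))" by (simp add: algebra_simps)
    also have "\<dots> = 5 * var * lil_log N" unfolding tr tN by simp
    finally have c: "(\<Sum>i<n. c i) \<le> 5 * var * lil_log N" .
    have "(5 * var + 2) * lil_log N = t * ((5 * var + 2) * lil_rate N)" using tr by (simp add: mult_ac)
    also have "\<dots> \<le> t * (\<Sum>i<n. lil_trunc i (Z i w))" using ge t by (intro mult_left_mono) auto
    finally have "2 * lil_log N \<le> (\<Sum>i<n. t * lil_trunc i (Z i w) - c i)"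
      using c by (simp add: sum_subtractf sum_distrib_left algebra_simps)
    then show ?thesis unfolding G_def by (simp add: exp_sum[symmetric])
  qed
  then have "prob {w\<in>space M. \<exists>n\<le>Suc N. (5 * var + 2) * lil_rate N \<le> (\<Sum>i<n. lil_trunc i (Z i w))}
    \<le> prob {w\<in>space M. \<exists>n\<le>Suc N. exp (2 * lil_log N) \<le> (\<Prod>i<n. G i w)}"
    by (intro finite_measure_mono) (auto simp: G_def)
  also have "\<dots> \<le> 1 / exp (2 * lil_log N)" by (rule le)
  finally show ?thesis by (simp add: exp_minus field_simps)
qed

text \<open>
  At $N = 2^k$ the probability $e^{-2h} = (\ln (2^k + 32))^{-2}$ is of order $k^{-2}$, and the
  Borel-Cantelli lemma applies. The maximal inequality covers all $n$ between two powers of 2,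
  between which the rate at most doubles.
\<close>

lemma sum_trunc_bounded:
  "AE w in M. \<forall>\<^sub>F n in sequentially. (\<Sum>i<n. lil_trunc i (Z i w)) \<le> 2 * (5 * var + 2) * lil_rate n"
proof -
  define A where "A k = {w\<in>space M. \<exists>n\<le>Suc (2^k). (5 * var + 2) * lil_rate (2^k) \<le> (\<Sum>i<n. lil_trunc i (Z i w))}" for k :: nat
  have [measurable]: "A k \<in> events" for k unfolding A_def by measurable
  have "summable (\<lambda>k. prob (A k))"
  proof (rule summable_comparison_test_ev)
    show "summable (\<lambda>k. (1 / (ln 2)\<^sup>2) * inverse (real k ^ 2))"
      by (intro summable_mult inverse_power_summable) simp
    show "\<forall>\<^sub>F k in sequentially. norm (prob (A k)) \<le> (1 / (ln 2)\<^sup>2) * inverse (real k ^ 2)"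
      using eventually_gt_at_top[of 0]
    proof eventually_elim
      case (elim k)
      define L where "L = ln (real (2^k) + 32)"
      have "real k * ln 2 = ln (2 ^ k)" by (simp add: ln_realpow)
      also have "\<dots> \<le> L" unfolding L_def by (rule ln_mono) auto
      finally have L: "real k * ln 2 \<le> L" .
      have pos: "0 < real k * ln 2" using elim by simp
      with L have L0: "0 < L" by linarith
      have "norm (prob (A k)) \<le> exp (- 2 * lil_log (2^k))"
        unfolding A_def using prob_running_sum_trunc_ge[of "2^k"] by simp
      also have "\<dots> = 1 / (exp (lil_log (2^k)))\<^sup>2"
        by (simp add: exp_minus field_simps exp_double)
      also have "exp (lil_log (2^k)) = L" using L pos unfolding lil_log_def L_def[symmetric] by simp
      also have "1 / L\<^sup>2 \<le> 1 / (real k * ln 2)\<^sup>2"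
        using power_mono[OF L, of 2] pos L0 by (intro frac_le zero_less_power) auto
      finally show ?case by (simp add: power_mult_distrib field_simps)
    qed
  qed
  then have "AE w in M. \<forall>\<^sub>F k in sequentially. w \<in> space M - A k"
    by (intro borel_cantelli_AE1) (auto simp: emeasure_eq_measure)
  then show ?thesis
  proof eventually_elim
    case (elim w)
    then obtain k0 where k0: "\<And>k. k \<ge> k0 \<Longrightarrow> w \<in> space M - A k" unfolding eventually_sequentially by blast
    show ?case
    proof (rule eventually_sequentiallyI[of "2 ^ Suc k0"])
      fix n :: nat assume n: "2 ^ Suc k0 \<le> n"
      then have "1 \<le> n" by (meson one_le_numeral one_le_power order_trans)
      then obtain k where k: "2 ^ k \<le> n" "n < 2 ^ (k + 1)" using ex_power_ivl1[of 2 n] by auto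
      have "(2::nat) ^ Suc k0 < 2 ^ (k + 1)" using n k by linarith
      then have "k0 \<le> k + 1" using power_less_imp_less_exp by fastforce
      then have "w \<notin> A (k + 1)" "w \<in> space M" using k0 by auto
      moreover have "n \<le> Suc (2 ^ (k + 1))" using k by linarith
      ultimately have "(\<Sum>i<n. lil_trunc i (Z i w)) \<le> (5 * var + 2) * lil_rate (2 ^ (k + 1))"
        unfolding A_def by force
      also have "lil_rate (2 ^ (k + 1)) \<le> 2 * lil_rate n"
        using lil_rate_double[of "2 ^ k"] lil_rate_mono[OF k(1)] by simp
      finally show "(\<Sum>i<n. lil_trunc i (Z i w)) \<le> 2 * (5 * var + 2) * lil_rate n"
        using var_nonneg by (simp add: mult_left_mono mult_ac)
    qed
  qed
qed

lemma sum_eventually_le: "AE w in M. \<exists>K. \<forall>\<^sub>F n in sequentially. (\<Sum>i<n. Z i w) \<le> K * lil_rate n"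
  using sum_tail_bounded sum_trunc_bounded
proof eventually_elim
  case (elim w)
  then obtain B where B: "\<And>n. (\<Sum>i<n. lil_tail i (Z i w)) \<le> B * lil_rate n" by blast
  have "\<forall>\<^sub>F n in sequentially. (\<Sum>i<n. Z i w) \<le> (B + 2 * (5 * var + 2)) * lil_rate n"
    using elim(2)
  proof eventually_elim
    case (elim n)
    have "(\<Sum>i<n. Z i w) \<le> (\<Sum>i<n. lil_tail i (Z i w) + lil_trunc i (Z i w))"
    proof (rule sum_mono)
      fix i show "Z i w \<le> lil_tail i (Z i w) + lil_trunc i (Z i w)"
        using lil_trunc_tail[of "Z i w" i] by linarith
    qed
    then show ?case using B[of n] elim by (simp add: sum.distrib algebra_simps)
  qed
  then show ?case by blast
qed

end

context prob_space begin

text \<open>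
  The bound from below is the one from above for the sequence with opposite signs.
\<close>

theorem iterated_logarithm_upper_bound:
  assumes Z: "iid Z" "integrable M (Z 0)" "expectation (Z 0) = 0" "integrable M (\<lambda>w. (Z 0 w)\<^sup>2)"
  shows "AE w in M. \<exists>K. \<forall>\<^sub>F n in sequentially. \<bar>\<Sum>i<n. Z i w\<bar> \<le> K * lil_rate n"
proof -
  interpret p: lil_sequence M Z by unfold_locales (use Z in auto)
  have "iid (\<lambda>i w. - Z i w)" using iid_compose[OF Z(1), of "\<lambda>z. - z"] by simp
  then interpret m: lil_sequence M "\<lambda>i w. - Z i w" by unfold_locales (use Z in auto)
  show ?thesis using p.sum_eventually_le m.sum_eventually_le
  proof eventually_elim
    case (elim w)
    then obtain K K' where K: "\<forall>\<^sub>F n in sequentially. (\<Sum>i<n. Z i w) \<le> K * lil_rate n"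
      "\<forall>\<^sub>F n in sequentially. (\<Sum>i<n. - Z i w) \<le> K' * lil_rate n" by blast
    have "\<forall>\<^sub>F n in sequentially. \<bar>\<Sum>i<n. Z i w\<bar> \<le> max K K' * lil_rate n"
      using K
    proof eventually_elim
      case (elim n)
      have "K * lil_rate n \<le> max K K' * lil_rate n" "K' * lil_rate n \<le> max K K' * lil_rate n"
        by (auto intro!: mult_right_mono simp: less_imp_le)
      then show ?case using elim by (simp only: sum_negf abs_le_iff) linarith
    qed
    then show ?case by blast
  qed
qed

theorem sum_over_dominating_sequence_tendsto_0:
  assumes Z: "iid Z" "integrable M (Z 0)" "expectation (Z 0) = 0" "integrable M (\<lambda>w. (Z 0 w)\<^sup>2)"
    and alpha: "filterlim (\<lambda>n. \<alpha> n / sqrt (real n * ln (ln (real n)))) at_top sequentially"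
  shows "AE w in M. (\<lambda>n. (\<Sum>i<n. Z i w) / \<alpha> n) \<longlonglongrightarrow> 0"
proof -
  have "(\<lambda>n. sqrt (real n * ln (ln (real n))) / lil_rate n) \<longlonglongrightarrow> 1"
    unfolding lil_rate_def lil_log_def by real_asymp
  then have "filterlim (\<lambda>n. sqrt (real n * ln (ln (real n))) / lil_rate n * (\<alpha> n / sqrt (real n * ln (ln (real n))))) at_top sequentially"
    by (rule filterlim_tendsto_pos_mult_at_top[OF _ _ alpha]) simp
  moreover have "\<forall>\<^sub>F n in sequentially. 0 < real n * ln (ln (real n))" by real_asymp
  then have "\<forall>\<^sub>F n in sequentially. sqrt (real n * ln (ln (real n))) / lil_rate n * (\<alpha> n / sqrt (real n * ln (ln (real n)))) = \<alpha> n / lil_rate n"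
    by eventually_elim auto
  ultimately have lim: "filterlim (\<lambda>n. \<alpha> n / lil_rate n) at_top sequentially"
    using filterlim_cong by fast
  then have inv: "(\<lambda>n. inverse (\<alpha> n / lil_rate n)) \<longlonglongrightarrow> 0"
    by (rule filterlim_compose[OF tendsto_inverse_0_at_top[OF filterlim_ident]])
  have pos: "\<forall>\<^sub>F n in sequentially. 0 < \<alpha> n / lil_rate n" 
    using lim by (simp add: filterlim_at_top_dense)
  show ?thesis using iterated_logarithm_upper_bound[OF Z]
  proof eventually_elim
    case (elim w)
    then obtain K where K: "\<forall>\<^sub>F n in sequentially. \<bar>\<Sum>i<n. Z i w\<bar> \<le> K * lil_rate n" by blast
    show ?case
    proof (rule Lim_null_comparison)
      show "(\<lambda>n. K * inverse (\<alpha> n / lil_rate n)) \<longlonglongrightarrow> 0" using tendsto_mult[OF tendsto_const inv, of K] by simp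
      show "\<forall>\<^sub>F n in sequentially. norm ((\<Sum>i<n. Z i w) / \<alpha> n) \<le> K * inverse (\<alpha> n / lil_rate n)"
        using K pos
      proof eventually_elim
        case (elim n)
        then have "0 < \<alpha> n" using lil_rate_pos[of n] by (simp add: zero_less_divide_iff less_asym)
        then show ?case using elim by (simp add: abs_divide divide_right_mono)
      qed
    qed
  qed
qed

end

section \<open>Two independent sequences observed term by term\<close>

context prob_space begin

lemma iid_composeI:
  assumes ind: "indep_vars (\<lambda>_. N) X UNIV" and same: "\<And>i. distr M N (X i) = D"
    and [measurable]: "f \<in> borel_measurable N"
  shows "iid (\<lambda>i w. f (X i w))"
proof -
  have [measurable]: "X i \<in> M \<rightarrow>\<^sub>M N" for i using ind unfolding indep_vars_def2 by auto
  have "distr M borel (\<lambda>w. f (X i w)) = distr D borel f" for i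
    unfolding same[of i, symmetric] by (subst distr_distr) (auto simp: comp_def)
  moreover have "indep_vars (\<lambda>_. borel) (\<lambda>i w. f (X i w)) UNIV"
    by (rule indep_vars_compose2[OF ind]) simp
  ultimately show ?thesis unfolding iid_def by simp
qed

lemma cylinder_in_PiM:
  assumes "finite K" "\<And>j. j \<in> K \<Longrightarrow> a j \<in> sets S"
  shows "{g \<in> space (Pi\<^sub>M (UNIV :: 'i set) (\<lambda>_. S)). \<forall>j\<in>K. g j \<in> a j} \<in> sets (Pi\<^sub>M UNIV (\<lambda>_. S))"
proof (rule sets.sets_Collect_finite_All)
  fix j assume "j \<in> K"
  then have "(\<lambda>g. g j) -` a j \<inter> space (Pi\<^sub>M (UNIV :: 'i set) (\<lambda>_. S)) \<in> sets (Pi\<^sub>M UNIV (\<lambda>_. S))"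
    using assms by (intro measurable_sets[OF measurable_component_singleton]) auto
  also have "(\<lambda>g. g j) -` a j \<inter> space (Pi\<^sub>M (UNIV :: 'i set) (\<lambda>_. S)) = {g \<in> space (Pi\<^sub>M UNIV (\<lambda>_. S)). g j \<in> a j}"
    by auto
  finally show "{g \<in> space (Pi\<^sub>M (UNIV :: 'i set) (\<lambda>_. S)). g j \<in> a j} \<in> sets (Pi\<^sub>M UNIV (\<lambda>_. S))" .
qed fact

lemma prob_Int_preimages:
  assumes X: "\<And>i. X i \<in> M \<rightarrow>\<^sub>M S" and Y: "\<And>i. Y i \<in> M \<rightarrow>\<^sub>M T"
    and ind: "indep_set
           (sets (vimage_algebra (space M) (\<lambda>w i. X i w) (Pi\<^sub>M (UNIV :: 'i set) (\<lambda>_. S))))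
           (sets (vimage_algebra (space M) (\<lambda>w i. Y i w) (Pi\<^sub>M (UNIV :: 'i set) (\<lambda>_. T))))"
    and K: "finite K" and a: "\<And>j. j \<in> K \<Longrightarrow> a j \<in> sets S" and b: "\<And>j. j \<in> K \<Longrightarrow> b j \<in> sets T"
  shows "prob ({w\<in>space M. \<forall>j\<in>K. X j w \<in> a j} \<inter> {w\<in>space M. \<forall>j\<in>K. Y j w \<in> b j})
    = prob {w\<in>space M. \<forall>j\<in>K. X j w \<in> a j} * prob {w\<in>space M. \<forall>j\<in>K. Y j w \<in> b j}"
proof (rule indep_setD[OF ind])
  have "(\<lambda>w i. X i w) -` {g \<in> space (Pi\<^sub>M UNIV (\<lambda>_. S)). \<forall>j\<in>K. g j \<in> a j} \<inter> space M
      \<in> sets (vimage_algebra (space M) (\<lambda>w i. X i w) (Pi\<^sub>M UNIV (\<lambda>_. S)))"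
    using K a by (intro in_vimage_algebra cylinder_in_PiM)
  also have "(\<lambda>w i. X i w) -` {g \<in> space (Pi\<^sub>M UNIV (\<lambda>_. S)). \<forall>j\<in>K. g j \<in> a j} \<inter> space M = {w\<in>space M. \<forall>j\<in>K. X j w \<in> a j}"
    using measurable_space[OF X] by (auto simp: space_PiM)
  finally show "{w\<in>space M. \<forall>j\<in>K. X j w \<in> a j} \<in> sets (vimage_algebra (space M) (\<lambda>w i. X i w) (Pi\<^sub>M UNIV (\<lambda>_. S)))" .
  have "(\<lambda>w i. Y i w) -` {g \<in> space (Pi\<^sub>M UNIV (\<lambda>_. T)). \<forall>j\<in>K. g j \<in> b j} \<inter> space M
      \<in> sets (vimage_algebra (space M) (\<lambda>w i. Y i w) (Pi\<^sub>M UNIV (\<lambda>_. T)))"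
    using K b by (intro in_vimage_algebra cylinder_in_PiM)
  also have "(\<lambda>w i. Y i w) -` {g \<in> space (Pi\<^sub>M UNIV (\<lambda>_. T)). \<forall>j\<in>K. g j \<in> b j} \<inter> space M = {w\<in>space M. \<forall>j\<in>K. Y j w \<in> b j}"
    using measurable_space[OF Y] by (auto simp: space_PiM)
  finally show "{w\<in>space M. \<forall>j\<in>K. Y j w \<in> b j} \<in> sets (vimage_algebra (space M) (\<lambda>w i. Y i w) (Pi\<^sub>M UNIV (\<lambda>_. T)))" .
qed

text \<open>
  The maps $f$ and $g$ bring values of possibly different types into a common one.
\<close>

lemma indep_var_if_families_indep:
  fixes X :: "'i \<Rightarrow> 'a \<Rightarrow> 'b" and Y :: "'i \<Rightarrow> 'a \<Rightarrow> 'c" and f :: "'b \<Rightarrow> 'd" and g :: "'c \<Rightarrow> 'd"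
  assumes X: "\<And>i. X i \<in> M \<rightarrow>\<^sub>M S" and Y: "\<And>i. Y i \<in> M \<rightarrow>\<^sub>M T"
    and ind: "indep_set
           (sets (vimage_algebra (space M) (\<lambda>w i. X i w) (Pi\<^sub>M UNIV (\<lambda>_. S))))
           (sets (vimage_algebra (space M) (\<lambda>w i. Y i w) (Pi\<^sub>M UNIV (\<lambda>_. T))))"
    and f: "f \<in> S \<rightarrow>\<^sub>M R" and g: "g \<in> T \<rightarrow>\<^sub>M R'"
  shows "indep_var R (\<lambda>w. f (X i w)) R' (\<lambda>w. g (Y i w))"
proof -
  let ?F = "{(\<lambda>w. f (X i w)) -` A \<inter> space M | A. A \<in> sets R}"
  let ?G = "{(\<lambda>w. g (Y i w)) -` B \<inter> space M | B. B \<in> sets R'}"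
  have fX: "(\<lambda>w. f (X i w)) \<in> M \<rightarrow>\<^sub>M R" and gY: "(\<lambda>w. g (Y i w)) \<in> M \<rightarrow>\<^sub>M R'"
    using measurable_compose[OF X f] measurable_compose[OF Y g] by auto
  have "indep_set ?F ?G"
  proof (rule indep_setI)
    fix A' B' assume "A' \<in> ?F" "B' \<in> ?G"
    then obtain A B where AB: "A \<in> sets R" "B \<in> sets R'"
      and "A' = (\<lambda>w. f (X i w)) -` A \<inter> space M" "B' = (\<lambda>w. g (Y i w)) -` B \<inter> space M" by blast
    then have eq: "A' = {w\<in>space M. \<forall>j\<in>{i}. X j w \<in> f -` A \<inter> space S}" "B' = {w\<in>space M. \<forall>j\<in>{i}. Y j w \<in> g -` B \<inter> space T}"
      using measurable_space[OF X] measurable_space[OF Y] by auto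
    show "prob (A' \<inter> B') = prob A' * prob B'"
      unfolding eq by (rule prob_Int_preimages[OF X Y ind]) (use AB f g in \<open>auto intro: measurable_sets\<close>)
  qed (use fX gY in \<open>auto intro: measurable_sets\<close>)
  moreover have "Int_stable ?F" "Int_stable ?G"
  proof -
    have "Int_stable {h -` A \<inter> space M | A. A \<in> sets N}" for h :: "'a \<Rightarrow> 'd" and N
    proof (rule Int_stableI)
      fix a b assume "a \<in> {h -` A \<inter> space M | A. A \<in> sets N}" "b \<in> {h -` A \<inter> space M | A. A \<in> sets N}"
      then obtain A B where AB: "A \<in> sets N" "B \<in> sets N" "a = h -` A \<inter> space M" "b = h -` B \<inter> space M" by blast
      then have "a \<inter> b = h -` (A \<inter> B) \<inter> space M" "A \<inter> B \<in> sets N" by auto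
      then show "a \<inter> b \<in> {h -` A \<inter> space M | A. A \<in> sets N}" by blast
    qed
    then show "Int_stable ?F" "Int_stable ?G" by auto
  qed
  ultimately have "indep_set (sigma_sets (space M) ?F) (sigma_sets (space M) ?G)"
    by (rule indep_set_sigma_sets)
  then show ?thesis unfolding indep_var_eq using fX gY by auto
qed

text \<open>
  The rectangles $\{X_i \in A, Y_i \in B\}$ are stable under intersection and generate the
  $\sigma$-algebra of the pair. The probability of finitely many of them factors first between
  the two families and then within each family.
\<close>

lemma indep_vars_Pair:
  fixes X :: "'i \<Rightarrow> 'a \<Rightarrow> 'b" and Y :: "'i \<Rightarrow> 'a \<Rightarrow> 'c"
  assumes indX: "indep_vars (\<lambda>_. S) X UNIV" and indY: "indep_vars (\<lambda>_. T) Y UNIV"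
    and ind: "indep_set
           (sets (vimage_algebra (space M) (\<lambda>w i. X i w) (Pi\<^sub>M UNIV (\<lambda>_. S))))
           (sets (vimage_algebra (space M) (\<lambda>w i. Y i w) (Pi\<^sub>M UNIV (\<lambda>_. T))))"
  shows "indep_vars (\<lambda>_. S \<Otimes>\<^sub>M T) (\<lambda>i w. (X i w, Y i w)) UNIV"
proof -
  have X[measurable]: "X i \<in> M \<rightarrow>\<^sub>M S" and Y[measurable]: "Y i \<in> M \<rightarrow>\<^sub>M T" for i
    using indX indY unfolding indep_vars_def2 by auto
  define E where "E i = {{w\<in>space M. X i w \<in> A \<and> Y i w \<in> B} | A B. A \<in> sets S \<and> B \<in> sets T}" for i
  have E_ev: "E i \<subseteq> events" for i unfolding E_def by (auto intro!: sets.sets_Collect)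
  have "indep_sets E UNIV"
  proof (rule indep_setsI[OF E_ev])
    fix F and K :: "'i set" assume K: "K \<noteq> {}" "finite K" and FE: "\<forall>j\<in>K. F j \<in> E j"
    have "\<exists>p. j \<in> K \<longrightarrow> fst p \<in> sets S \<and> snd p \<in> sets T \<and> F j = {w\<in>space M. X j w \<in> fst p \<and> Y j w \<in> snd p}" for j
    proof (cases "j \<in> K")
      case True
      then have "F j \<in> E j" using FE by blast
      then obtain A B where "A \<in> sets S" "B \<in> sets T" "F j = {w\<in>space M. X j w \<in> A \<and> Y j w \<in> B}"
        unfolding E_def by blast
      then show ?thesis by (intro exI[of _ "(A, B)"]) simp
    qed simp
    then have "\<exists>p. \<forall>j. j \<in> K \<longrightarrow> fst (p j) \<in> sets S \<and> snd (p j) \<in> sets T \<and> F j = {w\<in>space M. X j w \<in> fst (p j) \<and> Y j w \<in> snd (p j)}"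
      by (intro choice allI)
    then obtain p where p: "\<forall>j. j \<in> K \<longrightarrow> fst (p j) \<in> sets S \<and> snd (p j) \<in> sets T \<and> F j = {w\<in>space M. X j w \<in> fst (p j) \<and> Y j w \<in> snd (p j)}"
      by blast
    define a where "a j = fst (p j)" for j
    define b where "b j = snd (p j)" for j
    have ab: "\<And>j. j \<in> K \<Longrightarrow> a j \<in> sets S" "\<And>j. j \<in> K \<Longrightarrow> b j \<in> sets T"
      and F: "\<And>j. j \<in> K \<Longrightarrow> F j = {w\<in>space M. X j w \<in> a j \<and> Y j w \<in> b j}"
      using p unfolding a_def b_def by blast+
    have single: "prob (F j) = prob (X j -` a j \<inter> space M) * prob (Y j -` b j \<inter> space M)" if j: "j \<in> K" for j
    proof -
      have "F j = {w\<in>space M. \<forall>j\<in>{j}. X j w \<in> a j} \<inter> {w\<in>space M. \<forall>j\<in>{j}. Y j w \<in> b j}"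
        using F[OF j] by auto
      then have "prob (F j) = prob {w\<in>space M. \<forall>j\<in>{j}. X j w \<in> a j} * prob {w\<in>space M. \<forall>j\<in>{j}. Y j w \<in> b j}"
        using j ab by (simp only:) (rule prob_Int_preimages[OF X Y ind], auto)
      moreover have "{w\<in>space M. \<forall>j\<in>{j}. X j w \<in> a j} = X j -` a j \<inter> space M" by auto
      moreover have "{w\<in>space M. \<forall>j\<in>{j}. Y j w \<in> b j} = Y j -` b j \<inter> space M" by auto
      ultimately show ?thesis by simp
    qed
    have "(\<Inter>j\<in>K. F j) = {w\<in>space M. \<forall>j\<in>K. X j w \<in> a j} \<inter> {w\<in>space M. \<forall>j\<in>K. Y j w \<in> b j}"
      using K(1) F by auto
    then have "prob (\<Inter>j\<in>K. F j) = prob {w\<in>space M. \<forall>j\<in>K. X j w \<in> a j} * prob {w\<in>space M. \<forall>j\<in>K. Y j w \<in> b j}"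
      using ab by (simp only:) (rule prob_Int_preimages[OF X Y ind K(2)], auto)
    also have "{w\<in>space M. \<forall>j\<in>K. X j w \<in> a j} = (\<Inter>j\<in>K. X j -` a j \<inter> space M)" using K(1) by auto
    also have "{w\<in>space M. \<forall>j\<in>K. Y j w \<in> b j} = (\<Inter>j\<in>K. Y j -` b j \<inter> space M)" using K(1) by auto
    also have "prob (\<Inter>j\<in>K. X j -` a j \<inter> space M) = (\<Prod>j\<in>K. prob (X j -` a j \<inter> space M))"
      by (rule indep_varsD[OF indX K]) (use ab in auto)
    also have "prob (\<Inter>j\<in>K. Y j -` b j \<inter> space M) = (\<Prod>j\<in>K. prob (Y j -` b j \<inter> space M))"
      by (rule indep_varsD[OF indY K]) (use ab in auto)
    also have "(\<Prod>j\<in>K. prob (X j -` a j \<inter> space M)) * (\<Prod>j\<in>K. prob (Y j -` b j \<inter> space M)) = (\<Prod>j\<in>K. prob (F j))"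
      unfolding prod.distrib[symmetric] using single by (intro prod.cong) auto
    finally show "prob (\<Inter>j\<in>K. F j) = (\<Prod>j\<in>K. prob (F j))" .
  qed
  moreover have "Int_stable (E i)" for i
  proof (rule Int_stableI)
    fix F G assume "F \<in> E i" "G \<in> E i"
    then obtain A B A' B' where "A \<in> sets S" "B \<in> sets T" "F = {w\<in>space M. X i w \<in> A \<and> Y i w \<in> B}"
      "A' \<in> sets S" "B' \<in> sets T" "G = {w\<in>space M. X i w \<in> A' \<and> Y i w \<in> B'}" unfolding E_def by blast
    moreover from this have "F \<inter> G = {w\<in>space M. X i w \<in> A \<inter> A' \<and> Y i w \<in> B \<inter> B'}" by auto
    ultimately show "F \<inter> G \<in> E i" unfolding E_def by blast
  qed
  ultimately have sig: "indep_sets (\<lambda>i. sigma_sets (space M) (E i)) UNIV" by (rule indep_sets_sigma)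
  have "{(\<lambda>w. (X i w, Y i w)) -` A \<inter> space M | A. A \<in> sets (S \<Otimes>\<^sub>M T)} \<subseteq> sigma_sets (space M) (E i)" for i
  proof -
    define N where "N = sigma (space M) (E i)"
    have "E i \<subseteq> Pow (space M)" unfolding E_def by auto
    then have N: "space N = space M" "sets N = sigma_sets (space M) (E i)" by (auto simp: N_def)
    have "X i \<in> N \<rightarrow>\<^sub>M S"
    proof (rule measurableI)
      fix A assume "A \<in> sets S"
      moreover have "X i -` A \<inter> space N = {w\<in>space M. X i w \<in> A \<and> Y i w \<in> space T}"
        using measurable_space[OF Y] by (auto simp: N)
      ultimately show "X i -` A \<inter> space N \<in> sets N" unfolding N E_def by (intro sigma_sets.Basic) blast
    qed (use measurable_space[OF X] in \<open>simp add: N\<close>)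
    moreover have "Y i \<in> N \<rightarrow>\<^sub>M T"
    proof (rule measurableI)
      fix B assume "B \<in> sets T"
      moreover have "Y i -` B \<inter> space N = {w\<in>space M. X i w \<in> space S \<and> Y i w \<in> B}"
        using measurable_space[OF X] by (auto simp: N)
      ultimately show "Y i -` B \<inter> space N \<in> sets N" unfolding N E_def by (intro sigma_sets.Basic) blast
    qed (use measurable_space[OF Y] in \<open>simp add: N\<close>)
    ultimately have "(\<lambda>w. (X i w, Y i w)) \<in> N \<rightarrow>\<^sub>M S \<Otimes>\<^sub>M T" by simp
    from measurable_sets[OF this] show ?thesis unfolding N by auto
  qed
  then have "indep_sets (\<lambda>i. {(\<lambda>w. (X i w, Y i w)) -` A \<inter> space M | A. A \<in> sets (S \<Otimes>\<^sub>M T)}) UNIV"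
    by (intro indep_sets_mono_sets[OF sig])
  then show ?thesis unfolding indep_vars_def2 by auto
qed

end

lemma integrable_mult_if_square_integrable:
  fixes f g :: "'a \<Rightarrow> real"
  assumes [measurable]: "f \<in> borel_measurable M" "g \<in> borel_measurable M"
    and "integrable M (\<lambda>w. (f w)\<^sup>2)" "integrable M (\<lambda>w. (g w)\<^sup>2)"
  shows "integrable M (\<lambda>w. f w * g w)"
proof (rule Bochner_Integration.integrable_bound)
  show "integrable M (\<lambda>w. (f w)\<^sup>2 + (g w)\<^sup>2)" using assms by simp
  show "AE w in M. norm (f w * g w) \<le> norm ((f w)\<^sup>2 + (g w)\<^sup>2)"
  proof (rule AE_I2)
    fix w
    have "2 * (\<bar>f w\<bar> * \<bar>g w\<bar>) \<le> (f w)\<^sup>2 + (g w)\<^sup>2" using sum_squares_bound[of "\<bar>f w\<bar>" "\<bar>g w\<bar>"] by simp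
    moreover have "0 \<le> \<bar>f w\<bar> * \<bar>g w\<bar>" by simp
    ultimately have "\<bar>f w\<bar> * \<bar>g w\<bar> \<le> (f w)\<^sup>2 + (g w)\<^sup>2" by linarith
    then show "norm (f w * g w) \<le> norm ((f w)\<^sup>2 + (g w)\<^sup>2)" by (simp add: abs_mult)
  qed
qed simp

section \<open>Index positions and sorted absolute values\<close>

lemma pos_of_less: "i < j \<Longrightarrow> pos_of i < pos_of j"
  unfolding pos_of_def by (intro psubset_card_mono) auto

lemma pos_of_less_CARD: "pos_of (i::'p::{finite,linorder}) < CARD('p)"
  unfolding pos_of_def by (intro psubset_card_mono) auto

lemma bij_betw_pos_of: "bij_betw pos_of (UNIV :: 'p::{finite,linorder} set) {..<CARD('p)}"
proof -
  have inj: "inj (pos_of :: 'p \<Rightarrow> nat)" by (rule injI) (metis pos_of_less neqE less_irrefl)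
  moreover have "pos_of ` (UNIV :: 'p set) = {..<CARD('p)}"
    by (rule card_subset_eq) (auto simp: card_image[OF inj] pos_of_less_CARD)
  ultimately show ?thesis by (simp add: bij_betw_def)
qed

lemma pos_of_index_at:
  assumes "m < CARD('p::{finite,linorder})"
  shows "pos_of (index_at m :: 'p) = m"
proof -
  let ?xs = "sorted_list_of_set (UNIV :: 'p set)"
  have len: "length ?xs = CARD('p)" and set: "set ?xs = UNIV" and dist: "distinct ?xs" by auto
  have sorted: "sorted_wrt (<) ?xs" by simp
  have "{..<?xs ! m} = (\<lambda>k. ?xs ! k) ` {..<m}"
  proof (intro equalityI subsetI)
    fix x assume "x \<in> {..<?xs ! m}"
    then have lt: "x < ?xs ! m" by simp
    obtain k where k: "k < CARD('p)" "x = ?xs ! k" using set len by (metis UNIV_I in_set_conv_nth)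
    have "k < m"
    proof (rule ccontr)
      assume "\<not> k < m"
      then consider "k = m" | "m < k" by linarith
      then show False using lt k sorted_wrt_nth_less[OF sorted, of m k] len by cases auto
    qed
    then show "x \<in> (\<lambda>k. ?xs ! k) ` {..<m}" using k by auto
  next
    fix x assume "x \<in> (\<lambda>k. ?xs ! k) ` {..<m}"
    then show "x \<in> {..<?xs ! m}" using sorted_wrt_nth_less[OF sorted, of _ m] assms len by auto
  qed
  moreover have "inj_on (\<lambda>k. ?xs ! k) {..<m}" using dist assms len by (auto simp: inj_on_def nth_eq_iff_index_eq)
  ultimately show ?thesis unfolding pos_of_def index_at_def by (simp add: card_image)
qed

lemma index_at_pos_of: "index_at (pos_of i) = (i :: 'p::{finite,linorder})"
proof -
  have "pos_of (index_at (pos_of i) :: 'p) = pos_of i" by (intro pos_of_index_at pos_of_less_CARD)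
  then show ?thesis using bij_betw_pos_of[where 'p='p] by (auto simp: bij_betw_def inj_eq)
qed

lemma abs_sorted_permutation:
  fixes b :: "real ^ 'p::{finite,linorder}"
  shows "\<exists>\<sigma>. bij \<sigma> \<and> (\<forall>i. abs_sorted b $ i = \<bar>b $ \<sigma> i\<bar>) \<and> (\<forall>i j. i < j \<longrightarrow> \<bar>b $ \<sigma> j\<bar> \<le> \<bar>b $ \<sigma> i\<bar>)"
proof -
  let ?f = "\<lambda>j. \<bar>b $ j\<bar>"
  let ?xs = "sorted_list_of_set (UNIV :: 'p set)"
  define l where "l = rev (sort_key ?f ?xs)"
  have len: "length l = CARD('p)" and set: "set l = UNIV" and dist: "distinct l" by (auto simp: l_def)
  have "image_mset ?f (mset_set UNIV) = mset (map ?f ?xs)" using mset_set_set[of ?xs] by simp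
  then have "sorted_list_of_multiset (image_mset ?f (mset_set UNIV)) = sort (map ?f ?xs)"
    by (simp only: sorted_list_of_multiset_mset)
  also have "\<dots> = map ?f (sort_key ?f ?xs)" by (rule properties_for_sort) auto
  finally have eq: "abs_sorted b $ i = ?f (l ! pos_of i)" for i
    using pos_of_less_CARD[of i] len by (simp add: abs_sorted_def l_def rev_map)
  have bij: "bij (\<lambda>i::'p. l ! pos_of i)"
    using bij_betw_trans[OF bij_betw_pos_of bij_betw_nth[OF dist, of "{..<CARD('p)}" UNIV]] len set
    by (auto simp: comp_def)
  have "sorted (rev (map ?f l))" by (simp add: l_def rev_map)
  then have "?f (l ! pos_of j) \<le> ?f (l ! pos_of i)" if "i < j" for i j :: 'p
    using sorted_rev_nth_mono[of "map ?f l" "pos_of i" "pos_of j"] that pos_of_less[OF that] pos_of_less_CARD[of j] pos_of_less_CARD[of i] len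
    by (simp add: less_imp_le)
  then show ?thesis using bij eq by blast
qed

text \<open>
  Induction on the largest index $m$. If $\pi$ does not fix $m$, let it exchange its values at
  $m$ and at the preimage of $m$: the sum does not decrease, since the largest index then
  receives the smallest value. A permutation that fixes $m$ is left to the induction hypothesis.
\<close>

lemma rearrangement:
  fixes a c :: "'p::linorder \<Rightarrow> real"
  assumes "finite S" "\<pi> permutes S"
    and "\<And>i j. i \<in> S \<Longrightarrow> j \<in> S \<Longrightarrow> i < j \<Longrightarrow> a j \<le> a i"
    and "\<And>i j. i \<in> S \<Longrightarrow> j \<in> S \<Longrightarrow> i < j \<Longrightarrow> c j \<le> c i"
  shows "(\<Sum>i\<in>S. a i * c (\<pi> i)) \<le> (\<Sum>i\<in>S. a i * c i)"
  using assms
proof (induction S arbitrary: \<pi> rule: finite_linorder_max_induct)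
  case (insert m A)
  have m: "m \<notin> A" using insert.hyps by auto
  have fixed: "(\<Sum>i\<in>insert m A. a i * c (\<rho> i)) \<le> (\<Sum>i\<in>insert m A. a i * c i)" 
    if \<rho>: "\<rho> permutes insert m A" "\<rho> m = m" for \<rho>
  proof -
    have "\<rho> permutes A" by (rule permutes_superset[OF \<rho>(1)]) (use \<rho>(2) in auto)
    then have "(\<Sum>i\<in>A. a i * c (\<rho> i)) \<le> (\<Sum>i\<in>A. a i * c i)" using insert.prems by (intro insert.IH) auto
    then show ?thesis using insert.hyps m \<rho> by simp
  qed
  show ?case
  proof (cases "\<pi> m = m")
    case False
    obtain j where j: "\<pi> j = m" using permutes_surj[OF insert.prems(1)] by (metis surjD)
    have jA: "j \<in> A" using j False permutes_in_image[OF insert.prems(1), of j] by auto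
    have lA: "\<pi> m \<in> A" using False permutes_in_image[OF insert.prems(1), of m] by auto
    define \<rho> where "\<rho> = \<pi> \<circ> Transposition.transpose j m"
    have \<rho>: "\<rho> permutes insert m A" unfolding \<rho>_def
      using jA by (intro permutes_compose[OF permutes_swap_id insert.prems(1)]) auto
    have v: "\<rho> m = m" "\<rho> j = \<pi> m" by (auto simp: \<rho>_def j)
    have o: "\<rho> i = \<pi> i" if "i \<in> A - {j}" for i using that m by (auto simp: \<rho>_def Transposition.transpose_def)
    have s: "(\<Sum>i\<in>insert m A. f i) = f m + (f j + (\<Sum>i\<in>A - {j}. f i))" for f :: "'p \<Rightarrow> real"
      using insert.hyps m jA by (simp add: sum.remove)
    have "0 \<le> (a j - a m) * (c (\<pi> m) - c m)"
      using insert.prems insert.hyps jA lA by (intro mult_nonneg_nonneg) auto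
    then have "a m * c (\<pi> m) + a j * c (\<pi> j) \<le> a m * c (\<rho> m) + a j * c (\<rho> j)"
      by (simp add: v j algebra_simps)
    moreover have "(\<Sum>i\<in>A - {j}. a i * c (\<pi> i)) = (\<Sum>i\<in>A - {j}. a i * c (\<rho> i))" using o by (intro sum.cong) auto
    ultimately have "(\<Sum>i\<in>insert m A. a i * c (\<pi> i)) \<le> (\<Sum>i\<in>insert m A. a i * c (\<rho> i))" unfolding s by linarith
    also have "\<dots> \<le> (\<Sum>i\<in>insert m A. a i * c i)" by (rule fixed[OF \<rho> v(1)])
    finally show ?thesis .
  qed (use fixed insert.prems in auto)
qed simp

section \<open>Patterns and their spaces\<close>

text \<open>
  For a pattern $M$ this is the column space of $U_M$: the vectors that vanish where $M$ does and whose
  signed entries agree on each cluster of $M$.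
\<close>

definition pattern_space :: "real ^ 'p \<Rightarrow> (real ^ 'p) set" where
  "pattern_space M = {z. (\<forall>i. M $ i = 0 \<longrightarrow> z $ i = 0) \<and> 
     (\<forall>i j. \<bar>M $ i\<bar> = \<bar>M $ j\<bar> \<longrightarrow> sgn (M $ i) * z $ i = sgn (M $ j) * z $ j)}"

text \<open>
  Equality of patterns, expressed by signs and comparisons of absolute values instead of ranks.
\<close>

definition same_pattern :: "real ^ 'p \<Rightarrow> real ^ 'p \<Rightarrow> bool" where
  "same_pattern a b \<longleftrightarrow> (\<forall>i. sgn (a $ i) = sgn (b $ i)) \<and> (\<forall>i j. \<bar>a $ i\<bar> \<le> \<bar>a $ j\<bar> \<longleftrightarrow> \<bar>b $ i\<bar> \<le> \<bar>b $ j\<bar>)"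

lemma same_pattern_sym: "same_pattern a b \<Longrightarrow> same_pattern b a"
  by (simp add: same_pattern_def)

lemma same_pattern_trans: "same_pattern a b \<Longrightarrow> same_pattern b c \<Longrightarrow> same_pattern a c"
  by (simp add: same_pattern_def)

lemma same_pattern_eq_iff: "same_pattern a b \<Longrightarrow> \<bar>a $ i\<bar> = \<bar>a $ j\<bar> \<longleftrightarrow> \<bar>b $ i\<bar> = \<bar>b $ j\<bar>"
  by (simp add: same_pattern_def order_eq_iff)

lemma same_pattern_zero_iff: "same_pattern a b \<Longrightarrow> a $ i = 0 \<longleftrightarrow> b $ i = 0"
  by (metis same_pattern_def sgn_eq_0_iff)

lemma card_image_le_if_factors:
  assumes "finite S" "\<And>x y. x \<in> S \<Longrightarrow> y \<in> S \<Longrightarrow> f x = f y \<Longrightarrow> g x = g y"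
  shows "card (g ` S) \<le> card (f ` S)"
proof -
  have "g ` S = (g \<circ> inv_into S f) ` (f ` S)"
  proof (intro equalityI image_subsetI)
    fix x assume x: "x \<in> S"
    then have "f (inv_into S f (f x)) = f x" "inv_into S f (f x) \<in> S" by (auto intro: f_inv_into_f inv_into_into)
    then have "g x = g (inv_into S f (f x))" using assms(2) x by metis
    then show "g x \<in> (g \<circ> inv_into S f) ` (f ` S)" using x by auto
  next
    fix y assume "y \<in> f ` S"
    then show "(g \<circ> inv_into S f) y \<in> g ` S" by (auto intro: inv_into_into)
  qed
  then show ?thesis using assms(1) by (metis card_image_le finite_imageI)
qed

lemma abs_rank_image: "abs_rank b i = card ((\<lambda>j. \<bar>b $ j\<bar>) ` {j. b $ j \<noteq> 0 \<and> \<bar>b $ j\<bar> \<le> \<bar>b $ i\<bar>})"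
  unfolding abs_rank_def by (intro arg_cong[where f=card]) auto

lemma patt_eq_if_same_pattern:
  assumes "same_pattern a b" shows "patt a = patt b"
proof -
  have "abs_rank a i = abs_rank b i" for i
  proof -
    have S: "{j. a $ j \<noteq> 0 \<and> \<bar>a $ j\<bar> \<le> \<bar>a $ i\<bar>} = {j. b $ j \<noteq> 0 \<and> \<bar>b $ j\<bar> \<le> \<bar>b $ i\<bar>}"
      using assms same_pattern_zero_iff[OF assms] unfolding same_pattern_def by auto
    show ?thesis unfolding abs_rank_image S
      using same_pattern_eq_iff[OF assms] by (intro order_antisym[OF card_image_le_if_factors card_image_le_if_factors]) simp_all
  qed
  then show ?thesis using assms by (simp add: patt_def same_pattern_def)
qed

lemma abs_rank_le_iff: "abs_rank b i \<le> abs_rank b j \<longleftrightarrow> \<bar>b $ i\<bar> \<le> \<bar>b $ j\<bar>"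
proof
  assume le: "\<bar>b $ i\<bar> \<le> \<bar>b $ j\<bar>"
  show "abs_rank b i \<le> abs_rank b j" unfolding abs_rank_image
    by (intro card_mono) (use le in auto)
next
  show "\<bar>b $ i\<bar> \<le> \<bar>b $ j\<bar>" if "abs_rank b i \<le> abs_rank b j"
  proof (rule ccontr)
    assume *: "\<not> \<bar>b $ i\<bar> \<le> \<bar>b $ j\<bar>"
    let ?f = "\<lambda>j. \<bar>b $ j\<bar>"
    have "?f i \<in> ?f ` {k. b $ k \<noteq> 0 \<and> ?f k \<le> ?f i}" "?f i \<notin> ?f ` {k. b $ k \<noteq> 0 \<and> ?f k \<le> ?f j}"
      using * by auto
    moreover have "?f ` {k. b $ k \<noteq> 0 \<and> ?f k \<le> ?f j} \<subseteq> ?f ` {k. b $ k \<noteq> 0 \<and> ?f k \<le> ?f i}"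
      using * by auto
    ultimately have "abs_rank b j < abs_rank b i" unfolding abs_rank_image
      by (intro psubset_card_mono) auto
    then show False using that by simp
  qed
qed

lemma abs_rank_eq_0_iff: "abs_rank b i = 0 \<longleftrightarrow> b $ i = 0"
  by (auto simp: abs_rank_image card_eq_0_iff)

lemma abs_patt: "\<bar>patt b $ i\<bar> = real (abs_rank b i)"
  using abs_rank_eq_0_iff[of b i] by (auto simp: patt_def abs_mult abs_sgn_eq)

lemma same_pattern_patt: "same_pattern b (patt b)"
proof -
  have "sgn (patt b $ i) = sgn (b $ i)" for i
    using abs_rank_eq_0_iff[of b i] by (auto simp: patt_def sgn_mult)
  then show ?thesis by (simp add: same_pattern_def abs_patt abs_rank_le_iff)
qed

lemma pattern_space_zero: "z \<in> pattern_space M \<Longrightarrow> M $ i = 0 \<Longrightarrow> z $ i = 0"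
  unfolding pattern_space_def by blast

lemma pattern_space_cluster:
  "z \<in> pattern_space M \<Longrightarrow> \<bar>M $ i\<bar> = \<bar>M $ j\<bar> \<Longrightarrow> sgn (M $ i) * z $ i = sgn (M $ j) * z $ j"
  unfolding pattern_space_def by blast

lemma pattern_spaceI:
  assumes "\<And>i. M $ i = 0 \<Longrightarrow> z $ i = 0"
    and "\<And>i j. \<bar>M $ i\<bar> = \<bar>M $ j\<bar> \<Longrightarrow> sgn (M $ i) * z $ i = sgn (M $ j) * z $ j"
  shows "z \<in> pattern_space M"
  using assms unfolding pattern_space_def by blast

lemma subspace_pattern_space: "subspace (pattern_space M)"
proof (rule subspaceI)
  show "0 \<in> pattern_space M" by (rule pattern_spaceI) auto
  show "x + y \<in> pattern_space M" if "x \<in> pattern_space M" "y \<in> pattern_space M" for x y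
    using that by (intro pattern_spaceI)
      (auto simp: pattern_space_zero distrib_left intro!: arg_cong2[where f="(+)"] pattern_space_cluster)
  show "c *\<^sub>R x \<in> pattern_space M" if x: "x \<in> pattern_space M" for c x
  proof (rule pattern_spaceI)
    fix i j assume "\<bar>M $ i\<bar> = \<bar>M $ j\<bar>"
    then have "c * (sgn (M $ i) * x $ i) = c * (sgn (M $ j) * x $ j)" using pattern_space_cluster[OF x] by metis
    then show "sgn (M $ i) * (c *\<^sub>R x) $ i = sgn (M $ j) * (c *\<^sub>R x) $ j" by (simp add: mult.left_commute)
  qed (use pattern_space_zero[OF x] in simp)
qed

lemma pattern_space_same_pattern:
  assumes "same_pattern a b" shows "pattern_space a = pattern_space b"
proof -
  have "sgn (a $ i) = sgn (b $ i)" for i using assms by (simp add: same_pattern_def)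
  then show ?thesis
    by (simp add: pattern_space_def same_pattern_zero_iff[OF assms] same_pattern_eq_iff[OF assms])
qed

lemma mem_pattern_space: "b \<in> pattern_space b"
proof -
  have "sgn y * y = \<bar>y\<bar>" for y :: real by (simp add: abs_sgn mult.commute)
  then show ?thesis by (simp add: pattern_space_def)
qed

text \<open>
  Signs of nonzero entries and strict inequalities between absolute values survive a small
  perturbation; zeros and ties survive because the perturbation lies in the pattern space.
\<close>

lemma eventually_same_pattern:
  "\<forall>\<^sub>F u in nhds 0. u \<in> pattern_space b \<longrightarrow> same_pattern b (b + u)"
proof -
  have lim: "((\<lambda>u. (b + u) $ i) \<longlongrightarrow> b $ i) (nhds 0)" for i
  proof -
    have "((\<lambda>u. (b + u) $ i) \<longlongrightarrow> (b + 0) $ i) (nhds 0)" by (intro tendsto_intros) (simp add: filterlim_ident)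
    then show ?thesis by simp
  qed
  have sg: "\<forall>\<^sub>F u in nhds 0. u \<in> pattern_space b \<longrightarrow> sgn ((b + u) $ i) = sgn (b $ i)" for i
  proof -
    consider "b $ i = 0" | "0 < b $ i" | "b $ i < 0" by linarith
    then show ?thesis
    proof cases
      case 1 then show ?thesis by (auto simp: pattern_space_def)
    next
      case 2
      from order_tendstoD(1)[OF lim 2] show ?thesis by eventually_elim (use 2 in auto)
    next
      case 3
      from order_tendstoD(2)[OF lim 3] show ?thesis by eventually_elim (use 3 in auto)
    qed
  qed
  then have sg': "\<forall>\<^sub>F u in nhds 0. \<forall>i. u \<in> pattern_space b \<longrightarrow> sgn ((b + u) $ i) = sgn (b $ i)"
    by (rule eventually_all_finite)
  have lt: "\<forall>\<^sub>F u in nhds 0. \<bar>b $ i\<bar> < \<bar>b $ j\<bar> \<longrightarrow> \<bar>(b + u) $ i\<bar> < \<bar>(b + u) $ j\<bar>" for i j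
  proof (cases "\<bar>b $ i\<bar> < \<bar>b $ j\<bar>")
    case True
    have "((\<lambda>u. \<bar>(b + u) $ j\<bar> - \<bar>(b + u) $ i\<bar>) \<longlongrightarrow> \<bar>b $ j\<bar> - \<bar>b $ i\<bar>) (nhds 0)"
      by (intro tendsto_diff tendsto_rabs lim)
    from order_tendstoD(1)[OF this, of 0] True show ?thesis by (auto elim: eventually_mono)
  qed simp
  then have "\<forall>\<^sub>F u in nhds 0. \<forall>i. \<forall>j. \<bar>b $ i\<bar> < \<bar>b $ j\<bar> \<longrightarrow> \<bar>(b + u) $ i\<bar> < \<bar>(b + u) $ j\<bar>"
    by (intro eventually_all_finite)
  with sg' show ?thesis
  proof eventually_elim
    case (elim u)
    show ?case
    proof
      assume u: "u \<in> pattern_space b"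
      have s: "sgn ((b + u) $ i) = sgn (b $ i)" for i using elim u by blast
      have a: "\<bar>(b + u) $ i\<bar> = \<bar>b $ i\<bar> + sgn (b $ i) * u $ i" for i
      proof -
        have "\<bar>(b + u) $ i\<bar> = sgn ((b + u) $ i) * (b + u) $ i" by (simp add: abs_sgn mult.commute)
        also have "\<dots> = sgn (b $ i) * b $ i + sgn (b $ i) * u $ i" unfolding s by (simp add: distrib_left)
        finally show ?thesis by (simp add: abs_sgn mult.commute)
      qed
      have "\<bar>b $ i\<bar> = \<bar>b $ j\<bar> \<Longrightarrow> \<bar>(b + u) $ i\<bar> = \<bar>(b + u) $ j\<bar>" for i j
        unfolding a using pattern_space_cluster[OF u, of i j] by simp
      then have "\<bar>b $ i\<bar> \<le> \<bar>b $ j\<bar> \<longleftrightarrow> \<bar>(b + u) $ i\<bar> \<le> \<bar>(b + u) $ j\<bar>" for i j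
        using elim(2) by (metis linorder_not_less order_le_less)
      then show "same_pattern b (b + u)" using s unfolding same_pattern_def by auto
    qed
  qed
qed

section \<open>The sorted weighted norm and its subdifferential\<close>

context
  fixes \<Lambda> :: "real ^ 'p::{finite,linorder}"
  assumes dp: "decreasing_positive \<Lambda>"
begin

lemma weights_decreasing_positive: "i < j \<Longrightarrow> \<Lambda> $ j < \<Lambda> $ i" "0 < \<Lambda> $ i"
  using dp unfolding decreasing_positive_def by auto

lemma sum_permuted_le_sorted:
  fixes b :: "real ^ 'p::{finite,linorder}"
  assumes "bij \<sigma>" "bij \<tau>" "\<And>i j. i < j \<Longrightarrow> \<bar>b $ \<sigma> j\<bar> \<le> \<bar>b $ \<sigma> i\<bar>"
  shows "(\<Sum>i\<in>UNIV. \<Lambda> $ i * \<bar>b $ \<tau> i\<bar>) \<le> (\<Sum>i\<in>UNIV. \<Lambda> $ i * \<bar>b $ \<sigma> i\<bar>)"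
proof -
  have "inv_into UNIV \<sigma> \<circ> \<tau> permutes UNIV"
    by (rule bij_imp_permutes) (simp_all add: bij_comp[OF assms(2) bij_imp_bij_inv[OF assms(1)]])
  then have "(\<Sum>i\<in>UNIV. \<Lambda> $ i * \<bar>b $ \<sigma> ((inv_into UNIV \<sigma> \<circ> \<tau>) i)\<bar>) \<le> (\<Sum>i\<in>UNIV. \<Lambda> $ i * \<bar>b $ \<sigma> i\<bar>)"
    by (rule rearrangement[OF finite]) (use assms(3) weights_decreasing_positive in \<open>auto simp: less_imp_le\<close>)
  moreover have "\<sigma> (inv_into UNIV \<sigma> x) = x" for x using assms(1) by (simp add: surj_f_inv_f bij_is_surj)
  ultimately show ?thesis by simp
qed

lemma J_sorted:
  assumes "bij \<tau>" "\<And>i j. i < j \<Longrightarrow> \<bar>b $ \<tau> j\<bar> \<le> \<bar>b $ \<tau> i\<bar>"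
  shows "J \<Lambda> b = (\<Sum>i\<in>UNIV. \<Lambda> $ i * \<bar>b $ \<tau> i\<bar>)"
proof -
  obtain \<sigma> where \<sigma>: "bij \<sigma>" "\<And>i. abs_sorted b $ i = \<bar>b $ \<sigma> i\<bar>" "\<And>i j. i < j \<Longrightarrow> \<bar>b $ \<sigma> j\<bar> \<le> \<bar>b $ \<sigma> i\<bar>"
    using abs_sorted_permutation[of b] by blast
  show ?thesis unfolding J_def \<sigma>(2)
    using sum_permuted_le_sorted[OF \<sigma>(1) assms(1) \<sigma>(3)] sum_permuted_le_sorted[OF assms(1) \<sigma>(1) assms(2)] by simp
qed

text \<open>
  Together with \<open>J_sorted\<close> this presents the norm as the maximum of the weighted sums over all
  arrangements.
\<close>

lemma sum_permuted_le_J: "bij \<tau> \<Longrightarrow> (\<Sum>i\<in>UNIV. \<Lambda> $ i * \<bar>b $ \<tau> i\<bar>) \<le> J \<Lambda> b"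
proof -
  assume \<tau>: "bij \<tau>"
  obtain \<sigma> where \<sigma>: "bij \<sigma>" "\<And>i. abs_sorted b $ i = \<bar>b $ \<sigma> i\<bar>" "\<And>i j. i < j \<Longrightarrow> \<bar>b $ \<sigma> j\<bar> \<le> \<bar>b $ \<sigma> i\<bar>"
    using abs_sorted_permutation[of b] by blast
  show ?thesis unfolding J_def \<sigma>(2) by (rule sum_permuted_le_sorted[OF \<sigma>(1) \<tau> \<sigma>(3)])
qed

lemma J_scale: assumes "0 \<le> c" shows "J \<Lambda> (c *\<^sub>R b) = c * J \<Lambda> b"
proof -
  obtain \<sigma> where \<sigma>: "bij \<sigma>" "\<And>i. abs_sorted b $ i = \<bar>b $ \<sigma> i\<bar>" "\<And>i j. i < j \<Longrightarrow> \<bar>b $ \<sigma> j\<bar> \<le> \<bar>b $ \<sigma> i\<bar>"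
    using abs_sorted_permutation[of b] by blast
  have "J \<Lambda> (c *\<^sub>R b) = (\<Sum>i\<in>UNIV. \<Lambda> $ i * \<bar>(c *\<^sub>R b) $ \<sigma> i\<bar>)"
    by (rule J_sorted[OF \<sigma>(1)]) (use \<sigma>(3) assms in \<open>auto simp: abs_mult intro!: mult_left_mono\<close>)
  then show ?thesis using assms J_sorted[OF \<sigma>(1,3)] by (simp add: abs_mult sum_distrib_left mult_ac)
qed

text \<open>
  By positive homogeneity the points $0$ and $2b$ are comparable with $b$; inserting them in the
  subgradient inequality gives $v \cdot b = J(b)$.
\<close>

lemma subdiff_J_iff: "v \<in> subdiff_J \<Lambda> b \<longleftrightarrow> (\<forall>z. v \<bullet> z \<le> J \<Lambda> z) \<and> v \<bullet> b = J \<Lambda> b"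
proof
  assume v: "v \<in> subdiff_J \<Lambda> b"
  then have *: "J \<Lambda> b + v \<bullet> (z - b) \<le> J \<Lambda> z" for z by (simp add: subdiff_J_def)
  have "v \<bullet> b = J \<Lambda> b"
    using *[of "0 *\<^sub>R b"] *[of "2 *\<^sub>R b"] by (simp only: J_scale) (simp add: inner_diff_right)
  then show "(\<forall>z. v \<bullet> z \<le> J \<Lambda> z) \<and> v \<bullet> b = J \<Lambda> b" using * by (simp add: inner_diff_right)
qed (auto simp: subdiff_J_def inner_diff_right)

text \<open>
  For signs $\pm 1$ and bijective \<open>\<tau>\<close> these are the vertices of the dual unit ball, the signed
  rearrangements of the weights; \<open>\<tau>\<close>
  sends the index of a weight to the position that receives it.
\<close>

definition vertex :: "('p \<Rightarrow> real) \<Rightarrow> ('p \<Rightarrow> 'p) \<Rightarrow> real ^ 'p::{finite,linorder}" where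
  "vertex s \<tau> = (\<chi> j. s j * \<Lambda> $ inv_into UNIV \<tau> j)"

text \<open>
  The signs are those of the entries, with a free choice at zero entries, and \<open>\<tau>\<close> enumerates
  the positions by decreasing absolute value, with a free choice within clusters. These two
  freedoms span the directions of the subdifferential.
\<close>

definition sorts :: "('p \<Rightarrow> real) \<Rightarrow> ('p \<Rightarrow> 'p) \<Rightarrow> real ^ 'p::{finite,linorder} \<Rightarrow> bool" where
  "sorts s \<tau> b \<longleftrightarrow> bij \<tau> \<and> (\<forall>j. \<bar>s j\<bar> = 1 \<and> s j * b $ j = \<bar>b $ j\<bar>) \<and> (\<forall>i j. i < j \<longrightarrow> \<bar>b $ \<tau> j\<bar> \<le> \<bar>b $ \<tau> i\<bar>)"

lemma sorts_exists: obtains s \<tau> where "sorts s \<tau> b"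
proof -
  obtain \<sigma> where \<sigma>: "bij \<sigma>" "\<And>i. abs_sorted b $ i = \<bar>b $ \<sigma> i\<bar>" "\<And>i j. i < j \<Longrightarrow> \<bar>b $ \<sigma> j\<bar> \<le> \<bar>b $ \<sigma> i\<bar>"
    using abs_sorted_permutation[of b] by blast
  then have "sorts (\<lambda>j. if 0 \<le> b $ j then 1 else -1) \<sigma> b" by (auto simp: sorts_def)
  then show ?thesis by (rule that)
qed

lemma inner_vertex: "bij \<tau> \<Longrightarrow> vertex s \<tau> \<bullet> z = (\<Sum>i\<in>UNIV. \<Lambda> $ i * (s (\<tau> i) * z $ \<tau> i))"
  unfolding vertex_def inner_vec_def
  by (subst sum.reindex_bij_betw[symmetric, of \<tau> UNIV UNIV]) (auto simp: bij_is_inj mult_ac)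

lemma inner_vertex_le:
  assumes "bij \<tau>" "\<And>j. \<bar>s j\<bar> = 1"
  shows "vertex s \<tau> \<bullet> z \<le> J \<Lambda> z"
proof -
  have "vertex s \<tau> \<bullet> z \<le> (\<Sum>i\<in>UNIV. \<Lambda> $ i * \<bar>z $ \<tau> i\<bar>)"
    unfolding inner_vertex[OF assms(1)]
  proof (intro sum_mono mult_left_mono)
    fix i show "s (\<tau> i) * z $ \<tau> i \<le> \<bar>z $ \<tau> i\<bar>"
      using abs_ge_self[of "s (\<tau> i) * z $ \<tau> i"] assms(2) by (simp add: abs_mult)
  qed (simp add: weights_decreasing_positive less_imp_le)
  also have "\<dots> \<le> J \<Lambda> z" by (rule sum_permuted_le_J[OF assms(1)])
  finally show ?thesis .
qed

lemma inner_vertex_sorts: "sorts s \<tau> b \<Longrightarrow> vertex s \<tau> \<bullet> b = J \<Lambda> b"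
  by (subst J_sorted[of \<tau>]) (auto simp: sorts_def inner_vertex)

lemma vertex_in_subdiff: "sorts s \<tau> b \<Longrightarrow> vertex s \<tau> \<in> subdiff_J \<Lambda> b"
  unfolding subdiff_J_iff using inner_vertex_sorts inner_vertex_le by (auto simp: sorts_def)

lemma sorts_same_pattern:
  assumes "same_pattern a b" "sorts s \<tau> a" shows "sorts s \<tau> b"
proof -
  have "s j * b $ j = \<bar>b $ j\<bar>" for j
  proof -
    have "s j * a $ j = \<bar>a $ j\<bar>" "\<bar>s j\<bar> = 1" "sgn (a $ j) = sgn (b $ j)"
      using assms by (auto simp: sorts_def same_pattern_def)
    then show ?thesis by (auto simp: sgn_if abs_if split: if_splits)
  qed
  then show ?thesis using assms by (auto simp: sorts_def same_pattern_def)
qed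

text \<open>
  Along the pattern space $J$ is linear near $M$, with the vertex as its gradient. A subgradient
  $v$ is dominated by $J$ and agrees with it at $M$, so its inner product with $z$ is at most
  that of the vertex; the same holds for $-z$.
\<close>

lemma subdiff_inner_pattern_space:
  assumes v: "v \<in> subdiff_J \<Lambda> M" and s: "sorts s \<tau> M" and z: "z \<in> pattern_space M"
  shows "v \<bullet> z = vertex s \<tau> \<bullet> z"
proof -
  have le: "v \<bullet> z \<le> vertex s \<tau> \<bullet> z" if z: "z \<in> pattern_space M" for z
  proof -
    have "((\<lambda>t. t *\<^sub>R z) \<longlongrightarrow> 0 *\<^sub>R z) (at_right 0)" by (intro tendsto_intros)
    then have "filterlim (\<lambda>t. t *\<^sub>R z) (nhds 0) (at_right 0)" by simp
    from eventually_compose_filterlim[OF eventually_same_pattern this]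
    have "\<forall>\<^sub>F t in at_right 0. t *\<^sub>R z \<in> pattern_space M \<longrightarrow> same_pattern M (M + t *\<^sub>R z)" .
    moreover have "\<forall>\<^sub>F t in at_right (0::real). 0 < t" by (simp add: eventually_at_right_less)
    ultimately have "\<forall>\<^sub>F t in at_right (0::real). v \<bullet> z \<le> vertex s \<tau> \<bullet> z"
    proof eventually_elim
      case (elim t)
      have "t *\<^sub>R z \<in> pattern_space M" using z by (rule subspace_scale[OF subspace_pattern_space])
      then have "sorts s \<tau> (M + t *\<^sub>R z)" using elim s sorts_same_pattern by blast
      then have "vertex s \<tau> \<bullet> (M + t *\<^sub>R z) = J \<Lambda> (M + t *\<^sub>R z)" by (rule inner_vertex_sorts)
      moreover have "v \<bullet> (M + t *\<^sub>R z) \<le> J \<Lambda> (M + t *\<^sub>R z)" "v \<bullet> M = J \<Lambda> M" using v unfolding subdiff_J_iff by auto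
      moreover have "vertex s \<tau> \<bullet> M = J \<Lambda> M" using s by (rule inner_vertex_sorts)
      ultimately have "t * (v \<bullet> z) \<le> t * (vertex s \<tau> \<bullet> z)" by (simp add: inner_add_right)
      then show ?case using elim(2) by simp
    qed
    then show ?thesis by (simp add: trivial_limit_at_right_real)
  qed
  have "- z \<in> pattern_space M" using z by (rule subspace_neg[OF subspace_pattern_space])
  from le[OF this] le[OF z] show ?thesis by simp
qed

text \<open>
  A vector $b$ with the pattern of $M$ lies in the pattern space of $M$, where every subgradient
  at $M$ acts like a vertex that serves both $M$ and $b$.
\<close>

lemma subdiff_same_pattern:
  assumes "same_pattern M b" and v: "v \<in> subdiff_J \<Lambda> M"
  shows "v \<in> subdiff_J \<Lambda> b"
proof -
  obtain s \<tau> where s: "sorts s \<tau> M" by (rule sorts_exists)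
  have "b \<in> pattern_space M" using mem_pattern_space pattern_space_same_pattern[OF assms(1)] by blast
  then have "v \<bullet> b = vertex s \<tau> \<bullet> b" by (rule subdiff_inner_pattern_space[OF v s])
  also have "\<dots> = J \<Lambda> b" using sorts_same_pattern[OF assms(1) s] by (rule inner_vertex_sorts)
  finally show ?thesis using v unfolding subdiff_J_iff by auto
qed

text \<open>
  Changing the sign of a vertex at a zero $i$ of $M$ moves it along $e_i$, and exchanging two
  positions $i$, $j$ of a cluster moves it along $s_i e_i - s_j e_j$. Both stay in the
  subdifferential, and the moves are nontrivial because the weights are positive and distinct.
\<close>

lemma pattern_space_if_constant_on_subdiff:
  assumes const: "\<And>v v'. v \<in> subdiff_J \<Lambda> M \<Longrightarrow> v' \<in> subdiff_J \<Lambda> M \<Longrightarrow> v \<bullet> z = v' \<bullet> z"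
  shows "z \<in> pattern_space M"
proof -
  obtain s \<tau> where s: "sorts s \<tau> M" by (rule sorts_exists)
  then have bij: "bij \<tau>" and abs_s: "\<And>j. \<bar>s j\<bar> = 1" and sM: "\<And>j. s j * M $ j = \<bar>M $ j\<bar>" by (auto simp: sorts_def)
  have zero: "z $ i = 0" if "M $ i = 0" for i
  proof -
    define s' where "s' = s(i := - s i)"
    have "sorts s' \<tau> M" using s that unfolding sorts_def s'_def by auto
    then have "0 = vertex s \<tau> \<bullet> z - vertex s' \<tau> \<bullet> z"
      using const[OF vertex_in_subdiff[OF s] vertex_in_subdiff] by simp
    also have "\<dots> = (\<Sum>j\<in>UNIV. (s j - s' j) * \<Lambda> $ inv_into UNIV \<tau> j * z $ j)"
      by (simp add: vertex_def inner_vec_def sum_subtractf[symmetric] left_diff_distrib)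
    also have "\<dots> = (\<Sum>j\<in>{i}. (s j - s' j) * \<Lambda> $ inv_into UNIV \<tau> j * z $ j)"
      by (rule sum.mono_neutral_right) (auto simp: s'_def)
    also have "\<dots> = 2 * s i * \<Lambda> $ inv_into UNIV \<tau> i * z $ i" by (simp add: s'_def)
    finally show ?thesis using abs_s[of i] weights_decreasing_positive(2)[of "inv_into UNIV \<tau> i"] by auto
  qed
  have eq: "sgn (M $ i) * z $ i = sgn (M $ j) * z $ j" if ij: "\<bar>M $ i\<bar> = \<bar>M $ j\<bar>" "M $ i \<noteq> 0" "i \<noteq> j" for i j
  proof -
    let ?t = "Transposition.transpose i j"
    define \<tau>' where "\<tau>' = ?t \<circ> \<tau>"
    have "\<bar>M $ ?t k\<bar> = \<bar>M $ k\<bar>" for k using ij by (auto simp: Transposition.transpose_def)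
    moreover have bij': "bij \<tau>'" unfolding \<tau>'_def by (intro bij_comp bij bij_transpose)
    ultimately have "sorts s \<tau>' M" using s unfolding sorts_def \<tau>'_def by auto
    then have "0 = vertex s \<tau> \<bullet> z - vertex s \<tau>' \<bullet> z"
      using const[OF vertex_in_subdiff[OF s] vertex_in_subdiff] by simp
    also have "inv_into UNIV \<tau>' k = inv_into UNIV \<tau> (?t k)" for k
      unfolding \<tau>'_def using bij by (subst o_inv_distrib) (auto simp: inv_transpose_eq)
    then have "vertex s \<tau> \<bullet> z - vertex s \<tau>' \<bullet> z = (\<Sum>k\<in>UNIV. s k * (\<Lambda> $ inv_into UNIV \<tau> k - \<Lambda> $ inv_into UNIV \<tau> (?t k)) * z $ k)"
      by (simp add: vertex_def inner_vec_def sum_subtractf[symmetric] algebra_simps)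
    also have "\<dots> = (\<Sum>k\<in>{i, j}. s k * (\<Lambda> $ inv_into UNIV \<tau> k - \<Lambda> $ inv_into UNIV \<tau> (?t k)) * z $ k)"
      by (rule sum.mono_neutral_right) (auto simp: Transposition.transpose_def)
    also have "\<dots> = (\<Lambda> $ inv_into UNIV \<tau> i - \<Lambda> $ inv_into UNIV \<tau> j) * (s i * z $ i - s j * z $ j)"
      using ij(3) by (simp add: algebra_simps)
    finally have "\<Lambda> $ inv_into UNIV \<tau> i = \<Lambda> $ inv_into UNIV \<tau> j \<or> s i * z $ i = s j * z $ j" by simp
    moreover have "inv_into UNIV \<tau> i \<noteq> inv_into UNIV \<tau> j" using ij(3) bij by (metis bij_is_surj surj_f_inv_f)
    then have "\<Lambda> $ inv_into UNIV \<tau> i \<noteq> \<Lambda> $ inv_into UNIV \<tau> j" using weights_decreasing_positive(1) by (metis less_irrefl neqE)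
    moreover have "sgn (M $ k) = s k" if "M $ k \<noteq> 0" for k
    proof -
      have "s k * M $ k = sgn (M $ k) * M $ k" using sM[of k] by (simp add: abs_sgn mult.commute)
      then show ?thesis using that by simp
    qed
    moreover have "M $ j \<noteq> 0" using ij by auto
    ultimately show ?thesis using ij(2) by simp
  qed
  show ?thesis
  proof (rule pattern_spaceI)
    fix i j assume "\<bar>M $ i\<bar> = \<bar>M $ j\<bar>"
    then show "sgn (M $ i) * z $ i = sgn (M $ j) * z $ j" using eq[of i j] by (cases "M $ i = 0 \<or> i = j") auto
  qed (use zero in auto)
qed

text \<open>
  The orthogonal complement of the direction space of the subdifferential is contained in the
  pattern space. Taking complements once more, everything orthogonal to the pattern space is a
  direction of the subdifferential.
\<close>

lemma affine_hull_subdiff: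
  assumes v: "v \<in> subdiff_J \<Lambda> M" and w: "\<And>z. z \<in> pattern_space M \<Longrightarrow> w \<bullet> z = 0"
  shows "v + w \<in> affine hull (subdiff_J \<Lambda> M)"
proof -
  define D where "D = span {x - v | x. x \<in> subdiff_J \<Lambda> M - {v}}"
  have "z \<in> pattern_space M" if z: "z \<in> D\<^sup>\<bottom>" for z
  proof (rule pattern_space_if_constant_on_subdiff)
    have "x \<bullet> z = v \<bullet> z" if "x \<in> subdiff_J \<Lambda> M" for x
    proof (cases "x = v")
      case False
      then have "x - v \<in> D" unfolding D_def using that by (intro span_base) auto
      then show ?thesis using z by (auto simp: orthogonal_comp_def real_inner_class.orthogonal_def inner_diff_left)
    qed simp
    then show "x \<bullet> z = x' \<bullet> z" if "x \<in> subdiff_J \<Lambda> M" "x' \<in> subdiff_J \<Lambda> M" for x x' using that by metis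
  qed
  then have "w \<in> D\<^sup>\<bottom>\<^sup>\<bottom>" using w unfolding orthogonal_comp_def[of "D\<^sup>\<bottom>"] by (auto simp: real_inner_class.orthogonal_def inner_commute)
  also have "D\<^sup>\<bottom>\<^sup>\<bottom> = D" unfolding D_def by (intro orthogonal_comp_self subspace_span)
  finally show ?thesis unfolding affine_hull_span[OF v] D_def by auto
qed

lemma rel_interior_subdiff_nhds:
  assumes "v \<in> rel_interior (subdiff_J \<Lambda> M)"
  obtains e where "0 < e" 
    "\<And>v'. dist v v' < e \<Longrightarrow> (\<And>z. z \<in> pattern_space M \<Longrightarrow> (v' - v) \<bullet> z = 0) \<Longrightarrow> v' \<in> subdiff_J \<Lambda> M"
proof -
  obtain e where e: "0 < e" "v \<in> subdiff_J \<Lambda> M" "ball v e \<inter> affine hull (subdiff_J \<Lambda> M) \<subseteq> subdiff_J \<Lambda> M"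
    using assms unfolding mem_rel_interior_ball by blast
  show ?thesis
  proof (rule that[OF e(1)])
    fix v' assume v': "dist v v' < e" "\<And>z. z \<in> pattern_space M \<Longrightarrow> (v' - v) \<bullet> z = 0"
    have "v + (v' - v) \<in> affine hull (subdiff_J \<Lambda> M)" by (rule affine_hull_subdiff[OF e(2) v'(2)])
    then show "v' \<in> subdiff_J \<Lambda> M" using e(3) v'(1) by auto
  qed
qed

end

section \<open>The irrepresentable vector\<close>

lemma infnorm_eq_Max: "infnorm (x :: real ^ 'p) = Max (range (\<lambda>i. \<bar>x $ i\<bar>))"
proof -
  have "(\<lambda>b. \<bar>x \<bullet> b\<bar>) ` Basis = range (\<lambda>i. \<bar>x $ i\<bar>)"
    by (auto simp: Basis_vec_def inner_axis image_iff)
  then show ?thesis by (simp add: infnorm_Max)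
qed

lemma pattern_size_abs_sorted: "pattern_size (abs_sorted M) = pattern_size M"
proof -
  obtain \<sigma> where \<sigma>: "bij \<sigma>" "\<And>i. abs_sorted M $ i = \<bar>M $ \<sigma> i\<bar>"
    using abs_sorted_permutation[of M] by blast
  have "range (\<lambda>i. \<bar>M $ \<sigma> i\<bar>) = (\<lambda>i. \<bar>M $ i\<bar>) ` range \<sigma>" by (simp add: image_image)
  also have "range \<sigma> = UNIV" using \<sigma>(1) by (rule bij_is_surj)
  finally show ?thesis by (simp add: pattern_size_def infnorm_eq_Max \<sigma>(2))
qed

lemma abs_rank_eq_iff: "abs_rank b i = abs_rank b j \<longleftrightarrow> \<bar>b $ i\<bar> = \<bar>b $ j\<bar>"
  using abs_rank_le_iff[of b i j] abs_rank_le_iff[of b j i] by linarith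

text \<open>
  Distinct absolute values have distinct ranks, so there are as many ranks as nonzero absolute
  values. Since no rank exceeds this number, no rank is skipped.
\<close>

lemma patt_attains:
  assumes "0 < m" "m \<le> pattern_size (patt b)"
  shows "\<exists>i. \<bar>patt b $ i\<bar> = real m"
proof -
  let ?A = "(\<lambda>i. \<bar>b $ i\<bar>) ` {i. b $ i \<noteq> 0}" and ?R = "abs_rank b ` {i. b $ i \<noteq> 0}"
  have "card ?A \<le> card ?R"
    by (rule card_image_le_if_factors) (simp_all add: abs_rank_eq_iff)
  moreover have "?R \<subseteq> {1..card ?A}"
  proof
    fix r assume "r \<in> ?R"
    then obtain i where i: "r = abs_rank b i" "b $ i \<noteq> 0" by auto
    have "r \<le> card ?A" unfolding i abs_rank_image by (intro card_mono) auto
    then show "r \<in> {1..card ?A}" using i abs_rank_eq_0_iff[of b i] by (simp add: Suc_le_eq)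
  qed
  ultimately have R: "?R = {1..card ?A}" by (intro card_seteq) simp_all
  have "infnorm (patt b) \<in> range (\<lambda>i. \<bar>patt b $ i\<bar>)" unfolding infnorm_eq_Max by (intro Max_in) auto
  then obtain i where "infnorm (patt b) = real (abs_rank b i)" by (auto simp: abs_patt)
  then have i: "pattern_size (patt b) = abs_rank b i" by (simp add: pattern_size_def)
  then have "b $ i \<noteq> 0" using assms abs_rank_eq_0_iff[of b i] by simp
  then have "abs_rank b i \<in> ?R" by blast
  then have "m \<in> ?R" unfolding R using assms i by auto
  then show ?thesis by (auto simp: abs_patt)
qed

lemma scalar_prod_eq_inner:
  fixes u w :: "real Matrix.vec"
  assumes "w \<in> carrier_vec CARD('p::{finite,linorder})"
  shows "scalar_prod u w = (vec_of_jnf u :: real ^ 'p::{finite,linorder}) \<bullet> vec_of_jnf w"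
proof -
  have "scalar_prod u w = (\<Sum>m<CARD('p). vec_index u m * vec_index w m)"
    using assms by (simp add: scalar_prod_def lessThan_atLeast0)
  also have "\<dots> = (\<Sum>i\<in>(UNIV :: 'p set). vec_index u (pos_of i) * vec_index w (pos_of i))"
    by (rule sum.reindex_bij_betw[OF bij_betw_pos_of, symmetric])
  finally show ?thesis by (simp add: inner_vec_def vec_of_jnf_def)
qed

lemma vec_of_jnf_mult_mat_vec:
  fixes C :: "real ^ 'p::{finite,linorder} ^ 'p::{finite,linorder}"
  assumes "x \<in> carrier_vec CARD('p)"
  shows "vec_of_jnf (mat_to_jnf C *\<^sub>v x) = C *v vec_of_jnf x"
proof -
  have "vec_index (mat_to_jnf C *\<^sub>v x) (pos_of i) = (\<Sum>j\<in>(UNIV :: 'p set). C $ i $ j * vec_index x (pos_of j))" for i :: 'p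
  proof -
    have "vec_index (mat_to_jnf C *\<^sub>v x) (pos_of i) = (\<Sum>m<CARD('p). C $ i $ index_at m * vec_index x m)"
      using assms pos_of_less_CARD[of i]
      by (simp add: mat_to_jnf_def scalar_prod_def lessThan_atLeast0 index_at_pos_of)
    also have "\<dots> = (\<Sum>j\<in>(UNIV :: 'p set). C $ i $ index_at (pos_of j) * vec_index x (pos_of j))"
      by (rule sum.reindex_bij_betw[OF bij_betw_pos_of, symmetric])
    finally show ?thesis by (simp add: index_at_pos_of)
  qed
  then show ?thesis by (simp add: vec_of_jnf_def matrix_vector_mult_def vec_eq_iff)
qed

lemma vec_of_jnf_pattern_matrix:
  fixes M :: "real ^ 'p::{finite,linorder}"
  assumes "y \<in> carrier_vec (pattern_size M)"
  shows "vec_of_jnf (pattern_matrix M *\<^sub>v y) $ i = 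
    sgn (M $ i) * (\<Sum>j<pattern_size M. (if \<bar>M $ i\<bar> = real (pattern_size M - j) then vec_index y j else 0))"
proof -
  have "vec_index (pattern_matrix M *\<^sub>v y) (pos_of i) =
    (\<Sum>j<pattern_size M. (if \<bar>M $ i\<bar> = real (pattern_size M - j) then sgn (M $ i) else 0) * vec_index y j)"
    using assms pos_of_less_CARD[of i]
    by (simp add: pattern_matrix_def scalar_prod_def lessThan_atLeast0 index_at_pos_of del: of_nat_diff cong: if_cong)
  also have "\<dots> = sgn (M $ i) * (\<Sum>j<pattern_size M. (if \<bar>M $ i\<bar> = real (pattern_size M - j) then vec_index y j else 0))"
    unfolding sum_distrib_left by (rule sum.cong[OF refl]) (simp del: of_nat_diff)
  finally show ?thesis by (simp add: vec_of_jnf_def del: of_nat_diff)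
qed

lemma pattern_matrix_in_pattern_space:
  assumes "y \<in> carrier_vec (pattern_size M)"
  shows "vec_of_jnf (pattern_matrix M *\<^sub>v y) \<in> pattern_space M"
proof (rule pattern_spaceI)
  fix i j :: 'a assume eq: "\<bar>M $ i\<bar> = \<bar>M $ j\<bar>"
  then have "sgn (M $ i) * sgn (M $ i) = sgn (M $ j) * sgn (M $ j)" by (auto simp: sgn_if split: if_splits)
  then show "sgn (M $ i) * vec_of_jnf (pattern_matrix M *\<^sub>v y) $ i = sgn (M $ j) * vec_of_jnf (pattern_matrix M *\<^sub>v y) $ j"
    unfolding vec_of_jnf_pattern_matrix[OF assms] eq mult.assoc[symmetric] by simp
qed (simp add: vec_of_jnf_pattern_matrix[OF assms])

text \<open>
  Every column has a nonzero entry in a row where all other columns vanish, because no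
  rank is skipped.
\<close>

lemma pattern_matrix_injective:
  fixes b :: "real ^ 'p::{finite,linorder}"
  defines "M \<equiv> patt b"
  assumes y: "y \<in> carrier_vec (pattern_size M)" and 0: "vec_of_jnf (pattern_matrix M *\<^sub>v y) = (0 :: real ^ 'p::{finite,linorder})"
  shows "y = 0\<^sub>v (pattern_size M)"
proof
  fix j assume "j < dim_vec (0\<^sub>v (pattern_size M))"
  then have j: "j < pattern_size M" by simp
  then obtain i where i: "\<bar>M $ i\<bar> = real (pattern_size M - j)" 
    unfolding M_def using patt_attains[of "pattern_size (patt b) - j" b] by auto
  have "0 = sgn (M $ i) * (\<Sum>l<pattern_size M. (if \<bar>M $ i\<bar> = real (pattern_size M - l) then vec_index y l else 0))"
    unfolding vec_of_jnf_pattern_matrix[OF y, symmetric] 0 by simp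
  also have "(\<Sum>l<pattern_size M. (if \<bar>M $ i\<bar> = real (pattern_size M - l) then vec_index y l else 0))
     = (\<Sum>l<pattern_size M. (if l = j then vec_index y l else 0))"
    using j by (intro sum.cong refl if_cong) (auto simp: i)
  also have "\<dots> = vec_index y j" using j by simp
  finally have "sgn (M $ i) = 0 \<or> vec_index y j = 0" by simp
  moreover have "M $ i \<noteq> 0" using i j by auto
  ultimately show "vec_index y j = vec_index (0\<^sub>v (pattern_size M)) j" using j by (simp add: sgn_zero_iff)
qed (use y in auto)

text \<open>
  The coefficient vector is $d = U y$ with $y = (U'CU)^{-1} \tilde\Lambda$, where the inverse exists
  since $y' U'CU y$ is the value of the positive definite form $C$ at $U y$ and $U$ is injective.
\<close>

lemma irrepresentable_vector_eq_mult:
  fixes C :: "real ^ 'p::{finite,linorder} ^ 'p::{finite,linorder}" and b :: "real ^ 'p::{finite,linorder}"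
  assumes pd: "\<And>z. z \<noteq> 0 \<Longrightarrow> 0 < z \<bullet> (C *v z)"
  shows "\<exists>d\<in>pattern_space (patt b). irrepresentable_vector C \<Lambda> (patt b) = C *v d"
proof -
  define M where "M = patt b"
  define k where "k = pattern_size M"
  define U where "U = pattern_matrix M"
  define A where "A = mat_to_jnf C"
  define w where "w = reduced_weights \<Lambda> M"
  let ?n = "CARD('p)"
  have U: "U \<in> carrier_mat ?n k" by (simp add: U_def k_def pattern_matrix_def)
  have A: "A \<in> carrier_mat ?n ?n" by (simp add: A_def mat_to_jnf_def)
  have w: "w \<in> carrier_vec k"
    unfolding w_def reduced_weights_def k_def carrier_vec_def
    by (simp add: pattern_matrix_def pattern_size_abs_sorted)
  let ?G = "U\<^sup>T * A * U"
  have UT: "U\<^sup>T \<in> carrier_mat k ?n" using U by simp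
  have G: "?G \<in> carrier_mat k k" using U A UT by (meson mult_carrier_mat)
  have "det ?G \<noteq> 0"
  proof
    assume "det ?G = 0"
    then obtain y where y: "y \<in> carrier_vec k" "y \<noteq> 0\<^sub>v k" "?G *\<^sub>v y = 0\<^sub>v k"
      using det_0_iff_vec_prod_zero_field[OF G] by blast
    define u where "u = U *\<^sub>v y"
    have u: "u \<in> carrier_vec ?n" using U y by (simp add: u_def)
    have Au: "A *\<^sub>v u \<in> carrier_vec ?n" using A u by simp
    have "?G *\<^sub>v y = (U\<^sup>T * A) *\<^sub>v u" unfolding u_def
      by (rule assoc_mult_mat_vec[OF mult_carrier_mat[OF UT A] U y(1)])
    also have "\<dots> = U\<^sup>T *\<^sub>v (A *\<^sub>v u)" by (rule assoc_mult_mat_vec[OF UT A u])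
    finally have "U\<^sup>T *\<^sub>v (A *\<^sub>v u) = 0\<^sub>v k" unfolding y(3) by (rule sym)
    then have "0 = scalar_prod (U\<^sup>T *\<^sub>v (A *\<^sub>v u)) y" using y(1) by simp
    also have "scalar_prod (U\<^sup>T *\<^sub>v (A *\<^sub>v u)) y = scalar_prod (A *\<^sub>v u) u"
      unfolding u_def using transpose_vec_mult_scalar[OF U y(1) Au] by (simp add: u_def)
    also have "\<dots> = (vec_of_jnf (A *\<^sub>v u) :: real ^ 'p::{finite,linorder}) \<bullet> vec_of_jnf u" by (rule scalar_prod_eq_inner[OF u])
    also have "\<dots> = vec_of_jnf u \<bullet> (C *v vec_of_jnf u)"
      unfolding A_def by (simp add: vec_of_jnf_mult_mat_vec[OF u] inner_commute)
    finally have "(vec_of_jnf u :: real ^ 'p::{finite,linorder}) = 0" using pd[of "vec_of_jnf u"] by fastforce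
    then have "y = 0\<^sub>v k" using pattern_matrix_injective[of y b] y(1) by (simp add: u_def U_def k_def M_def)
    then show False using y(2) by simp
  qed
  then have "?G \<in> Units (ring_mat TYPE(real) k ())" by (rule det_non_zero_imp_unit[OF G])
  then have "mat_inverse ?G \<noteq> None" using mat_inverse(1)[OF G, where b = "()"] by blast
  then obtain B where B: "mat_inverse ?G = Some B" by blast
  then have Bc: "B \<in> carrier_mat k k" using mat_inverse(2)[OF G] by blast
  have y: "B *\<^sub>v w \<in> carrier_vec k" using Bc w by simp
  have "irrepresentable_vector C \<Lambda> M = vec_of_jnf (A * U * B *\<^sub>v w)"
    by (simp add: irrepresentable_vector_def Let_def B[unfolded U_def A_def] U_def A_def w_def)
  also have "A * U * B *\<^sub>v w = (A * U) *\<^sub>v (B *\<^sub>v w)" by (rule assoc_mult_mat_vec[OF mult_carrier_mat[OF A U] Bc w])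
  also have "\<dots> = A *\<^sub>v (U *\<^sub>v (B *\<^sub>v w))" by (rule assoc_mult_mat_vec[OF A U y])
  also have "vec_of_jnf \<dots> = C *v vec_of_jnf (U *\<^sub>v (B *\<^sub>v w))"
    unfolding A_def using U y by (intro vec_of_jnf_mult_mat_vec) simp
  finally show ?thesis using pattern_matrix_in_pattern_space[of "B *\<^sub>v w" M] y
    unfolding U_def k_def M_def by blast
qed

section \<open>Recovery for a fixed realization of design and noise\<close>

text \<open>
  It suffices that $A V + V^\perp$ is the whole space. A vector orthogonal to this sum lies in
  $V$ and is annihilated by the quadratic form of $A$, hence vanishes.
\<close>

lemma exists_projected_solution:
  fixes A :: "real ^ 'n ^ 'n"
  assumes pd: "\<And>z. z \<noteq> 0 \<Longrightarrow> 0 < z \<bullet> (A *v z)" and V: "subspace V"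
  shows "\<exists>u\<in>V. \<forall>z\<in>V. (A *v u) \<bullet> z = r \<bullet> z"
proof -
  define S where "S = {a + t | a t. a \<in> (\<lambda>u. A *v u) ` V \<and> t \<in> V\<^sup>\<bottom>}"
  have sub: "subspace S" unfolding S_def
    by (intro subspace_sums subspace_orthogonal_comp linear_subspace_image[OF matrix_vector_mul_linear] V)
  have "y = 0" if y: "y \<in> S\<^sup>\<bottom>" for y
  proof (rule ccontr)
    assume "y \<noteq> 0"
    have inS: "s \<bullet> y = 0" if "s \<in> S" for s
      using y that unfolding orthogonal_comp_def real_inner_class.orthogonal_def by blast
    have "t \<bullet> y = 0" if t: "t \<in> V\<^sup>\<bottom>" for t
    proof -
      have "A *v 0 + t \<in> S" unfolding S_def using t subspace_0[OF V] by blast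
      then show ?thesis using inS by simp
    qed
    then have "y \<in> V\<^sup>\<bottom>\<^sup>\<bottom>" unfolding orthogonal_comp_def[of "V\<^sup>\<bottom>"] by (simp add: real_inner_class.orthogonal_def)
    then have "y \<in> V" using orthogonal_comp_self[OF V] by simp
    then have "A *v y + 0 \<in> S" unfolding S_def using subspace_0[OF subspace_orthogonal_comp] by blast
    then have "(A *v y) \<bullet> y = 0" using inS by simp
    then show False using pd[OF \<open>y \<noteq> 0\<close>] by (simp add: inner_commute)
  qed
  then have "S\<^sup>\<bottom> = {0}" using subspace_0[OF subspace_orthogonal_comp] by blast
  then have "S = UNIV" using orthogonal_comp_self[OF sub] by (simp add: orthogonal_comp_null)
  then obtain u t where "u \<in> V" "t \<in> V\<^sup>\<bottom>" "r = A *v u + t" unfolding S_def by blast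
  then show ?thesis
    by (intro bexI[of _ u]) (auto simp: inner_add_right orthogonal_comp_def real_inner_class.orthogonal_def inner_commute)
qed

lemma positive_definite_lower_bound:
  fixes A :: "real ^ 'n ^ 'n"
  assumes pd: "\<And>z. z \<noteq> 0 \<Longrightarrow> 0 < z \<bullet> (A *v z)"
  obtains c where "0 < c" "\<And>z. c * (norm z)\<^sup>2 \<le> z \<bullet> (A *v z)"
proof -
  have cont: "continuous_on (sphere 0 1) (\<lambda>z. z \<bullet> (A *v z))"
    by (intro continuous_intros linear_continuous_on linear_conv_bounded_linear[THEN iffD1] matrix_vector_mul_linear)
  have ne: "sphere (0 :: real ^ 'n) 1 \<noteq> {}" by simp
  obtain s where s: "s \<in> sphere 0 1" "\<And>z. z \<in> sphere 0 1 \<Longrightarrow> s \<bullet> (A *v s) \<le> z \<bullet> (A *v z)"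
    using continuous_attains_inf[OF compact_sphere ne cont] by blast
  show ?thesis
  proof (rule that)
    show "0 < s \<bullet> (A *v s)" using s(1) by (intro pd) auto
    fix z :: "real ^ 'n"
    show "s \<bullet> (A *v s) * (norm z)\<^sup>2 \<le> z \<bullet> (A *v z)"
    proof (cases "z = 0")
      case False
      define y where "y = (1 / norm z) *\<^sub>R z"
      have z: "norm z *\<^sub>R y = z" using False by (simp add: y_def)
      have "y \<in> sphere 0 1" using False by (simp add: y_def)
      from s(2)[OF this] have "s \<bullet> (A *v s) * (norm z)\<^sup>2 \<le> (y \<bullet> (A *v y)) * (norm z)\<^sup>2"
        by (intro mult_right_mono) auto
      also have "\<dots> = (norm z *\<^sub>R y) \<bullet> (A *v (norm z *\<^sub>R y))"
        by (simp add: matrix_vector_mult_scaleR power2_eq_square)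
      finally show ?thesis unfolding z .
    qed simp
  qed
qed

definition gram :: "nat \<Rightarrow> (nat \<Rightarrow> real ^ 'n) \<Rightarrow> real ^ 'n ^ 'n" where
  "gram n x = (\<chi> j k. (\<Sum>i<n. x i $ j * x i $ k) / real n)"

lemma inner_gram: "real n * ((gram n x *v u) \<bullet> z) = (\<Sum>i<n. (x i \<bullet> u) * (x i \<bullet> z))"
proof (cases "n = 0")
  case False
  have g: "real n * gram n x $ j $ k = (\<Sum>i<n. x i $ j * x i $ k)" for j k using False by (simp add: gram_def)
  have "real n * ((gram n x *v u) \<bullet> z) = (\<Sum>j\<in>UNIV. \<Sum>k\<in>UNIV. (real n * gram n x $ j $ k) * u $ k * z $ j)"
    by (simp add: matrix_vector_mult_def inner_vec_def sum_distrib_left sum_distrib_right mult_ac)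
  also have "\<dots> = (\<Sum>j\<in>UNIV. \<Sum>k\<in>UNIV. (\<Sum>i<n. x i $ j * x i $ k) * u $ k * z $ j)" unfolding g ..
  also have "\<dots> = (\<Sum>j\<in>UNIV. \<Sum>i<n. \<Sum>k\<in>UNIV. x i $ j * x i $ k * u $ k * z $ j)"
    unfolding sum_distrib_right by (subst sum.swap) (rule refl)
  also have "\<dots> = (\<Sum>i<n. \<Sum>j\<in>UNIV. \<Sum>k\<in>UNIV. x i $ j * x i $ k * u $ k * z $ j)"
    by (rule sum.swap)
  also have "\<dots> = (\<Sum>i<n. (x i \<bullet> u) * (x i \<bullet> z))"
  proof (rule sum.cong[OF refl])
    fix i
    have "(x i \<bullet> u) * (x i \<bullet> z) = (\<Sum>k\<in>UNIV. \<Sum>j\<in>UNIV. (x i $ k * u $ k) * (x i $ j * z $ j))"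
      by (simp add: inner_vec_def sum_product)
    also have "\<dots> = (\<Sum>j\<in>UNIV. \<Sum>k\<in>UNIV. (x i $ k * u $ k) * (x i $ j * z $ j))" by (rule sum.swap)
    finally show "(\<Sum>j\<in>UNIV. \<Sum>k\<in>UNIV. x i $ j * x i $ k * u $ k * z $ j) = (x i \<bullet> u) * (x i \<bullet> z)"
      by (simp add: mult_ac)
  qed
  finally show ?thesis .
qed simp

lemma inner_mult_le_sum_entries:
  fixes A :: "real ^ 'n ^ 'n"
  shows "\<bar>z \<bullet> (A *v u)\<bar> \<le> (\<Sum>j\<in>UNIV. \<Sum>k\<in>UNIV. \<bar>A $ j $ k\<bar>) * norm u * norm z"
proof -
  have "\<bar>z \<bullet> (A *v u)\<bar> \<le> (\<Sum>j\<in>UNIV. \<Sum>k\<in>UNIV. \<bar>z $ j * (A $ j $ k * u $ k)\<bar>)"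
    by (auto simp: inner_vec_def matrix_vector_mult_def sum_distrib_left intro!: order_trans[OF sum_abs] sum_mono)
  also have "\<dots> \<le> (\<Sum>j\<in>UNIV. \<Sum>k\<in>UNIV. \<bar>A $ j $ k\<bar> * (norm u * norm z))"
  proof (intro sum_mono)
    fix j k
    have "\<bar>z $ j\<bar> * \<bar>u $ k\<bar> \<le> norm z * norm u" by (intro mult_mono component_le_norm_cart) auto
    then have "\<bar>A $ j $ k\<bar> * (\<bar>z $ j\<bar> * \<bar>u $ k\<bar>) \<le> \<bar>A $ j $ k\<bar> * (norm z * norm u)" by (intro mult_left_mono) auto
    then show "\<bar>z $ j * (A $ j $ k * u $ k)\<bar> \<le> \<bar>A $ j $ k\<bar> * (norm u * norm z)" by (simp add: abs_mult mult_ac)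
  qed
  finally show ?thesis by (simp add: sum_distrib_right mult.assoc)
qed

text \<open>
  Expanding the squared residuals around $b$, the linear term cancels against the subgradient
  inequality, and the remaining quadratic term is positive unless $b' = b$.
\<close>

lemma slope_minimizer_unique:
  fixes x :: "nat \<Rightarrow> real ^ 'p::{finite,linorder}"
  assumes a: "0 < a" and v: "v \<in> subdiff_J \<Lambda> b"
    and grad: "\<And>z. a * (v \<bullet> z) = (\<Sum>i<n. (Y i - x i \<bullet> b) * (x i \<bullet> z))"
    and inj: "\<And>z. z \<noteq> 0 \<Longrightarrow> 0 < (\<Sum>i<n. (x i \<bullet> z)\<^sup>2)"
    and min: "b' \<in> slope_minimizers n x Y a \<Lambda>"
  shows "b' = b"
proof (rule ccontr)
  assume "b' \<noteq> b"
  define h where "h = b' - b"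
  have "J \<Lambda> b + v \<bullet> h \<le> J \<Lambda> b'" using v by (simp add: subdiff_J_def h_def)
  then have J: "a * J \<Lambda> b + a * (v \<bullet> h) \<le> a * J \<Lambda> b'"
    using a by (metis distrib_left mult_le_cancel_left_pos)
  have "(\<Sum>i<n. (Y i - x i \<bullet> b')\<^sup>2) = (\<Sum>i<n. (Y i - x i \<bullet> b)\<^sup>2 - 2 * ((Y i - x i \<bullet> b) * (x i \<bullet> h)) + (x i \<bullet> h)\<^sup>2)"
    by (intro sum.cong refl) (simp add: h_def inner_diff_right power2_eq_square algebra_simps)
  also have "\<dots> = (\<Sum>i<n. (Y i - x i \<bullet> b)\<^sup>2) - 2 * (a * (v \<bullet> h)) + (\<Sum>i<n. (x i \<bullet> h)\<^sup>2)"
    unfolding grad by (simp add: sum.distrib sum_subtractf sum_distrib_left)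
  finally have "slope_objective n x Y a \<Lambda> b + (\<Sum>i<n. (x i \<bullet> h)\<^sup>2) / 2 \<le> slope_objective n x Y a \<Lambda> b'"
    unfolding slope_objective_def using J by linarith
  moreover have "slope_objective n x Y a \<Lambda> b' \<le> slope_objective n x Y a \<Lambda> b"
    using min by (simp add: slope_minimizers_def)
  moreover have "0 < (\<Sum>i<n. (x i \<bullet> h)\<^sup>2)" using \<open>b' \<noteq> b\<close> by (intro inj) (simp add: h_def)
  ultimately show False by linarith
qed

lemma slope_pattern_recovery:
  fixes \<beta> \<Lambda> :: "real ^ 'p::{finite,linorder}" and x :: "nat \<Rightarrow> real ^ 'p::{finite,linorder}"
  assumes dp: "decreasing_positive \<Lambda>"
    and pd: "\<And>z. z \<noteq> 0 \<Longrightarrow> 0 < z \<bullet> (C *v z)"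
    and cov: "\<And>j k. (\<lambda>n. (\<Sum>i<n. x i $ j * x i $ k) / real n) \<longlonglongrightarrow> C $ j $ k"
    and noise: "\<And>j. (\<lambda>n. (\<Sum>i<n. x i $ j * e i) / \<alpha> n) \<longlonglongrightarrow> 0"
    and \<alpha>: "\<And>n. 0 < \<alpha> n" "(\<lambda>n. \<alpha> n / real n) \<longlonglongrightarrow> 0"
    and irr: "irrepresentable_vector C \<Lambda> (patt \<beta>) \<in> rel_interior (subdiff_J \<Lambda> (patt \<beta>))"
    and min: "\<forall>\<^sub>F n in sequentially. b n \<in> slope_minimizers n x (\<lambda>i. x i \<bullet> \<beta> + e i) (\<alpha> n) \<Lambda>"
  shows "\<forall>\<^sub>F n in sequentially. patt (b n) = patt \<beta>"
proof -
  let ?V = "pattern_space (patt \<beta>)"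
  obtain d where d: "d \<in> ?V" and irr_d: "irrepresentable_vector C \<Lambda> (patt \<beta>) = C *v d"
    using irrepresentable_vector_eq_mult[OF pd] by blast
  obtain r where r: "0 < r" "\<And>v. dist (C *v d) v < r \<Longrightarrow> (\<And>z. z \<in> ?V \<Longrightarrow> (v - C *v d) \<bullet> z = 0) \<Longrightarrow> v \<in> subdiff_J \<Lambda> (patt \<beta>)"
    using rel_interior_subdiff_nhds[OF dp irr[unfolded irr_d]] by blast
  obtain c where c: "0 < c" "\<And>z. c * (norm z)\<^sup>2 \<le> z \<bullet> (C *v z)"
    using positive_definite_lower_bound[OF pd] by blast
  define G where "G n = gram n x" for n
  define w where "w n = (\<chi> j. (\<Sum>i<n. x i $ j * e i) / \<alpha> n)" for n
  define \<delta> where "\<delta> n = (\<Sum>j\<in>UNIV. \<Sum>k\<in>UNIV. \<bar>(G n - C) $ j $ k\<bar>)" for n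
  have Glim: "(\<lambda>n. G n $ j $ k) \<longlonglongrightarrow> C $ j $ k" for j k using cov by (simp add: G_def gram_def)
  have "\<delta> \<longlonglongrightarrow> (\<Sum>j\<in>(UNIV :: 'p set). \<Sum>k\<in>(UNIV :: 'p set). \<bar>C $ j $ k - C $ j $ k\<bar>)"
    unfolding \<delta>_def vector_minus_component by (intro tendsto_sum tendsto_rabs tendsto_diff Glim tendsto_const)
  then have \<delta>: "\<delta> \<longlonglongrightarrow> 0" by simp
  have w: "w \<longlonglongrightarrow> 0" by (rule vec_tendstoI) (simp add: w_def noise)
  have "\<forall>\<^sub>F n in sequentially. \<delta> n < c / 2"
    by (rule order_tendstoD(2)[OF \<delta>]) (use c(1) in simp)
  then have Gpd0: "\<forall>\<^sub>F n in sequentially. \<forall>z. c / 2 * (norm z)\<^sup>2 \<le> z \<bullet> (G n *v z)"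
  proof eventually_elim
    case (elim n)
    show ?case
    proof
      fix z
      have "\<bar>z \<bullet> ((G n - C) *v z)\<bar> \<le> \<delta> n * norm z * norm z"
        unfolding \<delta>_def by (rule inner_mult_le_sum_entries)
      also have "\<dots> \<le> c / 2 * (norm z)\<^sup>2" using elim
        unfolding power2_eq_square mult.assoc by (intro mult_right_mono) auto
      finally have "\<bar>z \<bullet> (G n *v z) - z \<bullet> (C *v z)\<bar> \<le> c / 2 * (norm z)\<^sup>2"
        by (simp only: matrix_vector_mult_diff_rdistrib inner_diff_right)
      then show "c / 2 * (norm z)\<^sup>2 \<le> z \<bullet> (G n *v z)" using c(2)[of z] by linarith
    qed
  qed
  \<comment> \<open>The sample matrix is uniformly positive definite from some index on.\<close>
  define good where "good n \<longleftrightarrow> (\<forall>z. c / 2 * (norm z)\<^sup>2 \<le> z \<bullet> (G n *v z))" for n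
  have Gpd: "\<forall>\<^sub>F n in sequentially. good n" using Gpd0 unfolding good_def .
  have goodD: "c / 2 * (norm z)\<^sup>2 \<le> z \<bullet> (G n *v z)" if "good n" for n z
    using that unfolding good_def by blast
  have pdG: "0 < z \<bullet> (G n *v z)" if "good n" "z \<noteq> 0" for n z
  proof -
    have "0 < c / 2 * (norm z)\<^sup>2" using c(1) that(2) by simp
    also have "\<dots> \<le> z \<bullet> (G n *v z)" by (rule goodD[OF that(1)])
    finally show ?thesis .
  qed
  \<comment> \<open>The correction $u_n$ in the pattern space makes $w_n + C_n u_n - C d$ orthogonal to that space.\<close>
  have "\<exists>u. good n \<longrightarrow> (u \<in> ?V \<and> (\<forall>z\<in>?V. (G n *v u) \<bullet> z = (C *v d - w n) \<bullet> z))" for n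
    using exists_projected_solution[OF pdG subspace_pattern_space, of n] by blast
  then have "\<exists>u. \<forall>n. good n \<longrightarrow> (u n \<in> ?V \<and> (\<forall>z\<in>?V. (G n *v u n) \<bullet> z = (C *v d - w n) \<bullet> z))"
    by (intro choice allI)
  then obtain u where u: "\<And>n. good n \<Longrightarrow> u n \<in> ?V"
    "\<And>n z. good n \<Longrightarrow> z \<in> ?V \<Longrightarrow> (G n *v u n) \<bullet> z = (C *v d - w n) \<bullet> z"
    by blast
  \<comment> \<open>Testing the defining equation of $u_n$ with $u_n - d$ bounds this difference by the two errors.\<close>
  have "(\<lambda>n. u n - d) \<longlonglongrightarrow> 0"
  proof (rule Lim_null_comparison)
    show "\<forall>\<^sub>F n in sequentially. norm (u n - d) \<le> (2 / c) * (norm (w n) + \<delta> n * norm d)"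
      using Gpd
    proof eventually_elim
      case (elim n)
      define h where "h = u n - d"
      have h: "h \<in> ?V" unfolding h_def using u(1)[OF elim] d by (rule subspace_diff[OF subspace_pattern_space])
      have "c / 2 * norm h * norm h \<le> h \<bullet> (G n *v h)" using goodD[OF elim, of h] by (simp add: power2_eq_square mult.assoc)
      also have "\<dots> = - (w n \<bullet> h) - h \<bullet> ((G n - C) *v d)"
        using u(2)[OF elim h] unfolding h_def
        by (simp add: matrix_vector_mult_diff_distrib matrix_vector_mult_diff_rdistrib inner_diff_right inner_diff_left inner_commute algebra_simps)
      also have "\<dots> \<le> norm (w n) * norm h + \<delta> n * norm d * norm h"
        using Cauchy_Schwarz_ineq2[of "w n" h] inner_mult_le_sum_entries[of h "G n - C" d]
        unfolding \<delta>_def by linarith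
      finally have "(c / 2 * norm h) * norm h \<le> (norm (w n) + \<delta> n * norm d) * norm h" by (simp add: algebra_simps)
      moreover have "0 \<le> norm (w n) + \<delta> n * norm d" unfolding \<delta>_def by (intro add_nonneg_nonneg mult_nonneg_nonneg sum_nonneg) auto
      ultimately have "c / 2 * norm h \<le> norm (w n) + \<delta> n * norm d"
        by (cases "h = 0") (auto simp: mult_le_cancel_right)
      then show ?case using c(1) unfolding h_def by (simp add: field_simps)
    qed
    have "(\<lambda>n. (2 / c) * (norm (w n) + \<delta> n * norm d)) \<longlonglongrightarrow> (2 / c) * (norm (0 :: real ^ 'p::{finite,linorder}) + 0 * norm d)"
      by (intro tendsto_intros w \<delta>)
    then show "(\<lambda>n. (2 / c) * (norm (w n) + \<delta> n * norm d)) \<longlonglongrightarrow> 0" by simp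
  qed
  then have ulim: "u \<longlonglongrightarrow> d" by (simp add: LIM_zero_iff)
  define v where "v n = w n + G n *v u n" for n
  have "(\<lambda>n. G n *v u n) \<longlonglongrightarrow> C *v d"
    unfolding matrix_vector_mult_def
    by (intro vec_tendstoI) (auto intro!: tendsto_sum tendsto_mult Glim tendsto_vec_nth[OF ulim])
  then have "v \<longlonglongrightarrow> 0 + C *v d" unfolding v_def by (intro tendsto_add w)
  then have vlim: "v \<longlonglongrightarrow> C *v d" by simp
  \<comment> \<open>The candidate for the minimizer, with $v_n$ as its subgradient.\<close>
  define bt where "bt n = \<beta> - (\<alpha> n / real n) *\<^sub>R u n" for n
  have "(\<lambda>n. - ((\<alpha> n / real n) *\<^sub>R u n)) \<longlonglongrightarrow> - (0 *\<^sub>R d)" by (intro tendsto_intros \<alpha> ulim)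
  then have "filterlim (\<lambda>n. - ((\<alpha> n / real n) *\<^sub>R u n)) (nhds 0) sequentially" by simp
  from eventually_compose_filterlim[OF eventually_same_pattern[of \<beta>] this]
  have "\<forall>\<^sub>F n in sequentially. - ((\<alpha> n / real n) *\<^sub>R u n) \<in> pattern_space \<beta> \<longrightarrow> same_pattern \<beta> (bt n)"
    by (simp add: bt_def)
  moreover have "\<forall>\<^sub>F n in sequentially. dist (v n) (C *v d) < r" using vlim r(1) by (rule tendstoD)
  ultimately show ?thesis using Gpd min eventually_gt_at_top[of 0]
  proof eventually_elim
    case (elim n)
    have uV: "u n \<in> ?V" using u(1)[OF elim(3)] .
    have VV: "pattern_space \<beta> = ?V" by (rule pattern_space_same_pattern[OF same_pattern_patt])
    have "- ((\<alpha> n / real n) *\<^sub>R u n) \<in> ?V"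
      by (intro subspace_neg subspace_scale subspace_pattern_space uV)
    then have sp: "same_pattern \<beta> (bt n)" using elim(1) VV by simp
    have "v n \<in> subdiff_J \<Lambda> (patt \<beta>)"
    proof (rule r(2))
      show "dist (C *v d) (v n) < r" using elim(2) by (simp add: dist_commute)
      fix z assume "z \<in> ?V"
      then show "(v n - C *v d) \<bullet> z = 0" using u(2)[OF elim(3)] by (simp add: v_def inner_diff_left inner_add_left)
    qed
    then have vJ: "v n \<in> subdiff_J \<Lambda> (bt n)"
      by (rule subdiff_same_pattern[OF dp same_pattern_trans[OF same_pattern_sym[OF same_pattern_patt] sp]])
    \<comment> \<open>The subgradient $v_n$ was built so that the gradient of the squared loss at the candidate cancels it.\<close>
    have "b n = bt n"
    proof (rule slope_minimizer_unique[OF \<alpha>(1) vJ _ _ elim(4)])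
      fix z :: "real ^ 'p::{finite,linorder}"
      have w_inner: "\<alpha> n * (w n \<bullet> z) = (\<Sum>i<n. e i * (x i \<bullet> z))"
      proof -
        have "\<alpha> n * (w n \<bullet> z) = (\<Sum>j\<in>UNIV. (\<Sum>i<n. x i $ j * e i) * z $ j)"
          using \<alpha>(1)[of n] by (simp add: w_def inner_vec_def sum_distrib_left)
        also have "\<dots> = (\<Sum>i<n. \<Sum>j\<in>UNIV. x i $ j * e i * z $ j)"
          unfolding sum_distrib_right by (rule sum.swap)
        finally show ?thesis by (simp add: inner_vec_def sum_distrib_left mult_ac)
      qed
      have "\<alpha> n * (v n \<bullet> z) = \<alpha> n * (w n \<bullet> z) + (\<alpha> n / real n) * (real n * ((G n *v u n) \<bullet> z))"
        using elim(5) by (simp add: v_def inner_add_left algebra_simps)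
      also have "\<dots> = (\<Sum>i<n. e i * (x i \<bullet> z)) + (\<alpha> n / real n) * (\<Sum>i<n. (x i \<bullet> u n) * (x i \<bullet> z))"
        unfolding w_inner G_def inner_gram ..
      also have "\<dots> = (\<Sum>i<n. (x i \<bullet> \<beta> + e i - x i \<bullet> bt n) * (x i \<bullet> z))"
        unfolding sum_distrib_left sum.distrib[symmetric]
        by (intro sum.cong refl) (simp add: bt_def inner_diff_right algebra_simps)
      finally show "\<alpha> n * (v n \<bullet> z) = (\<Sum>i<n. (x i \<bullet> \<beta> + e i - x i \<bullet> bt n) * (x i \<bullet> z))" .
      assume "z \<noteq> 0"
      then have "0 < real n * ((G n *v z) \<bullet> z)" using pdG[OF elim(3)] elim(5) by (simp add: inner_commute)
      then show "0 < (\<Sum>i<n. (x i \<bullet> z)\<^sup>2)" unfolding G_def inner_gram by (simp add: power2_eq_square)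
    qed
    then show ?case using patt_eq_if_same_pattern[OF sp] by simp
  qed
qed

section \<open>The random design\<close>

text \<open>
  The two factors of each term are independent, so their joint law is the product of two laws
  that do not depend on the index, and the law of their product does not either.
\<close>

lemma (in prob_space) iid_mult_independent_families:
  fixes X :: "nat \<Rightarrow> 'a \<Rightarrow> 'b" and Y :: "nat \<Rightarrow> 'a \<Rightarrow> real"
  assumes indX: "indep_vars (\<lambda>_. S) X UNIV" and indY: "indep_vars (\<lambda>_. borel) Y UNIV"
    and ind: "indep_set
           (sets (vimage_algebra (space M) (\<lambda>w i. X i w) (Pi\<^sub>M UNIV (\<lambda>_. S))))
           (sets (vimage_algebra (space M) (\<lambda>w i. Y i w) (Pi\<^sub>M UNIV (\<lambda>_. borel))))"
    and X_same: "\<And>i. distr M S (X i) = D" and Y_same: "\<And>i. distr M borel (Y i) = D'"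
    and f[measurable]: "f \<in> borel_measurable S"
  shows "iid (\<lambda>i w. f (X i w) * Y i w)"
proof -
  have X[measurable]: "X i \<in> M \<rightarrow>\<^sub>M S" and Y[measurable]: "Y i \<in> borel_measurable M" for i
    using indX indY unfolding indep_vars_def2 by auto
  have "distr M borel (\<lambda>w. f (X i w) * Y i w) = distr (distr D borel f \<Otimes>\<^sub>M D') borel (\<lambda>(a, b). a * b)" for i
  proof -
    have "indep_var borel (\<lambda>w. f (X i w)) borel (\<lambda>w. Y i w)"
      using indep_var_if_families_indep[OF X Y ind f, of "\<lambda>y. y" borel i] by simp
    then have "distr M borel (\<lambda>w. f (X i w)) \<Otimes>\<^sub>M D' = distr M (borel \<Otimes>\<^sub>M borel) (\<lambda>w. (f (X i w), Y i w))"
      unfolding indep_var_distribution_eq Y_same by blast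
    moreover have "distr M borel (\<lambda>w. f (X i w)) = distr D borel f"
      unfolding X_same[of i, symmetric] by (subst distr_distr) (auto simp: comp_def)
    ultimately have "distr (distr D borel f \<Otimes>\<^sub>M D') borel (\<lambda>(a, b). a * b) = distr (distr M (borel \<Otimes>\<^sub>M borel) (\<lambda>w. (f (X i w), Y i w))) borel (\<lambda>(a, b). a * b)"
      by simp
    also have "\<dots> = distr M borel (\<lambda>w. f (X i w) * Y i w)"
      by (subst distr_distr) (auto simp: comp_def)
    finally show ?thesis by simp
  qed
  moreover have "indep_vars (\<lambda>_. borel) (\<lambda>i w. (\<lambda>(a, b). f a * b) (X i w, Y i w)) UNIV"
    by (rule indep_vars_compose2[OF indep_vars_Pair[OF indX indY ind]]) simp
  ultimately show ?thesis unfolding iid_def by simp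
qed

text \<open>
  The quadratic form of the matrix at $z$ is $E (z \cdot \xi)^2$.
\<close>

lemma second_moment_matrix_positive_definite:
  fixes \<xi> :: "'b \<Rightarrow> real ^ 'n"
  assumes [measurable]: "\<xi> \<in> borel_measurable Q"
    and sq: "\<And>i. integrable Q (\<lambda>w. (\<xi> w $ i)\<^sup>2)"
    and indep: "\<And>t. t \<noteq> 0 \<Longrightarrow> \<not> (AE w in Q. (\<Sum>i\<in>UNIV. t $ i * \<xi> w $ i) = 0)"
    and z: "z \<noteq> 0"
  shows "0 < z \<bullet> (second_moment_matrix Q \<xi> *v z)"
proof -
  have comp[measurable]: "(\<lambda>w. \<xi> w $ i) \<in> borel_measurable Q" for i
    by (rule measurable_compose[OF assms(1)]) (auto intro!: borel_measurable_continuous_onI continuous_intros)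
  have int: "integrable Q (\<lambda>w. \<xi> w $ j * \<xi> w $ k)" for j k
    by (rule integrable_mult_if_square_integrable[OF comp comp sq sq])
  let ?s = "\<lambda>w. \<Sum>i\<in>UNIV. z $ i * \<xi> w $ i"
  have s2: "(?s w)\<^sup>2 = (\<Sum>j\<in>UNIV. \<Sum>k\<in>UNIV. z $ j * z $ k * (\<xi> w $ j * \<xi> w $ k))" for w
    unfolding power2_eq_square sum_product by (intro sum.cong refl) (simp add: mult_ac)
  have int2: "integrable Q (\<lambda>w. (?s w)\<^sup>2)" unfolding s2 using int by auto
  have "z \<bullet> (second_moment_matrix Q \<xi> *v z) = (\<Sum>j\<in>UNIV. \<Sum>k\<in>UNIV. z $ j * z $ k * integral\<^sup>L Q (\<lambda>w. \<xi> w $ j * \<xi> w $ k))"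
    by (simp add: inner_vec_def matrix_vector_mult_def second_moment_matrix_def sum_distrib_left mult_ac)
  also have "\<dots> = integral\<^sup>L Q (\<lambda>w. (?s w)\<^sup>2)" unfolding s2 using int by simp
  finally have eq: "z \<bullet> (second_moment_matrix Q \<xi> *v z) = integral\<^sup>L Q (\<lambda>w. (?s w)\<^sup>2)" .
  have "integral\<^sup>L Q (\<lambda>w. (?s w)\<^sup>2) \<noteq> 0"
  proof
    assume "integral\<^sup>L Q (\<lambda>w. (?s w)\<^sup>2) = 0"
    then have "AE w in Q. (?s w)\<^sup>2 = 0" using integral_nonneg_eq_0_iff_AE[OF int2] by simp
    then show False using indep[OF z] by simp
  qed
  moreover have "0 \<le> integral\<^sup>L Q (\<lambda>w. (?s w)\<^sup>2)" by simp
  ultimately show ?thesis unfolding eq by linarith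
qed

theorem theorem4p3:
  fixes P :: "'w measure" and Q :: "'b measure"
    and \<beta> \<Lambda> :: "real ^ 'p::{finite,linorder}"
    and x :: "nat \<Rightarrow> 'w \<Rightarrow> real ^ 'p::{finite,linorder}"
    and \<epsilon> :: "nat \<Rightarrow> 'w \<Rightarrow> real"
    and \<xi> :: "'b \<Rightarrow> real ^ 'p::{finite,linorder}"
    and \<alpha> :: "nat \<Rightarrow> real"
    and \<beta>hat :: "nat \<Rightarrow> 'w \<Rightarrow> real ^ 'p::{finite,linorder}"
  assumes "prob_space P" and "prob_space Q"
    and "decreasing_positive \<Lambda>"
    \<comment> \<open>(A); \<open>\<epsilon> 0, \<dots>, \<epsilon> (n - 1)\<close> are the components of the error vector for sample size \<open>n\<close>\<close>
    and "prob_space.indep_vars P (\<lambda>_. borel) \<epsilon> UNIV"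
    and "\<And>i j. distr P borel (\<epsilon> i) = distr P borel (\<epsilon> j)"
    and "\<And>i. integrable P (\<epsilon> i)" and "\<And>i. integral\<^sup>L P (\<epsilon> i) = 0"
    and "\<And>i. integrable P (\<lambda>w. (\<epsilon> i w)\<^sup>2)"
    \<comment> \<open>(B'); \<open>x 0, \<dots>, x (n - 1)\<close> are the rows of the design matrix for sample size \<open>n\<close>,
      so, like the errors, the rows for different sample sizes come from one sequence\<close>
    and "prob_space.indep_vars P (\<lambda>_. borel) x UNIV"
    and "\<xi> \<in> borel_measurable Q"
    and "\<And>i. distr P borel (x i) = distr Q borel \<xi>"
    and "\<And>t. t \<noteq> 0 \<Longrightarrow> \<not> (AE w in Q. (\<Sum>i\<in>UNIV. t $ i * \<xi> w $ i) = 0)"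
    and "\<And>i. integrable Q (\<lambda>w. (\<xi> w $ i)\<^sup>2)"
    \<comment> \<open>(C)\<close>
    and "prob_space.indep_set P
           (sets (vimage_algebra (space P) (\<lambda>w i. x i w) (Pi\<^sub>M UNIV (\<lambda>_. borel))))
           (sets (vimage_algebra (space P) (\<lambda>w i. \<epsilon> i w) (Pi\<^sub>M UNIV (\<lambda>_. borel))))"
    and "\<And>n. 0 < \<alpha> n"
    and "(\<lambda>n. \<alpha> n / real n) \<longlonglongrightarrow> 0"
    and "filterlim (\<lambda>n. \<alpha> n / sqrt (real n * ln (ln (real n)))) at_top sequentially"
    and "\<And>n. n \<ge> CARD('p) \<Longrightarrow>
           AE w in P. \<beta>hat n w \<in> slope_minimizers n (\<lambda>i. x i w) (\<lambda>i. x i w \<bullet> \<beta> + \<epsilon> i w) (\<alpha> n) \<Lambda>"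
    and "irrepresentable_vector (second_moment_matrix Q \<xi>) \<Lambda> (patt \<beta>)
           \<in> rel_interior (subdiff_J \<Lambda> (patt \<beta>))"
  shows "AE w in P. eventually (\<lambda>n. patt (\<beta>hat n w) = patt \<beta>) sequentially"
proof -
  interpret P: prob_space P by fact
  interpret Q: prob_space Q by fact
  note indX = assms(9) and \<xi> = assms(10) and law = assms(11) and fam = assms(14)
  note indE = assms(4) and lawE = assms(5)
  note \<xi>[measurable]
  have xm[measurable]: "x i \<in> borel_measurable P" for i using indX unfolding P.indep_vars_def2 by auto
  have em[measurable]: "\<epsilon> i \<in> borel_measurable P" for i using indE unfolding P.indep_vars_def2 by auto
  have comp[measurable]: "(\<lambda>v :: real ^ 'p::{finite,linorder}. v $ j) \<in> borel_measurable borel" for j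
    by (auto intro!: borel_measurable_continuous_onI continuous_intros)
  have int_iff: "integrable P (\<lambda>w. f (x i w)) \<longleftrightarrow> integrable Q (\<lambda>w. f (\<xi> w))"
    if f: "f \<in> borel_measurable borel" for f :: "real ^ 'p::{finite,linorder} \<Rightarrow> real" and i
    using integrable_distr_eq[OF xm f] integrable_distr_eq[OF \<xi> f] law by simp
  have exp_eq: "integral\<^sup>L P (\<lambda>w. f (x i w)) = integral\<^sup>L Q (\<lambda>w. f (\<xi> w))"
    if f: "f \<in> borel_measurable borel" for f :: "real ^ 'p::{finite,linorder} \<Rightarrow> real" and i
    using integral_distr[OF xm f] integral_distr[OF \<xi> f] law by simp
  have x_sq: "integrable P (\<lambda>w. (x i w $ j)\<^sup>2)" for i j
    using int_iff[of "\<lambda>v. (v $ j)\<^sup>2"] assms(13) by simp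
  have x_prod: "integrable P (\<lambda>w. x i w $ j * x i w $ k)" for i j k
    by (rule integrable_mult_if_square_integrable[OF _ _ x_sq x_sq]) simp_all
  let ?C = "second_moment_matrix Q \<xi>"
  have pd: "0 < z \<bullet> (?C *v z)" if "z \<noteq> 0" for z
    by (rule second_moment_matrix_positive_definite[OF \<xi> assms(13) assms(12) that])
  have cov: "AE w in P. (\<lambda>n. (\<Sum>i<n. x i w $ j * x i w $ k) / real n) \<longlonglongrightarrow> ?C $ j $ k" for j k
  proof -
    have "P.iid (\<lambda>i w. x i w $ j * x i w $ k)"
      by (rule P.iid_composeI[OF indX law, of "\<lambda>v. v $ j * v $ k"]) simp
    from P.strong_law_of_large_numbers[OF this x_prod]
    show ?thesis using exp_eq[of "\<lambda>v. v $ j * v $ k" 0] by (simp add: second_moment_matrix_def)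
  qed
  have noise: "AE w in P. (\<lambda>n. (\<Sum>i<n. x i w $ j * \<epsilon> i w) / \<alpha> n) \<longlonglongrightarrow> 0" for j
  proof (rule P.sum_over_dominating_sequence_tendsto_0)
    show "P.iid (\<lambda>i w. x i w $ j * \<epsilon> i w)"
      using P.iid_mult_independent_families[OF indX indE fam law lawE[of _ 0], of "\<lambda>v. v $ j"] by simp
    have ind: "P.indep_var borel (\<lambda>w. x 0 w $ j) borel (\<epsilon> 0)"
      by (rule P.indep_var_if_families_indep[OF xm em fam, where f = "\<lambda>v. v $ j" and g = "\<lambda>y. y"]) simp_all
    have x1: "integrable P (\<lambda>w. x 0 w $ j)"
      by (rule P.square_integrable_imp_integrable[OF _ x_sq]) simp
    show "integrable P (\<lambda>w. x 0 w $ j * \<epsilon> 0 w)"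
      by (rule P.indep_var_integrable[OF ind x1 assms(6)])
    show "P.expectation (\<lambda>w. x 0 w $ j * \<epsilon> 0 w) = 0"
      using P.indep_var_lebesgue_integral[OF ind x1 assms(6)] assms(7) by simp
    have "P.indep_var borel (\<lambda>w. (x 0 w $ j)\<^sup>2) borel (\<lambda>w. (\<epsilon> 0 w)\<^sup>2)"
      by (rule P.indep_var_if_families_indep[OF xm em fam, where f = "\<lambda>v. (v $ j)\<^sup>2" and g = "\<lambda>y. y\<^sup>2"]) simp_all
    from P.indep_var_integrable[OF this x_sq assms(8)]
    show "integrable P (\<lambda>w. (x 0 w $ j * \<epsilon> 0 w)\<^sup>2)" by (simp add: power_mult_distrib)
  qed (rule assms(17))
  have "AE w in P. \<forall>j k. (\<lambda>n. (\<Sum>i<n. x i w $ j * x i w $ k) / real n) \<longlonglongrightarrow> ?C $ j $ k"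
    unfolding AE_all_countable using cov by blast
  moreover have "AE w in P. \<forall>j. (\<lambda>n. (\<Sum>i<n. x i w $ j * \<epsilon> i w) / \<alpha> n) \<longlonglongrightarrow> 0"
    unfolding AE_all_countable using noise by blast
  moreover have "AE w in P. \<forall>n. n \<ge> CARD('p) \<longrightarrow>
      \<beta>hat n w \<in> slope_minimizers n (\<lambda>i. x i w) (\<lambda>i. x i w \<bullet> \<beta> + \<epsilon> i w) (\<alpha> n) \<Lambda>"
    unfolding AE_all_countable using assms(18) by (auto simp: AE_conj_iff)
  ultimately show ?thesis
  proof eventually_elim
    case (elim w)
    show ?case
    proof (rule slope_pattern_recovery[OF assms(3) pd _ _ assms(15,16) assms(19)])
      show "\<forall>\<^sub>F n in sequentially. \<beta>hat n w \<in> slope_minimizers n (\<lambda>i. x i w) (\<lambda>i. x i w \<bullet> \<beta> + \<epsilon> i w) (\<alpha> n) \<Lambda>"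
        using elim(3) by (intro eventually_sequentiallyI[of "CARD('p)"]) blast
    qed (use elim in blast)+
  qed
qed

end
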